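(* Let $p \in (1, \infty)$. Suppose that an $L^p$-operator algebra $A$ has a cai $(e_t)_{t \in \Lambda}$ consisting of hermitian elements of $A^1$. Then $A$ is scaled.
   Context: An $L^p$-operator algebra is a (complex) Banach algebra isometrically isomorphic to a norm closed subalgebra of $B(L^p(X,\mu))$ for some measure space $(X,\mu)$. A unital Banach algebra is one with an identity of norm $1$. A cai is a contractive approximate identity (a net $(e_t)$ with $\|e_t\|\le1$, $e_ta\to a$, $ae_t\to a$ for all $a$). Approximately unital means having a cai. Multiplier unitization: for a nonunital approximately unital Banach algebra $A$, $A^1 = A + \mathbb{C}1$ with norm $\|a+\lambda 1\| = \sup\{\|ac+\lambda c\| : c \in A, \|c\|\le 1\}$; if $A$ is unital, $A^1 = A$. An element $a$ of a unital Banach algebra is hermitian if $\|\exp(i\lambda a)\|=1$ for all $\lambda\in\mathbb{R}$. A state on a unital Banach algebra is a linear functional $\omega$ with $\|\omega\| = \omega(1)=1$. A state on an approximately unital Banach algebra $A$ is a functional of norm $1$ on $A$ which is the restriction to $A$ of a state on $A^1$. The quasistate space is $Q(A) = \{\lambda\varphi : \lambda\in[0,1],\ \varphi \text{ a state on } A\}$. A nonunital approximately unital Banach algebra $A$ is scaled if the set of restrictions to $A$ of states on $A^1$ equals $Q(A)$; all unital Banach algebras are (regarded as) scaled. (Equivalently, in all cases: every $\varphi\in A^*$ with $\mathrm{Re}\,\varphi(a)\ge 0$ for all $a \in A$ satisfying $\mathrm{Re}\,\omega(a)\ge0$ for all states $\omega$ of $A^1$ is a nonnegative multiple of a state on $A$.)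 *)

theory Defs
  imports "HOL-Analysis.Analysis"
begin

section \<open>Complex Banach algebras\<close>

class complex_vector = real_vector +
  fixes scaleC :: "complex \<Rightarrow> 'a \<Rightarrow> 'a"  (infixr "*\<^sub>C" 75)
  assumes scaleC_add_right: "c *\<^sub>C (x + y) = c *\<^sub>C x + c *\<^sub>C y"
    and scaleC_add_left: "(c + d) *\<^sub>C x = c *\<^sub>C x + d *\<^sub>C x"
    and scaleC_scaleC: "c *\<^sub>C d *\<^sub>C x = (c * d) *\<^sub>C x"
    and scaleC_one: "1 *\<^sub>C x = x"
    and scaleR_scaleC: "r *\<^sub>R x = complex_of_real r *\<^sub>C x"

instantiation complex :: complex_vector
begin

definition scaleC_complex :: "complex \<Rightarrow> complex \<Rightarrow> complex"
  where "scaleC_complex c x = c * x"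

instance
  by standard (simp_all add: scaleC_complex_def algebra_simps scaleR_conv_of_real)

end

instantiation prod :: (complex_vector, complex_vector) complex_vector
begin

definition scaleC_prod :: "complex \<Rightarrow> 'a \<times> 'b \<Rightarrow> 'a \<times> 'b"
  where "scaleC_prod c x = (c *\<^sub>C fst x, c *\<^sub>C snd x)"

instance
  by standard (simp_all add: scaleC_prod_def scaleC_add_right scaleC_add_left
      scaleC_scaleC scaleC_one scaleR_scaleC scaleR_prod_def)

end

text \<open>No identity element is assumed.\<close>

class complex_banach_algebra = complex_vector + real_normed_algebra + banach +
  assumes norm_scaleC: "norm (c *\<^sub>C x) = cmod c * norm x"
    and mult_scaleC_left: "(c *\<^sub>C x) * y = c *\<^sub>C (x * y)"
    and mult_scaleC_right: "x * (c *\<^sub>C y) = c *\<^sub>C (x * y)"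

definition is_unit :: "'a::complex_banach_algebra \<Rightarrow> bool"
  where "is_unit u \<longleftrightarrow> (\<forall>a. u * a = a \<and> a * u = a) \<and> norm u = 1"

definition unital :: "'a::complex_banach_algebra itself \<Rightarrow> bool"
  where "unital _ \<longleftrightarrow> (\<exists>u::'a. is_unit u)"

section \<open>Contractive approximate identities\<close>

definition directed_set :: "'i set \<Rightarrow> ('i \<Rightarrow> 'i \<Rightarrow> bool) \<Rightarrow> bool"
  where "directed_set \<Lambda> le \<longleftrightarrow>
    \<Lambda> \<noteq> {} \<and> (\<forall>s\<in>\<Lambda>. le s s) \<and>
    (\<forall>r\<in>\<Lambda>. \<forall>s\<in>\<Lambda>. \<forall>t\<in>\<Lambda>. le r s \<longrightarrow> le s t \<longrightarrow> le r t) \<and>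
    (\<forall>r\<in>\<Lambda>. \<forall>s\<in>\<Lambda>. \<exists>t\<in>\<Lambda>. le r t \<and> le s t)"

text \<open>The filter of tails of a directed set; convergence along it is net convergence.\<close>

definition tail_filter :: "'i set \<Rightarrow> ('i \<Rightarrow> 'i \<Rightarrow> bool) \<Rightarrow> 'i filter"
  where "tail_filter \<Lambda> le = (INF s\<in>\<Lambda>. principal {t\<in>\<Lambda>. le s t})"

definition is_cai :: "'i set \<Rightarrow> ('i \<Rightarrow> 'i \<Rightarrow> bool) \<Rightarrow> ('i \<Rightarrow> 'a::complex_banach_algebra) \<Rightarrow> bool"
  where "is_cai \<Lambda> le e \<longleftrightarrow>
    directed_set \<Lambda> le \<and> (\<forall>t\<in>\<Lambda>. norm (e t) \<le> 1) \<and>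
    (\<forall>a. ((\<lambda>t. e t * a) \<longlongrightarrow> a) (tail_filter \<Lambda> le)) \<and>
    (\<forall>a. ((\<lambda>t. a * e t) \<longlongrightarrow> a) (tail_filter \<Lambda> le))"

section \<open>The multiplier unitization\<close>

text \<open>The pair \<open>(a, \<mu>)\<close> stands for \<open>a + \<mu>1\<close>, and \<open>a\<close> in the algebra is identified with \<open>(a, 0)\<close>.
  If the algebra is unital, the unitization is the algebra itself, that is, the set of pairs
  \<open>(a, 0)\<close>. Its norm is \<open>A1_norm\<close>, not the norm of the product type. In the nonunital case
  \<open>A1_norm\<close> is the intended norm only for approximately unital algebras.\<close>

definition A1_carrier :: "('a::complex_banach_algebra \<times> complex) set"
  where "A1_carrier = (if unital TYPE('a) then UNIV \<times> {0} else UNIV)"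

definition A1_one :: "'a::complex_banach_algebra \<times> complex"
  where "A1_one = (if unital TYPE('a) then ((THE u. is_unit u), 0) else (0, 1))"

definition A1_mult ::
    "'a::complex_banach_algebra \<times> complex \<Rightarrow> 'a \<times> complex \<Rightarrow> 'a \<times> complex"
  where "A1_mult x y =
    (fst x * fst y + snd x *\<^sub>C fst y + snd y *\<^sub>C fst x, snd x * snd y)"

definition A1_norm :: "'a::complex_banach_algebra \<times> complex \<Rightarrow> real"
  where "A1_norm x =
    (if unital TYPE('a) then norm (fst x)
     else (SUP c\<in>{c. norm c \<le> 1}. norm (fst x * c + snd x *\<^sub>C c)))"

fun A1_power :: "'a::complex_banach_algebra \<times> complex \<Rightarrow> nat \<Rightarrow> 'a \<times> complex"
  where
    "A1_power x 0 = A1_one"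
  | "A1_power x (Suc n) = A1_mult x (A1_power x n)"

definition A1_exp :: "'a::complex_banach_algebra \<times> complex \<Rightarrow> 'a \<times> complex"
  where "A1_exp x = (THE y. y \<in> A1_carrier \<and>
    (\<lambda>n. A1_norm ((\<Sum>k<n. complex_of_real (1 / fact k) *\<^sub>C A1_power x k) - y)) \<longlonglongrightarrow> 0)"

definition A1_hermitian :: "'a::complex_banach_algebra \<times> complex \<Rightarrow> bool"
  where "A1_hermitian x \<longleftrightarrow> x \<in> A1_carrier \<and>
    (\<forall>r::real. A1_norm (A1_exp ((\<i> * complex_of_real r) *\<^sub>C x)) = 1)"

section \<open>States and quasistates\<close>

text \<open>Only the values of \<open>\<omega>\<close> on \<open>A1_carrier\<close> matter. Boundedness is required separately
  because \<open>Sup\<close> of an unbounded set of reals is unspecified.\<close>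

definition A1_state :: "('a::complex_banach_algebra \<times> complex \<Rightarrow> complex) \<Rightarrow> bool"
  where "A1_state \<omega> \<longleftrightarrow>
    (\<forall>x\<in>A1_carrier. \<forall>y\<in>A1_carrier. \<omega> (x + y) = \<omega> x + \<omega> y) \<and>
    (\<forall>c. \<forall>x\<in>A1_carrier. \<omega> (c *\<^sub>C x) = c * \<omega> x) \<and>
    bdd_above ((\<lambda>x. cmod (\<omega> x)) ` {x\<in>A1_carrier. A1_norm x \<le> 1}) \<and>
    (SUP x\<in>{x\<in>A1_carrier. A1_norm x \<le> 1}. cmod (\<omega> x)) = 1 \<and>
    \<omega> A1_one = 1"

definition A1_restrict :: "('a \<times> complex \<Rightarrow> complex) \<Rightarrow> 'a::complex_banach_algebra \<Rightarrow> complex"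
  where "A1_restrict \<omega> = (\<lambda>a. \<omega> (a, 0))"

definition state :: "('a::complex_banach_algebra \<Rightarrow> complex) \<Rightarrow> bool"
  where "state \<phi> \<longleftrightarrow>
    bounded_linear \<phi> \<and> (\<forall>c a. \<phi> (c *\<^sub>C a) = c * \<phi> a) \<and> onorm \<phi> = 1 \<and>
    (\<exists>\<omega>. A1_state \<omega> \<and> \<phi> = A1_restrict \<omega>)"

definition quasistates :: "('a::complex_banach_algebra \<Rightarrow> complex) set"
  where "quasistates = {(\<lambda>a. complex_of_real l * \<phi> a) | l \<phi>. l \<in> {0..1} \<and> state \<phi>}"

definition scaled :: "'a::complex_banach_algebra itself \<Rightarrow> bool"
  where "scaled _ \<longleftrightarrow> unital TYPE('a) \<or>
    A1_restrict ` {\<omega>. A1_state \<omega>} = (quasistates :: ('a \<Rightarrow> complex) set)"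

section \<open>Operators on \<open>L\<^sup>p\<close> spaces\<close>

definition Lp_funs :: "real \<Rightarrow> 'x measure \<Rightarrow> ('x \<Rightarrow> complex) set"
  where "Lp_funs p M =
    {f \<in> borel_measurable M. integrable M (\<lambda>x. cmod (f x) powr p)}"

definition Lp_class :: "real \<Rightarrow> 'x measure \<Rightarrow> ('x \<Rightarrow> complex) \<Rightarrow> ('x \<Rightarrow> complex) set"
  where "Lp_class p M f = {g \<in> Lp_funs p M. AE x in M. g x = f x}"

definition Lp :: "real \<Rightarrow> 'x measure \<Rightarrow> ('x \<Rightarrow> complex) set set"
  where "Lp p M = Lp_class p M ` Lp_funs p M"

definition Lp_rep :: "('x \<Rightarrow> complex) set \<Rightarrow> 'x \<Rightarrow> complex"
  where "Lp_rep F = (SOME f. f \<in> F)"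

definition Lp_add ::
    "real \<Rightarrow> 'x measure \<Rightarrow> ('x \<Rightarrow> complex) set \<Rightarrow> ('x \<Rightarrow> complex) set \<Rightarrow> ('x \<Rightarrow> complex) set"
  where "Lp_add p M F G = Lp_class p M (\<lambda>x. Lp_rep F x + Lp_rep G x)"

definition Lp_scale ::
    "real \<Rightarrow> 'x measure \<Rightarrow> complex \<Rightarrow> ('x \<Rightarrow> complex) set \<Rightarrow> ('x \<Rightarrow> complex) set"
  where "Lp_scale p M c F = Lp_class p M (\<lambda>x. c * Lp_rep F x)"

definition Lp_norm :: "real \<Rightarrow> 'x measure \<Rightarrow> ('x \<Rightarrow> complex) set \<Rightarrow> real"
  where "Lp_norm p M F = (\<integral>x. cmod (Lp_rep F x) powr p \<partial>M) powr (1 / p)"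

type_synonym 'x Lp_op = "('x \<Rightarrow> complex) set \<Rightarrow> ('x \<Rightarrow> complex) set"

text \<open>Operators are extensional functions on \<open>Lp p M\<close>, so that equality of operators is
  equality in HOL.\<close>

definition Lp_ops :: "real \<Rightarrow> 'x measure \<Rightarrow> 'x Lp_op set"
  where "Lp_ops p M = {T \<in> Lp p M \<rightarrow>\<^sub>E Lp p M.
    (\<forall>F\<in>Lp p M. \<forall>G\<in>Lp p M. T (Lp_add p M F G) = Lp_add p M (T F) (T G)) \<and>
    (\<forall>c. \<forall>F\<in>Lp p M. T (Lp_scale p M c F) = Lp_scale p M c (T F)) \<and>
    (\<exists>C. \<forall>F\<in>Lp p M. Lp_norm p M (T F) \<le> C * Lp_norm p M F)}"

definition Lp_op_norm :: "real \<Rightarrow> 'x measure \<Rightarrow> 'x Lp_op \<Rightarrow> real"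
  where "Lp_op_norm p M T = (SUP F\<in>{F\<in>Lp p M. Lp_norm p M F \<le> 1}. Lp_norm p M (T F))"

definition Lp_op_add :: "real \<Rightarrow> 'x measure \<Rightarrow> 'x Lp_op \<Rightarrow> 'x Lp_op \<Rightarrow> 'x Lp_op"
  where "Lp_op_add p M S T = (\<lambda>F\<in>Lp p M. Lp_add p M (S F) (T F))"

definition Lp_op_scale :: "real \<Rightarrow> 'x measure \<Rightarrow> complex \<Rightarrow> 'x Lp_op \<Rightarrow> 'x Lp_op"
  where "Lp_op_scale p M c T = (\<lambda>F\<in>Lp p M. Lp_scale p M c (T F))"

definition Lp_op_mult :: "real \<Rightarrow> 'x measure \<Rightarrow> 'x Lp_op \<Rightarrow> 'x Lp_op \<Rightarrow> 'x Lp_op"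
  where "Lp_op_mult p M S T = compose (Lp p M) S T"

definition closed_subalgebra :: "real \<Rightarrow> 'x measure \<Rightarrow> 'x Lp_op set \<Rightarrow> bool"
  where "closed_subalgebra p M B \<longleftrightarrow>
    B \<subseteq> Lp_ops p M \<and> B \<noteq> {} \<and>
    (\<forall>S\<in>B. \<forall>T\<in>B. Lp_op_add p M S T \<in> B) \<and>
    (\<forall>c. \<forall>T\<in>B. Lp_op_scale p M c T \<in> B) \<and>
    (\<forall>S\<in>B. \<forall>T\<in>B. Lp_op_mult p M S T \<in> B) \<and>
    (\<forall>T\<in>Lp_ops p M.
      (\<forall>\<epsilon>>0. \<exists>S\<in>B. Lp_op_norm p M (Lp_op_add p M T (Lp_op_scale p M (-1) S)) < \<epsilon>)
        \<longrightarrow> T \<in> B)"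

text \<open>The measure space is a parameter: an existential quantifier over measure spaces would have
  to range over types. As a hypothesis with \<open>M\<close> universally quantified this is equivalent.\<close>

definition Lp_operator_algebra ::
    "real \<Rightarrow> 'x measure \<Rightarrow> 'a::complex_banach_algebra itself \<Rightarrow> bool"
  where "Lp_operator_algebra p M _ \<longleftrightarrow>
    (\<exists>B (\<pi> :: 'a \<Rightarrow> 'x Lp_op). closed_subalgebra p M B \<and> bij_betw \<pi> UNIV B \<and>
      (\<forall>a b. \<pi> (a + b) = Lp_op_add p M (\<pi> a) (\<pi> b)) \<and>
      (\<forall>c a. \<pi> (c *\<^sub>C a) = Lp_op_scale p M c (\<pi> a)) \<and>
      (\<forall>a b. \<pi> (a * b) = Lp_op_mult p M (\<pi> a) (\<pi> b)) \<and>
      (\<forall>a. Lp_op_norm p M (\<pi> a) = norm a))"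

end

theory Submission
  imports Defs
begin

text \<open>
  Let \<open>E\<close> be the closure of \<open>A L\<^sup>p\<close>; it is the range of the contractive projection \<open>lim e\<^sub>t\<close>, and
  \<open>A\<^sup>1\<close> acts isometrically on it. The duality map \<open>f \<mapsto> \<bar>f\<bar>\<^sup>p\<^sup>-\<^sup>2 cnj f\<close> sends \<open>E\<close> onto the analogous
  subspace of \<open>L\<^sup>q\<close>. Differentiating it, one finds for \<open>p \<noteq> 2\<close> that \<open>f, g \<in> E\<close> implies
  \<open>\<bar>f\<bar> sgn g \<in> E\<close>, so \<open>E\<close> is closed under truncations. A hermitian \<open>h\<close> has real numerical range
  \<open>\<langle>h f, \<bar>f\<bar>\<^sup>p\<^sup>-\<^sup>2 cnj f\<rangle>\<close>; applied to \<open>f + z g\<close> with \<open>f, g\<close> disjoint, homogeneity in \<open>z\<close> (of degree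
  \<open>p - 1\<close> in one cross term, of degree 1 in the other) forces both cross terms to vanish, so \<open>h\<close> preserves
  supports and acts as multiplication by a real function. If \<open>p = 2\<close>, then \<open>h\<close> is selfadjoint.

  In both cases \<open>x \<mapsto> h\<^sup>2 x h\<^sup>2 + 1 - h\<^sup>2\<close> maps the unit ball of \<open>A\<^sup>1\<close> into itself if \<open>\<parallel>h\<parallel> \<le> 1\<close>. Hence
  \<open>\<bar>\<omega> (h\<^sup>2 x h\<^sup>2)\<bar> \<le> Re \<omega> (h\<^sup>2)\<close> for every state \<open>\<omega>\<close> and \<open>\<parallel>x\<parallel> \<le> 1\<close>. With \<open>h = e\<^sub>t\<close> this shows
  \<open>\<phi> (e\<^sub>t\<^sup>2) \<rightarrow> \<parallel>\<phi>\<parallel>\<close> for the restriction \<open>\<phi>\<close> of \<open>\<omega>\<close> to \<open>A\<close>, and then \<open>\<bar>\<phi> a + l \<parallel>\<phi>\<parallel>\<bar> \<le> \<parallel>\<phi>\<parallel>\<close> whenever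
  \<open>\<parallel>a + l1\<parallel> \<le> 1\<close>: the functional \<open>a + l1 \<mapsto> \<phi> a / \<parallel>\<phi>\<parallel> + l\<close> is a state.
\<close>

section \<open>The duality map of \<open>L\<^sup>p\<close>\<close>

text \<open>On all of \<open>L^p\<close> the element \<open>a + l1\<close> may have too large a
  norm; on \<open>E\<close> it has exactly the norm of the unitization. Squares are used because a
  hermitian element may have negative spectrum. With \<open>s = h^2\<close> and \<open>m\<close> the
  multiplier of \<open>h\<close>, writing \<open>|u|^p = m^2 |u|^p + (1 - m^2) |u|^p\<close> splits
  the mass of \<open>u\<close> between the two summands of \<open>s x s + (1 - s)\<close>; a similar
  split on the dual side makes the two Young estimates add up without loss. Fourth powers are needed
  as well: for \<open>x = a + l1\<close> the bound on \<open>\<omega> (s x s)\<close> contains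
  \<open>l \<omega> (s^2)\<close>, and the limit of \<open>\<omega> (s^2)\<close> comes from the
  same estimate with \<open>s^2\<close> in place of \<open>s\<close>. Hermiticity enters only
  through \<open>\<parallel>1 + \<i> r h\<parallel> \<le> 1 + r^2\<close>, the exponential series
  cut off after its linear term. The zero functional is a quasistate only when some state exists, so
  one state is built from a vector of \<open>E\<close>.\<close>

definition lp_dual :: "real \<Rightarrow> complex \<Rightarrow> complex"
  where "lp_dual p z = complex_of_real (cmod z powr (p - 1)) * cnj (sgn z)"

text \<open>The \<open>p\<close>-th power of the norm. No root is taken, so masses of disjoint
  pieces add and Young's inequality can take the place of Hoelder's.\<close>

definition mass :: "real \<Rightarrow> 'x measure \<Rightarrow> ('x \<Rightarrow> complex) \<Rightarrow> real"
  where "mass p M f = (\<integral>x. cmod (f x) powr p \<partial>M)"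

text \<open>Bilinear, without a conjugate; the conjugation is part of \<open>lp_dual\<close>. This
  keeps the sides \<open>p\<close> and \<open>q\<close> symmetric.\<close>

definition pairing :: "'x measure \<Rightarrow> ('x \<Rightarrow> complex) \<Rightarrow> ('x \<Rightarrow> complex) \<Rightarrow> complex"
  where "pairing M f g = (\<integral>x. f x * g x \<partial>M)"

lemma norm_lp_dual: "cmod (lp_dual p z) = cmod z powr (p - 1)"
  by (cases "z = 0") (simp_all add: lp_dual_def norm_mult norm_sgn)

lemma lp_dual_0 [simp]: "lp_dual p 0 = 0"
  by (simp add: lp_dual_def)

lemma lp_dual_1 [simp]: "lp_dual p 1 = 1"
  by (simp add: lp_dual_def)

lemma mult_lp_dual: "z * lp_dual p z = complex_of_real (cmod z powr p)"
proof (cases "z = 0")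
  case False
  have "z * cnj (sgn z) = complex_of_real (cmod z)"
    using False complex_norm_square[of z]
    by (simp add: sgn_eq power2_eq_square nonzero_divide_eq_eq)
  moreover have "cmod z * cmod z powr (p - 1) = cmod z powr p"
    using False powr_mult_base[of "cmod z" "p - 1"] by simp
  ultimately show ?thesis
    unfolding lp_dual_def by (metis mult.left_commute mult.commute of_real_mult)
qed simp

lemma sgn_mult_complex: "sgn (w * z :: complex) = sgn w * sgn z"
  by (simp add: sgn_eq norm_mult)

lemma lp_dual_mult: "lp_dual p (w * z) = lp_dual p w * lp_dual p z"
  by (simp add: lp_dual_def norm_mult powr_mult sgn_mult_complex)

lemma lp_dual_2: "lp_dual 2 z = cnj z"
  using complex_sgn_def[of z] by (cases "z = 0") (simp_all add: lp_dual_def scaleR_conv_of_real)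

lemma continuous_lp_dual:
  assumes "1 < p"
  shows "continuous_on UNIV (lp_dual p)"
proof -
  have "isCont (lp_dual p) z" for z
  proof (cases "z = 0")
    case True
    have "((\<lambda>z. cmod z powr (p - 1)) \<longlongrightarrow> 0) (at 0)"
      using assms by (auto intro!: tendsto_eq_intros)
    then have "(lp_dual p \<longlongrightarrow> 0) (at 0)"
      by (intro tendsto_norm_zero_cancel[of "lp_dual p"]) (simp add: norm_lp_dual)
    then show ?thesis
      using True by (simp add: isCont_def)
  next
    case False
    have "isCont (\<lambda>z. complex_of_real (cmod z powr (p - 1)) * cnj (z / complex_of_real (cmod z))) z"
      using False by (intro continuous_intros) auto
    moreover have "lp_dual p = (\<lambda>z. complex_of_real (cmod z powr (p - 1)) * cnj (z / complex_of_real (cmod z)))"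
      by (simp add: fun_eq_iff lp_dual_def sgn_eq)
    ultimately show ?thesis by simp
  qed
  then show ?thesis
    by (simp add: continuous_at_imp_continuous_on)
qed

lemma measurable_lp_dual [measurable]:
  assumes "1 < p"
  shows "lp_dual p \<in> borel_measurable borel"
  using continuous_lp_dual[OF assms] by (rule borel_measurable_continuous_onI)

lemma borel_measurable_cnj [measurable]: "cnj \<in> borel_measurable borel"
  by (intro borel_measurable_continuous_onI continuous_intros)

lemma unimodular_rotation:
  obtains w where "cmod w = 1" "w * v = complex_of_real (cmod v)"
proof
  let ?w = "if v = 0 then 1 else cnj (sgn v)"
  show "cmod ?w = 1" by (simp add: norm_sgn)
  show "?w * v = complex_of_real (cmod v)"
    using complex_norm_square[of v] by (simp add: sgn_eq power2_eq_square field_simps)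
qed

section \<open>Functions with integrable p-th power\<close>

lemma powr_add_le:
  fixes a b p :: real
  assumes "0 \<le> a" "0 \<le> b" "0 < p"
  shows "(a + b) powr p \<le> 2 powr p * (a powr p + b powr p)"
proof -
  have "(a + b) powr p \<le> (2 * max a b) powr p"
    using assms by (intro powr_mono2) auto
  also have "\<dots> = 2 powr p * max a b powr p"
    using assms by (simp add: powr_mult)
  also have "\<dots> \<le> 2 powr p * (a powr p + b powr p)"
    by (intro mult_left_mono) (auto simp: max_def)
  finally show ?thesis .
qed

lemma Lp_funsD:
  assumes "f \<in> Lp_funs p M"
  shows "f \<in> borel_measurable M" "integrable M (\<lambda>x. cmod (f x) powr p)"
  using assms by (auto simp: Lp_funs_def)

lemma Lp_funs_measurable [measurable_dest]:
  "f \<in> Lp_funs p M \<Longrightarrow> f \<in> borel_measurable M"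
  by (rule Lp_funsD)

lemma Lp_funs_bound:
  assumes "f \<in> borel_measurable M" "integrable M (\<lambda>x. w x powr p)" "0 < p"
    and "AE x in M. cmod (f x) \<le> w x"
  shows "f \<in> Lp_funs p M"
proof -
  have "integrable M (\<lambda>x. cmod (f x) powr p)"
    using assms(2)
  proof (rule Bochner_Integration.integrable_bound)
    show "AE x in M. norm (cmod (f x) powr p) \<le> norm (w x powr p)"
      using assms(4) by eventually_elim (use assms(3) in \<open>auto intro!: powr_mono2\<close>)
  qed (use assms(1) in measurable)
  then show ?thesis using assms(1) by (simp add: Lp_funs_def)
qed

lemma Lp_funs_add_integrable:
  assumes "f \<in> Lp_funs p M" "g \<in> Lp_funs p M" "0 < p"
  shows "integrable M (\<lambda>x. (cmod (f x) + cmod (g x)) powr p)"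
proof (rule Bochner_Integration.integrable_bound)
  show "integrable M (\<lambda>x. 2 powr p * (cmod (f x) powr p + cmod (g x) powr p))"
    using assms by (auto dest!: Lp_funsD)
  show "(\<lambda>x. (cmod (f x) + cmod (g x)) powr p) \<in> borel_measurable M"
    using assms by measurable
  show "AE x in M. norm ((cmod (f x) + cmod (g x)) powr p)
      \<le> norm (2 powr p * (cmod (f x) powr p + cmod (g x) powr p))"
    using powr_add_le assms(3) by auto
qed

lemma Lp_funs_bound_add:
  assumes "h \<in> borel_measurable M" "f \<in> Lp_funs p M" "g \<in> Lp_funs p M" "0 < p"
    and "AE x in M. cmod (h x) \<le> cmod (f x) + cmod (g x)"
  shows "h \<in> Lp_funs p M"
  using Lp_funs_bound[OF assms(1) Lp_funs_add_integrable[OF assms(2-4)] assms(4,5)] .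

lemma Lp_funs_bound_fun:
  assumes "h \<in> borel_measurable M" "f \<in> Lp_funs p M" "0 < p"
    and "AE x in M. cmod (h x) \<le> cmod (f x)"
  shows "h \<in> Lp_funs p M"
  using Lp_funs_bound[OF assms(1) Lp_funsD(2)[OF assms(2)] assms(3,4)] .

lemma Lp_funs_add:
  assumes "f \<in> Lp_funs p M" "g \<in> Lp_funs p M" "0 < p"
  shows "(\<lambda>x. f x + g x) \<in> Lp_funs p M"
proof (rule Lp_funs_bound_add[OF _ assms])
  show "(\<lambda>x. f x + g x) \<in> borel_measurable M"
    using assms by measurable
qed (auto intro: norm_triangle_ineq)

lemma Lp_funs_scale:
  assumes "f \<in> Lp_funs p M"
  shows "(\<lambda>x. c * f x) \<in> Lp_funs p M"
  using assms by (auto simp: Lp_funs_def norm_mult powr_mult)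

lemma Lp_funs_diff:
  assumes "f \<in> Lp_funs p M" "g \<in> Lp_funs p M" "0 < p"
  shows "(\<lambda>x. f x - g x) \<in> Lp_funs p M"
  using Lp_funs_add[OF assms(1) Lp_funs_scale[OF assms(2), of "-1"] assms(3)] by simp

lemma mass_nonneg [simp]: "0 \<le> mass p M f"
  unfolding mass_def by (rule integral_nonneg_AE) auto

lemma mass_scale: "mass p M (\<lambda>x. c * f x) = cmod c powr p * mass p M f"
  by (simp add: mass_def norm_mult powr_mult)

lemma mass_cong:
  assumes "f \<in> Lp_funs p M" "g \<in> Lp_funs p M" "AE x in M. f x = g x"
  shows "mass p M f = mass p M g"
  unfolding mass_def using assms by (intro integral_cong_AE) (auto dest: Lp_funsD)

lemma mass_mono:
  assumes "f \<in> borel_measurable M" "g \<in> Lp_funs p M" "AE x in M. cmod (f x) \<le> cmod (g x)" "0 < p"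
  shows "mass p M f \<le> mass p M g"
  unfolding mass_def
proof (rule integral_mono_AE)
  show "integrable M (\<lambda>x. cmod (f x) powr p)"
    using Lp_funs_bound_fun[OF assms(1,2,4,3)] by (rule Lp_funsD)
  show "AE x in M. cmod (f x) powr p \<le> cmod (g x) powr p"
    using assms(3) by eventually_elim (use assms(4) in \<open>auto intro!: powr_mono2\<close>)
qed (use assms in \<open>auto dest: Lp_funsD\<close>)

lemma mass_eq_0_iff:
  assumes "f \<in> Lp_funs p M"
  shows "mass p M f = 0 \<longleftrightarrow> (AE x in M. f x = 0)"
  unfolding mass_def
  using integral_nonneg_eq_0_iff_AE[OF Lp_funsD(2)[OF assms]] by simp

lemma mass_bounded_convergence:
  assumes f: "\<And>n. f n \<in> Lp_funs p M" and g: "g \<in> borel_measurable M" and p: "0 < p"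
    and w: "integrable M (\<lambda>x. w x powr p)"
    and bound: "\<And>n. AE x in M. cmod (f n x) \<le> w x"
    and lim: "AE x in M. (\<lambda>n. f n x) \<longlonglongrightarrow> g x"
  shows "g \<in> Lp_funs p M" "(\<lambda>n. mass p M (\<lambda>x. f n x - g x)) \<longlonglongrightarrow> 0"
proof -
  have b: "AE x in M. \<forall>n. cmod (f n x) \<le> w x"
    using bound by (simp add: AE_all_countable)
  have bg: "AE x in M. cmod (g x) \<le> w x"
    using b lim
  proof eventually_elim
    case (elim x)
    then show ?case
      by (intro tendsto_upperbound[OF tendsto_norm[OF elim(2)]]) auto
  qed
  show G: "g \<in> Lp_funs p M"
    using Lp_funs_bound[OF g w p bg] .
  have "(\<lambda>n. \<integral>x. cmod (f n x - g x) powr p \<partial>M) \<longlonglongrightarrow> (\<integral>x. 0 \<partial>M)"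
  proof (rule integral_dominated_convergence[where w="\<lambda>x. 2 powr p * w x powr p"])
    show "(\<lambda>x. cmod (f n x - g x) powr p) \<in> borel_measurable M" for n
      using Lp_funsD(1)[OF f[of n]] g by measurable
    show "integrable M (\<lambda>x. 2 powr p * w x powr p)"
      using w by simp
    show "AE x in M. (\<lambda>n. cmod (f n x - g x) powr p) \<longlonglongrightarrow> 0"
      using lim
    proof eventually_elim
      case (elim x)
      then have "(\<lambda>n. cmod (f n x - g x)) \<longlonglongrightarrow> 0"
        using LIM_zero tendsto_norm_zero by blast
      from tendsto_powr'[OF this tendsto_const[of p]] show ?case using p by simp
    qed
    show "AE x in M. norm (cmod (f n x - g x) powr p) \<le> 2 powr p * w x powr p" for n
      using b bg
    proof eventually_elim
      case (elim x)
      have "cmod (f n x - g x) \<le> 2 * w x"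
        using norm_triangle_ineq4[of "f n x" "g x"] elim(1)[rule_format, of n] elim(2) by linarith
      moreover have "0 \<le> w x" using elim(2) norm_ge_zero order_trans by blast
      ultimately show ?case
        using p by (auto simp flip: powr_mult intro!: powr_mono2)
    qed
  qed auto
  then show "(\<lambda>n. mass p M (\<lambda>x. f n x - g x)) \<longlonglongrightarrow> 0"
    by (simp add: mass_def)
qed

section \<open>Young's inequality and the pairing for conjugate exponents\<close>

locale conjugate_exponents =
  fixes p q :: real
  assumes p_gt_1: "1 < p" and q_gt_1: "1 < q" and conj_eq: "1 / p + 1 / q = 1"
begin

lemma swap: "conjugate_exponents q p"
  using p_gt_1 q_gt_1 conj_eq by unfold_locales auto

lemma conj_sum: "p + q = p * q"
  using conj_eq p_gt_1 q_gt_1 by (simp add: field_simps)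

lemma p_minus_1_mult: "(p - 1) * (q - 1) = 1" "(p - 1) * q = p"
  using conj_sum by (simp_all add: algebra_simps)

text \<open>Pairing a vector with its own dual element puts its mass \<open>m\<close> on both sides
  of Young's inequality, and as \<open>1 / p + 1 / q = 1\<close> the share \<open>m / q\<close>
  cancels. This replaces the equality case of Hoelder's inequality.\<close>

lemma young_cancel:
  assumes "m \<le> c / p + m / q"
  shows "m \<le> c"
proof -
  have "m = m / p + m / q" using conj_eq by (simp add: divide_inverse flip: distrib_left)
  then have "m / p \<le> c / p" using assms by linarith
  then show ?thesis using p_gt_1 by (simp add: divide_le_cancel)
qed

lemma young: "cmod (z * w) \<le> cmod z powr p / p + cmod w powr q / q"
  using Youngs_inequality[OF p_gt_1 q_gt_1 conj_eq, of "cmod z" "cmod w"] by (simp add: norm_mult)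

lemma norm_lp_dual_powr: "cmod (lp_dual p z) powr q = cmod z powr p"
  by (simp add: norm_lp_dual powr_powr p_minus_1_mult)

text \<open>The tangent inequality at \<open>a\<close> for the convex function
  \<open>cmod z powr p\<close>. Young's inequality for \<open>b\<close> and
  \<open>lp_dual p a\<close> yields it without differentiation, so \<open>a = 0\<close> needs no
  separate treatment.\<close>

lemma powr_diff_le: "cmod a powr p - cmod b powr p \<le> p * Re ((a - b) * lp_dual p a)"
proof -
  have "Re (b * lp_dual p a) \<le> cmod (b * lp_dual p a)"
    by (rule complex_Re_le_cmod)
  also have "\<dots> \<le> cmod b powr p / p + cmod a powr p / q" (is "_ \<le> ?r")
    using young[of b "lp_dual p a"] by (simp add: norm_lp_dual_powr)
  finally have 0: "Re (b * lp_dual p a) \<le> ?r" .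
  have 1: "Re (b * lp_dual p a) \<le> cmod b powr p / p + cmod a powr p * (1 - 1 / p)"
  proof -
    have "1 - 1 / p = 1 / q" using conj_eq by simp
    then have "cmod a powr p / q = cmod a powr p * (1 - 1 / p)" by simp
    then show ?thesis
      using 0 by linarith
  qed
  have "Re ((a - b) * lp_dual p a) = cmod a powr p - Re (b * lp_dual p a)"
    by (simp add: left_diff_distrib mult_lp_dual)
  then have "(cmod a powr p - cmod b powr p) / p \<le> Re ((a - b) * lp_dual p a)"
    using 1 by (simp add: algebra_simps diff_divide_distrib)
  then show ?thesis using p_gt_1 by (simp add: field_simps)
qed

lemma lp_dual_Lp_funs:
  assumes "f \<in> Lp_funs p M"
  shows "(\<lambda>x. lp_dual p (f x)) \<in> Lp_funs q M"
  using assms measurable_compose[OF _ measurable_lp_dual[OF p_gt_1]]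
  by (auto simp: Lp_funs_def norm_lp_dual_powr)

lemma mass_lp_dual: "mass q M (\<lambda>x. lp_dual p (f x)) = mass p M f"
  by (simp add: mass_def norm_lp_dual_powr)

lemma pairing_integrable:
  assumes "f \<in> Lp_funs p M" "g \<in> Lp_funs q M"
  shows "integrable M (\<lambda>x. f x * g x)"
proof (rule Bochner_Integration.integrable_bound)
  show "integrable M (\<lambda>x. cmod (f x) powr p / p + cmod (g x) powr q / q)"
    using assms by (auto dest!: Lp_funsD)
  show "AE x in M. norm (f x * g x) \<le> norm (cmod (f x) powr p / p + cmod (g x) powr q / q)"
    using young by (intro AE_I2 order_trans[OF young]) simp
qed (use assms in measurable)

lemma pairing_young:
  assumes "f \<in> Lp_funs p M" "g \<in> Lp_funs q M"
  shows "cmod (pairing M f g) \<le> mass p M f / p + mass q M g / q"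
proof -
  have "cmod (pairing M f g) \<le> (\<integral>x. cmod (f x * g x) \<partial>M)"
    unfolding pairing_def by (rule integral_norm_bound)
  also have "\<dots> \<le> (\<integral>x. cmod (f x) powr p / p + cmod (g x) powr q / q \<partial>M)"
    using assms pairing_integrable[OF assms] young
    by (intro integral_mono) (auto dest!: Lp_funsD)
  also have "\<dots> = mass p M f / p + mass q M g / q"
    unfolding mass_def using assms by (subst Bochner_Integration.integral_add) (auto dest: Lp_funsD)
  finally show ?thesis .
qed

lemma pairing_lp_dual:
  assumes "f \<in> Lp_funs p M"
  shows "pairing M f (\<lambda>x. lp_dual p (f x)) = complex_of_real (mass p M f)"
  by (simp add: pairing_def mult_lp_dual mass_def)

lemma pairing_add_left:
  assumes "f \<in> Lp_funs p M" "f' \<in> Lp_funs p M" "g \<in> Lp_funs q M"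
  shows "pairing M (\<lambda>x. f x + f' x) g = pairing M f g + pairing M f' g"
  using assms by (simp add: pairing_def distrib_right pairing_integrable)

lemma pairing_add_right:
  assumes "f \<in> Lp_funs p M" "g \<in> Lp_funs q M" "g' \<in> Lp_funs q M"
  shows "pairing M f (\<lambda>x. g x + g' x) = pairing M f g + pairing M f g'"
  using assms by (simp add: pairing_def distrib_left pairing_integrable)

end

lemma pairing_scale_left: "pairing M (\<lambda>x. c * f x) g = c * pairing M f g"
  by (simp add: pairing_def mult.assoc)

lemma pairing_scale_right: "pairing M f (\<lambda>x. c * g x) = c * pairing M f g"
  by (simp add: pairing_def mult.left_commute)

lemma pairing_commute: "pairing M f g = pairing M g f"
  by (simp add: pairing_def mult.commute)

lemma pairing_cong:
  assumes "AE x in M. f x = f' x" "f \<in> borel_measurable M" "f' \<in> borel_measurable M"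
    and "AE x in M. g x = g' x" "g \<in> borel_measurable M" "g' \<in> borel_measurable M"
  shows "pairing M f g = pairing M f' g'"
  unfolding pairing_def using assms by (intro integral_cong_AE) auto

section \<open>Subspaces fixed by a net of contractions\<close>

text \<open>For the forms of the net \<open>e_t\<close> this is the range of the projection
  \<open>lim e_t\<close>, described by weak limits so that no limit operator has to be
  constructed.\<close>

definition fixed_space ::
    "real \<Rightarrow> real \<Rightarrow> 'x measure \<Rightarrow> 'i filter
      \<Rightarrow> ('i \<Rightarrow> ('x \<Rightarrow> complex) \<Rightarrow> ('x \<Rightarrow> complex) \<Rightarrow> complex) \<Rightarrow> ('x \<Rightarrow> complex) set"
  where "fixed_space p q M \<Phi> B = {f \<in> Lp_funs p M.
    \<forall>g\<in>Lp_funs q M. ((\<lambda>t. B t f g) \<longlongrightarrow> pairing M f g) \<Phi>}"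

text \<open>A bound valid for every scaling \<open>c\<close> amounts to Hoelder's inequality:
  \<open>c\<close> is taken large enough for the second term, and then \<open>m\<close> small enough
  for the first.\<close>

lemma (in conjugate_exponents) young_small:
  assumes "0 \<le> K" "0 < \<epsilon>"
  shows "\<exists>\<delta>>0. \<forall>m<\<delta>. \<forall>z.
    (\<forall>c>0. cmod z \<le> c powr p * m / p + c powr (- q) * K / q) \<longrightarrow> cmod z < \<epsilon>"
proof -
  \<comment> \<open>The value that makes \<open>c powr (- q) * K / q\<close> at most half of
    \<epsilon>; \<open>K + 1\<close> instead of \<open>K\<close> keeps \<open>c\<close> positive
    when \<open>K = 0\<close>.\<close>
  define r where "r = (K + 1) / (q * (\<epsilon> / 2))"
  define c where "c = r powr (1 / q)"
  have r: "0 < r"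
    using assms q_gt_1 unfolding r_def by (intro divide_pos_pos mult_pos_pos) auto
  have c: "0 < c" using r unfolding c_def by simp
  have "c powr (- q) = inverse r"
    using r q_gt_1 by (simp add: c_def powr_powr powr_minus)
  then have "c powr (- q) * K / q = (K / (K + 1)) * (\<epsilon> / 2)"
    using q_gt_1 assms by (simp add: r_def)
  also have "\<dots> \<le> 1 * (\<epsilon> / 2)"
    using assms by (intro mult_right_mono) auto
  finally have 1: "c powr (- q) * K / q \<le> \<epsilon> / 2" by simp
  define \<delta> where "\<delta> = \<epsilon> / 2 * p / c powr p"
  have "0 < \<delta>" using assms c p_gt_1 unfolding \<delta>_def by simp
  moreover have "cmod z < \<epsilon>"
    if "m < \<delta>" and z: "\<forall>c>0. cmod z \<le> c powr p * m / p + c powr (- q) * K / q" for m z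
  proof -
    have "c powr p * m / p < \<epsilon> / 2"
      using that(1) c p_gt_1 by (simp add: \<delta>_def field_simps)
    moreover have "cmod z \<le> c powr p * m / p + c powr (- q) * K / q" using z c by blast
    ultimately show ?thesis using 1 by linarith
  qed
  ultimately show ?thesis by blast
qed

text \<open>Working with the forms \<open>\<integral> (e\<^sub>t f) g\<close> instead of the operators \<open>e\<^sub>t\<close> makes the setting symmetric in
  \<open>(f, p)\<close> and \<open>(g, q)\<close> and avoids adjoint operators and the representation of the dual of \<open>L\<^sup>p\<close>.
  Contractivity is expressed by Young's inequality.\<close>

locale contractive_forms = conjugate_exponents p q for p q :: real +
  fixes M :: "'x measure" and \<Phi> :: "'i filter"
    and B :: "'i \<Rightarrow> ('x \<Rightarrow> complex) \<Rightarrow> ('x \<Rightarrow> complex) \<Rightarrow> complex"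
  assumes form_add_left: "\<And>t f f' g. f \<in> Lp_funs p M \<Longrightarrow> f' \<in> Lp_funs p M \<Longrightarrow> g \<in> Lp_funs q M \<Longrightarrow>
      B t (\<lambda>x. f x + f' x) g = B t f g + B t f' g"
    and form_add_right: "\<And>t f g g'. f \<in> Lp_funs p M \<Longrightarrow> g \<in> Lp_funs q M \<Longrightarrow> g' \<in> Lp_funs q M \<Longrightarrow>
      B t f (\<lambda>x. g x + g' x) = B t f g + B t f g'"
    and form_scale_left: "\<And>t f g c. f \<in> Lp_funs p M \<Longrightarrow> g \<in> Lp_funs q M \<Longrightarrow>
      B t (\<lambda>x. c * f x) g = c * B t f g"
    and form_scale_right: "\<And>t f g c. f \<in> Lp_funs p M \<Longrightarrow> g \<in> Lp_funs q M \<Longrightarrow>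
      B t f (\<lambda>x. c * g x) = c * B t f g"
    and form_young: "\<And>t f g. f \<in> Lp_funs p M \<Longrightarrow> g \<in> Lp_funs q M \<Longrightarrow>
      cmod (B t f g) \<le> mass p M f / p + mass q M g / q"
begin

lemma swap_forms: "contractive_forms q p M (\<lambda>t g f. B t f g)"
proof -
  interpret s: conjugate_exponents q p by (rule swap)
  show ?thesis
    by unfold_locales
      (simp_all add: form_add_left form_add_right form_scale_left form_scale_right
        form_young add.commute[of "mass q M _ / q"])
qed

abbreviation (input) "dual f \<equiv> \<lambda>x. lp_dual p (f x)"
abbreviation "E \<equiv> fixed_space p q M \<Phi> B"
abbreviation "E' \<equiv> fixed_space q p M \<Phi> (\<lambda>t g f. B t f g)"

lemma fixed_Lp: "f \<in> E \<Longrightarrow> f \<in> Lp_funs p M"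
  by (simp add: fixed_space_def)

lemma fixed_measurable [measurable_dest]: "f \<in> E \<Longrightarrow> f \<in> borel_measurable M"
  by (rule Lp_funs_measurable[OF fixed_Lp])

lemma fixed_add:
  assumes "f \<in> E" "g \<in> E"
  shows "(\<lambda>x. f x + g x) \<in> E"
  using assms p_gt_1 unfolding fixed_space_def
  by (auto simp: form_add_left pairing_add_left Lp_funs_add intro!: tendsto_add)

lemma fixed_scale:
  assumes "f \<in> E"
  shows "(\<lambda>x. c * f x) \<in> E"
  using assms unfolding fixed_space_def
  by (auto simp: form_scale_left pairing_scale_left Lp_funs_scale intro!: tendsto_mult)

lemma fixed_diff:
  assumes "f \<in> E" "g \<in> E"
  shows "(\<lambda>x. f x - g x) \<in> E"
  using fixed_add[OF assms(1) fixed_scale[OF assms(2), of "-1"]] by simp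

lemma form_diff_left:
  assumes "f \<in> Lp_funs p M" "f' \<in> Lp_funs p M" "g \<in> Lp_funs q M"
  shows "B t (\<lambda>x. f x - f' x) g = B t f g - B t f' g"
  using form_add_left[OF assms(1) Lp_funs_scale[OF assms(2), of "-1"] assms(3)]
    form_scale_left[OF assms(2,3), of _ "-1"] by simp

text \<open>Multiplying \<open>f\<close> by \<open>c\<close> and \<open>g\<close> by
  \<open>1 / c\<close> leaves the form unchanged, but not the two terms of the bound.\<close>

lemma form_young_scaled:
  assumes "f \<in> Lp_funs p M" "g \<in> Lp_funs q M" "0 < c"
  shows "cmod (B t f g) \<le> c powr p * mass p M f / p + c powr (- q) * mass q M g / q"
proof -
  have "B t (\<lambda>x. of_real c * f x) (\<lambda>x. of_real (1 / c) * g x)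
      = of_real c * (of_real (1 / c) * B t f g)"
    using assms by (simp only: form_scale_left form_scale_right Lp_funs_scale)
  then have "B t (\<lambda>x. of_real c * f x) (\<lambda>x. of_real (1 / c) * g x) = B t f g"
    using assms by simp
  moreover have "cmod (complex_of_real c) = c" "cmod (complex_of_real (1 / c)) = 1 / c"
    using assms(3) by (simp_all add: norm_divide)
  moreover have "(1 / c) powr q = c powr (- q)"
    using assms(3) by (simp add: powr_divide powr_minus_divide)
  ultimately show ?thesis
    using form_young[of "\<lambda>x. of_real c * f x" "\<lambda>x. of_real (1 / c) * g x" t] assms
    by (simp only: Lp_funs_scale mass_scale)
qed

text \<open>As a constant net of contractive forms, the pairing is open to every estimate proved for
  the forms.\<close>

lemma pairing_forms: "contractive_forms p q M (\<lambda>_. pairing M)"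
  by unfold_locales (auto simp: pairing_add_left pairing_add_right pairing_scale_left
      pairing_scale_right pairing_young)

text \<open>Equicontinuity: \<delta> is independent of \<open>t\<close>, which lets weak convergence
  pass to limits in mass.\<close>

lemma form_small:
  assumes "g \<in> Lp_funs q M" "0 < \<epsilon>"
  obtains \<delta> where "0 < \<delta>"
    "\<And>f t. f \<in> Lp_funs p M \<Longrightarrow> mass p M f < \<delta> \<Longrightarrow> cmod (B t f g) < \<epsilon>"
proof -
  obtain \<delta> where \<delta>: "0 < \<delta>" "\<And>m z. m < \<delta> \<Longrightarrow>
      (\<forall>c>0. cmod z \<le> c powr p * m / p + c powr (- q) * mass q M g / q) \<Longrightarrow> cmod z < \<epsilon>"
    using young_small[of "mass q M g" \<epsilon>] assms by auto
  show thesis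
    by (rule that[OF \<delta>(1)], rule \<delta>(2)) (use form_young_scaled assms in auto)
qed

lemma fixed_closed:
  assumes f: "\<And>n. f n \<in> E" and g: "g \<in> Lp_funs p M"
    and lim: "(\<lambda>n. mass p M (\<lambda>x. f n x - g x)) \<longlonglongrightarrow> 0"
  shows "g \<in> E"
proof -
  interpret P: contractive_forms p q M \<Phi> "\<lambda>_. pairing M" by (rule pairing_forms)
  have "((\<lambda>t. B t g h) \<longlongrightarrow> pairing M g h) \<Phi>" if h: "h \<in> Lp_funs q M" for h
  proof (rule tendstoI)
    fix \<epsilon> :: real assume "0 < \<epsilon>"
    then have e: "0 < \<epsilon> / 3" by simp
    obtain d1 where d1: "0 < d1"
        "\<And>f. f \<in> Lp_funs p M \<Longrightarrow> mass p M f < d1 \<Longrightarrow> cmod (pairing M f h) < \<epsilon> / 3"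
      using P.form_small[OF h e] by metis
    obtain d2 where d2: "0 < d2"
        "\<And>f t. f \<in> Lp_funs p M \<Longrightarrow> mass p M f < d2 \<Longrightarrow> cmod (B t f h) < \<epsilon> / 3"
      using form_small[OF h e] by metis
    obtain n where n: "mass p M (\<lambda>x. f n x - g x) < min d1 d2"
      using order_tendstoD(2)[OF lim, of "min d1 d2"] d1(1) d2(1)
      by (auto simp: eventually_sequentially)
    have fn: "f n \<in> Lp_funs p M" using f by (rule fixed_Lp)
    have d: "(\<lambda>x. f n x - g x) \<in> Lp_funs p M"
      using Lp_funs_diff[OF fn g] p_gt_1 by simp
    have "\<forall>\<^sub>F t in \<Phi>. dist (B t (f n) h) (pairing M (f n) h) < \<epsilon> / 3"
      using f[of n] h unfolding fixed_space_def by (intro tendstoD[OF _ e]) auto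
    then show "\<forall>\<^sub>F t in \<Phi>. dist (B t g h) (pairing M g h) < \<epsilon>"
    proof eventually_elim
      case (elim t)
      have "cmod (B t (\<lambda>x. f n x - g x) h) < \<epsilon> / 3"
        using d2(2)[OF d] n by simp
      then have 1: "dist (B t (f n) h) (B t g h) < \<epsilon> / 3"
        unfolding form_diff_left[OF fn g h] dist_norm .
      have "cmod (pairing M (\<lambda>x. f n x - g x) h) < \<epsilon> / 3"
        using d1(2)[OF d] n by simp
      then have 2: "dist (pairing M (f n) h) (pairing M g h) < \<epsilon> / 3"
        unfolding P.form_diff_left[OF fn g h] dist_norm .
      show ?case
        using 1 2 elim by (metis dist_commute dist_triangle_third)
    qed
  qed
  then show ?thesis using g by (simp add: fixed_space_def)
qed

lemma fixed_bounded_limit: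
  assumes "\<And>n. f n \<in> E" "g \<in> borel_measurable M" "integrable M (\<lambda>x. w x powr p)"
    and "\<And>n. AE x in M. cmod (f n x) \<le> w x" "AE x in M. (\<lambda>n. f n x) \<longlonglongrightarrow> g x"
  shows "g \<in> E"
proof -
  have "\<And>n. f n \<in> Lp_funs p M" "0 < p"
    using assms(1) fixed_Lp p_gt_1 by auto
  from mass_bounded_convergence[OF this(1) assms(2) this(2) assms(3-5)] show ?thesis
    by (intro fixed_closed[OF assms(1)])
qed

text \<open>The functionals \<open>g \<mapsto> B t g F\<close> have at most the norm of \<open>F\<close> and their values at \<open>f\<close> converge to the
  norming value; as the norm of \<open>L\<^sup>p\<close> is Gateaux differentiable at \<open>f\<close>, they converge pointwise.\<close>

lemma lp_dual_upper:
  assumes f: "f \<in> E" and g: "g \<in> Lp_funs p M" and \<epsilon>: "0 < \<epsilon>"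
  defines "F \<equiv> \<lambda>x. lp_dual p (f x)"
  shows "\<forall>\<^sub>F t in \<Phi>. Re (B t g F) < Re (pairing M g F) + \<epsilon>"
proof -
  have fL: "f \<in> Lp_funs p M" using f by (rule fixed_Lp)
  have FL: "F \<in> Lp_funs q M" unfolding F_def by (rule lp_dual_Lp_funs[OF fL])
  define s where "s n = 1 / real (Suc n)" for n
  define h where "h n = (\<lambda>x. f x + complex_of_real (s n) * g x)" for n
  have s: "0 < s n" "s n \<le> 1" for n by (simp_all add: s_def)
  have hL: "h n \<in> Lp_funs p M" for n
    unfolding h_def using p_gt_1 by (intro Lp_funs_add fL Lp_funs_scale g) auto
  have h_bound: "cmod (h n x) \<le> cmod (f x) + cmod (g x)" for n x
  proof -
    have "cmod (complex_of_real (s n) * g x) \<le> cmod (g x)"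
      using s[of n] by (simp add: norm_mult mult_left_le_one_le)
    then show ?thesis unfolding h_def by (rule norm_triangle_mono[OF order_refl])
  qed
  \<comment> \<open>By continuity of the duality map; the dominating function is Young's bound with
    \<open>cmod (h n x)\<close> replaced by \<open>cmod (f x) + cmod (g x)\<close>.\<close>
  have "(\<lambda>n. pairing M g (dual (h n))) \<longlonglongrightarrow> pairing M g F"
    unfolding pairing_def
  proof (rule integral_dominated_convergence[where
        w="\<lambda>x. cmod (g x) powr p / p + (cmod (f x) + cmod (g x)) powr p / q"])
    show "integrable M (\<lambda>x. cmod (g x) powr p / p + (cmod (f x) + cmod (g x)) powr p / q)"
      using Lp_funsD[OF g] Lp_funs_add_integrable[OF fL g] p_gt_1 by simp
    have "(\<lambda>n. h n x) \<longlonglongrightarrow> f x + complex_of_real 0 * g x" for x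
      unfolding h_def s_def using LIMSEQ_inverse_real_of_nat
      by (intro tendsto_intros) (simp add: inverse_eq_divide)
    then have "(\<lambda>n. lp_dual p (h n x)) \<longlonglongrightarrow> lp_dual p (f x)" for x
      using continuous_lp_dual[OF p_gt_1]
      by (auto simp: continuous_on_eq_continuous_at intro: isCont_tendsto_compose)
    then show "AE x in M. (\<lambda>n. g x * lp_dual p (h n x)) \<longlonglongrightarrow> g x * F x"
      unfolding F_def by (intro AE_I2 tendsto_intros)
    show "AE x in M. norm (g x * lp_dual p (h n x))
        \<le> cmod (g x) powr p / p + (cmod (f x) + cmod (g x)) powr p / q" for n
    proof (intro AE_I2)
      fix x
      have "cmod (h n x) powr p \<le> (cmod (f x) + cmod (g x)) powr p"
        using h_bound p_gt_1 by (intro powr_mono2) auto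
      then have "cmod (h n x) powr p / q \<le> (cmod (f x) + cmod (g x)) powr p / q"
        using q_gt_1 by (intro divide_right_mono) auto
      then show "norm (g x * lp_dual p (h n x))
          \<le> cmod (g x) powr p / p + (cmod (f x) + cmod (g x)) powr p / q"
        using young[of "g x" "lp_dual p (h n x)"] by (simp add: norm_lp_dual_powr)
    qed
    show "(\<lambda>x. g x * lp_dual p (h n x)) \<in> borel_measurable M" for n
      using pairing_integrable[OF g lp_dual_Lp_funs[OF hL[of n]]] by auto
    show "(\<lambda>x. g x * F x) \<in> borel_measurable M"
      using pairing_integrable[OF g FL] by auto
  qed
  then have "(\<lambda>n. Re (pairing M g (dual (h n)))) \<longlonglongrightarrow> Re (pairing M g F)"
    by (rule tendsto_Re)
  from order_tendstoD(2)[OF this, of "Re (pairing M g F) + \<epsilon> / 2"] \<epsilon> obtain n where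
    n: "Re (pairing M g (dual (h n))) < Re (pairing M g F) + \<epsilon> / 2"
    by (auto simp: eventually_sequentially)
  have "mass p M (h n) - mass p M f = (\<integral>x. cmod (h n x) powr p - cmod (f x) powr p \<partial>M)"
    unfolding mass_def using Lp_funsD[OF hL[of n]] Lp_funsD[OF fL] by simp
  also have "\<dots> \<le> (\<integral>x. p * s n * Re (g x * lp_dual p (h n x)) \<partial>M)"
  proof (rule integral_mono)
    show "integrable M (\<lambda>x. p * s n * Re (g x * lp_dual p (h n x)))"
      using pairing_integrable[OF g lp_dual_Lp_funs[OF hL[of n]]]
      by (intro integrable_mult_right integrable_Re)
    fix x
    have "Re (complex_of_real (s n) * (g x * lp_dual p (h n x))) = s n * Re (g x * lp_dual p (h n x))"
      by simp
    then show "cmod (h n x) powr p - cmod (f x) powr p \<le> p * s n * Re (g x * lp_dual p (h n x))"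
      using powr_diff_le[of "h n x" "f x"] by (simp add: h_def mult.assoc)
  qed (use Lp_funsD[OF hL[of n]] Lp_funsD[OF fL] in simp)
  also have "\<dots> = p * s n * Re (pairing M g (dual (h n)))"
    using integral_Re[OF pairing_integrable[OF g lp_dual_Lp_funs[OF hL[of n]]]]
    by (simp only: pairing_def integral_mult_right_zero)
  finally have m: "(mass p M (h n) - mass p M f) / p
      \<le> s n * Re (pairing M g (dual (h n)))"
    using p_gt_1 by (simp add: field_simps)
  \<comment> \<open>The step \<open>s n\<close> is fixed by now, so the net can be followed until
    the error at \<open>f\<close> is small even compared with \<open>s n\<close>.\<close>
  have "((\<lambda>t. B t f F) \<longlongrightarrow> pairing M f F) \<Phi>"
    using f FL by (simp add: fixed_space_def)
  moreover have "0 < s n * (\<epsilon> / 2)" using s \<epsilon> by simp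
  ultimately have "\<forall>\<^sub>F t in \<Phi>. dist (B t f F) (pairing M f F) < s n * (\<epsilon> / 2)"
    by (rule tendstoD)
  then show ?thesis
  proof eventually_elim
    case (elim t)
    have pf: "pairing M f F = complex_of_real (mass p M f)"
      unfolding F_def by (rule pairing_lp_dual[OF fL])
    have 1: "mass p M f - Re (B t f F) < s n * (\<epsilon> / 2)"
      using elim abs_Re_le_cmod[of "pairing M f F - B t f F"]
      by (simp add: dist_norm norm_minus_commute pf)
    \<comment> \<open>By Young's inequality the form at \<open>f + s g\<close> exceeds
      \<open>mass p M f\<close> by at most \<open>s\<close> times the derivative, and at
      \<open>f\<close> it is already almost \<open>mass p M f\<close>. The difference, divided by
      \<open>s\<close>, bounds the value at \<open>g\<close>.\<close>
    have "B t (h n) F = B t f F + s n * B t g F"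
      unfolding h_def using fL g FL by (simp add: form_add_left form_scale_left Lp_funs_scale)
    then have "Re (B t f F) + s n * Re (B t g F) \<le> cmod (B t (h n) F)"
      using complex_Re_le_cmod[of "B t (h n) F"] by simp
    also have "\<dots> \<le> mass p M (h n) / p + mass p M f / q"
      using form_young[OF hL FL, of t n] by (simp add: F_def mass_lp_dual)
    also have "\<dots> = (mass p M (h n) - mass p M f) / p + mass p M f * (1 / p + 1 / q)"
      by (simp add: diff_divide_distrib distrib_left)
    also have "\<dots> \<le> s n * Re (pairing M g (dual (h n))) + mass p M f"
      using m by (simp only: conj_eq)
    finally have "s n * Re (B t g F)
        < s n * Re (pairing M g (dual (h n))) + s n * (\<epsilon> / 2)"
      using 1 by linarith
    then have "s n * Re (B t g F) < s n * (Re (pairing M g (dual (h n))) + \<epsilon> / 2)"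
      by (simp add: algebra_simps)
    then have "Re (B t g F) < Re (pairing M g (dual (h n))) + \<epsilon> / 2"
      using s by (simp add: mult_less_cancel_left_pos)
    then show ?case using n by simp
  qed
qed

text \<open>The upper estimate holds for \<open>g\<close> multiplied by 1, -1, \<open>\<i>\<close>
  and \<open>-\<i>\<close>, hence it bounds real and imaginary parts from both sides.\<close>

lemma lp_dual_fixed:
  assumes f: "f \<in> E"
  shows "(dual f) \<in> E'"
proof -
  define F where "F = (dual f)"
  have FL: "F \<in> Lp_funs q M" unfolding F_def by (rule lp_dual_Lp_funs[OF fixed_Lp[OF f]])
  have "((\<lambda>t. B t g F) \<longlongrightarrow> pairing M g F) \<Phi>" if g: "g \<in> Lp_funs p M" for g
  proof (rule tendstoI)
    fix \<epsilon> :: real assume "0 < \<epsilon>"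
    then have e: "0 < \<epsilon> / 2" by simp
    have *: "\<forall>\<^sub>F t in \<Phi>. Re (c * B t g F) < Re (c * pairing M g F) + \<epsilon> / 2" for c
      using lp_dual_upper[OF f Lp_funs_scale[OF g, of c] e] FL g
      unfolding F_def[symmetric] by (simp add: form_scale_left pairing_scale_left)
    show "\<forall>\<^sub>F t in \<Phi>. dist (B t g F) (pairing M g F) < \<epsilon>"
      using *[of 1] *[of "-1"] *[of \<i>] *[of "-\<i>"]
    proof eventually_elim
      case (elim t)
      have "\<bar>Re (B t g F - pairing M g F)\<bar> < \<epsilon> / 2" "\<bar>Im (B t g F - pairing M g F)\<bar> < \<epsilon> / 2"
        using elim unfolding abs_less_iff by auto
      then show ?case
        using cmod_le[of "B t g F - pairing M g F"] by (simp add: dist_norm)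
    qed
  qed
  then have "\<forall>g\<in>Lp_funs p M. ((\<lambda>t. B t g F) \<longlongrightarrow> pairing M F g) \<Phi>"
    using pairing_commute[of M _ F] by metis
  then have "F \<in> E'" using FL by (simp add: fixed_space_def)
  then show ?thesis by (simp add: F_def)
qed

end

section \<open>Lattice structure of the fixed subspace\<close>

lemma lp_dual_altdef: "lp_dual p z = complex_of_real (cmod z powr (p - 2)) * cnj z"
proof (cases "z = 0")
  case False
  have "cmod z powr (p - 1) = cmod z powr (p - 2) * cmod z"
    using False powr_mult_base[of "cmod z" "p - 2"] by (simp add: mult.commute)
  then show ?thesis using False by (simp add: lp_dual_def sgn_eq)
qed simp

lemma lp_dual_of_real:
  assumes "0 \<le> a"
  shows "lp_dual p (complex_of_real a) = complex_of_real (a powr (p - 1))"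
  using assms by (cases "a = 0") (auto simp: lp_dual_def sgn_of_real)

lemma sgn_lp_dual: "sgn (lp_dual p z) = cnj (sgn z)"
proof (cases "z = 0")
  case False
  then show ?thesis unfolding sgn_eq[of "lp_dual p z"] norm_lp_dual by (simp add: lp_dual_def)
qed simp

lemma lp_dual_cnj_sgn: "lp_dual p (cnj (sgn z)) = sgn z"
  by (cases "z = 0") (simp_all add: lp_dual_def sgn_eq[of "cnj (sgn z)"] norm_sgn)

section \<open>Difference quotients of the duality map\<close>

lemma powr_diff_le_real:
  fixes a b r :: real
  assumes "1 < r" "0 \<le> b" "b \<le> a"
  shows "a powr r - b powr r \<le> r * a powr (r - 1) * (a - b)"
proof -
  interpret conjugate_exponents r "r / (r - 1)"
    using assms by unfold_locales (auto simp: field_simps)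
  show ?thesis
    using lp_dual_of_real[of a r] powr_diff_le[of "complex_of_real a" "complex_of_real b"] assms
    by (simp add: mult_ac flip: of_real_diff)
qed

text \<open>For \<open>p > 2\<close> the factor \<open>cmod z powr (p - 2)\<close> increases with
  the modulus, and its change, weighted with the smaller modulus, is bounded by the tangent
  inequality for the exponent \<open>p - 1\<close>. The estimate will dominate difference
  quotients.\<close>

lemma lp_dual_diff_le_aux:
  assumes p: "2 < p" and "cmod b \<le> cmod a"
  shows "cmod (lp_dual p a - lp_dual p b) \<le> p * cmod a powr (p - 2) * cmod (a - b)"
proof -
  let ?A = "cmod a powr (p - 2)" and ?B = "cmod b powr (p - 2)"
  have pw: "x * x powr (p - 2) = x powr (p - 1)" if "0 \<le> x" for x :: real
    using that powr_mult_base[of x "p - 2"] by (cases "x = 0") auto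
  have le: "?B \<le> ?A" using assms by (intro powr_mono2) auto
  have "lp_dual p a - lp_dual p b = ?A * cnj (a - b) + (?A - ?B) * cnj b"
    by (simp add: lp_dual_altdef algebra_simps)
  then have "cmod (lp_dual p a - lp_dual p b)
      \<le> cmod (?A * cnj (a - b)) + cmod ((?A - ?B) * cnj b)"
    by (simp only: norm_triangle_ineq)
  also have "\<dots> = ?A * cmod (a - b) + (?A - ?B) * cmod b"
    using le by (simp add: norm_mult flip: complex_cnj_diff of_real_diff)
  also have "(?A - ?B) * cmod b \<le> (p - 1) * ?A * cmod (a - b)"
  proof -
    have "(?A - ?B) * cmod b = ?A * cmod b - cmod b powr (p - 1)"
      using pw[of "cmod b"] by (simp add: algebra_simps)
    also have "\<dots> \<le> cmod a powr (p - 1) - cmod b powr (p - 1)"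
      using pw[of "cmod a"] mult_left_mono[OF assms(2), of ?A] by (simp add: mult.commute)
    also have "\<dots> \<le> (p - 1) * ?A * (cmod a - cmod b)"
      using powr_diff_le_real[of "p - 1" "cmod b" "cmod a"] assms by simp
    also have "\<dots> \<le> (p - 1) * ?A * cmod (a - b)"
      using p by (intro mult_left_mono norm_triangle_ineq2) auto
    finally show ?thesis .
  qed
  finally show ?thesis by (simp add: algebra_simps)
qed

lemma lp_dual_diff_le:
  assumes p: "2 < p"
  shows "cmod (lp_dual p (z + w) - lp_dual p z) \<le> p * (cmod z + cmod w) powr (p - 2) * cmod w"
proof -
  define m where "m = max (cmod (z + w)) (cmod z)"
  have "cmod (lp_dual p (z + w) - lp_dual p z) \<le> p * m powr (p - 2) * cmod w"
  proof (cases "cmod z \<le> cmod (z + w)")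
    case True
    then show ?thesis using lp_dual_diff_le_aux[OF p True] by (simp add: m_def max_def)
  next
    case False
    then show ?thesis
      using lp_dual_diff_le_aux[OF p, of "z + w" z] by (simp add: m_def max_def norm_minus_commute)
  qed
  also have "\<dots> \<le> p * (cmod z + cmod w) powr (p - 2) * cmod w"
    using p norm_triangle_ineq[of z w]
    by (intro mult_right_mono mult_left_mono powr_mono2) (auto simp: m_def le_max_iff_disj)
  finally show ?thesis .
qed

lemma power2_powr_half:
  fixes x r :: real
  assumes "0 \<le> x"
  shows "x\<^sup>2 powr (r / 2) = x powr r"
proof -
  have "x\<^sup>2 powr (r / 2) = (x powr 2) powr (r / 2)" using assms by simp
  then show ?thesis unfolding powr_powr by simp
qed

lemma has_vector_derivative_quotient:
  assumes "(f has_vector_derivative D) (at x)"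
  shows "((\<lambda>h. (f (x + h) - f x) /\<^sub>R h) \<longlongrightarrow> D) (at 0)"
proof -
  have "(\<lambda>h. norm (f (x + h) - f x - h *\<^sub>R D) / norm h) \<midarrow>0\<rightarrow> 0"
    using assms by (simp add: has_vector_derivative_def has_derivative_at)
  moreover have "\<forall>\<^sub>F h in at 0. norm (f (x + h) - f x - h *\<^sub>R D) / norm h
      = norm ((f (x + h) - f x) /\<^sub>R h - D)"
    unfolding eventually_at_filter
  proof (intro always_eventually allI impI)
    fix h :: real assume "h \<noteq> 0"
    then have "(f (x + h) - f x) /\<^sub>R h - D = (f (x + h) - f x - h *\<^sub>R D) /\<^sub>R h"
      by (simp add: scaleR_diff_right)
    then show "norm (f (x + h) - f x - h *\<^sub>R D) / norm h = norm ((f (x + h) - f x) /\<^sub>R h - D)"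
      by (simp add: divide_inverse_commute)
  qed
  ultimately have "(\<lambda>h. norm ((f (x + h) - f x) /\<^sub>R h - D)) \<midarrow>0\<rightarrow> 0"
    by (rule Lim_transform_eventually)
  then show ?thesis by (rule LIM_zero_cancel[OF tendsto_norm_zero_cancel])
qed

text \<open>The product rule, with the modulus written as a power of the quadratic polynomial
  \<open>N\<close>, which is smooth. At \<open>z = 0\<close> homogeneity leaves the factor
  \<open>inverse (real (Suc n)) powr (p - 2)\<close>, which tends to 0 because
  \<open>p > 2\<close>.\<close>

lemma lp_dual_directional:
  assumes p: "2 < p"
  shows "(\<lambda>n. of_nat (Suc n) * (lp_dual p (z + w / of_nat (Suc n)) - lp_dual p z)) \<longlonglongrightarrow>
    complex_of_real ((p - 2) * (cmod z)\<^sup>2 powr ((p - 4) / 2) * Re (cnj z * w)) * cnj z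
      + complex_of_real (cmod z powr (p - 2)) * cnj w" (is "?f \<longlonglongrightarrow> ?D")
proof (cases "z = 0")
  case True
  have "?f = (\<lambda>n. complex_of_real (inverse (real (Suc n)) powr (p - 2)) * lp_dual p w)"
  proof
    fix n
    define m where "m = real (Suc n)"
    have m: "0 < m" by (simp add: m_def)
    have "lp_dual p (w / complex_of_real m) = lp_dual p (complex_of_real (inverse m) * w)"
      by (simp add: field_simps)
    also have "\<dots> = complex_of_real (inverse m powr (p - 1)) * lp_dual p w"
      using m unfolding lp_dual_mult by (subst lp_dual_of_real) simp_all
    also have "inverse m powr (p - 1) = inverse m * inverse m powr (p - 2)"
      using powr_mult_base[of "inverse m" "p - 2"] m by simp
    finally have "complex_of_real m * lp_dual p (w / complex_of_real m)
        = complex_of_real (inverse m powr (p - 2)) * lp_dual p w"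
      using m by simp
    moreover have "of_nat (Suc n) = complex_of_real m" by (simp add: m_def)
    ultimately show "?f n = complex_of_real (inverse (real (Suc n)) powr (p - 2)) * lp_dual p w"
      using True by (simp only: m_def add_0 lp_dual_0 diff_zero)
  qed
  moreover have "(\<lambda>n. inverse (real (Suc n)) powr (p - 2)) \<longlonglongrightarrow> 0 powr (p - 2)"
    using p LIMSEQ_inverse_real_of_nat by (intro tendsto_powr') (auto simp del: of_nat_Suc)
  then have "(\<lambda>n. complex_of_real (inverse (real (Suc n)) powr (p - 2)) * lp_dual p w) \<longlonglongrightarrow> 0"
    using tendsto_mult[OF tendsto_of_real tendsto_const] by fastforce
  ultimately show ?thesis using True by simp
next
  case False
  define N where "N t = (Re z + t * Re w)\<^sup>2 + (Im z + t * Im w)\<^sup>2" for t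
  have N: "(cmod (z + complex_of_real t * w))\<^sup>2 = N t" for t
    by (simp add: N_def cmod_power2)
  have N0: "N 0 = (cmod z)\<^sup>2" using N[of 0] by simp
  have Npos: "0 < N 0" using False N0 by simp
  have npow: "cmod (z + complex_of_real t * w) powr (p - 2) = N t powr ((p - 2) / 2)" for t
    by (simp add: power2_powr_half flip: N)
  have N': "(N has_field_derivative 2 * Re (cnj z * w)) (at 0)"
    unfolding N_def by (auto intro!: derivative_eq_intros simp: algebra_simps)
  have exponent: "(p - 2) / 2 - of_nat 1 = (p - 4) / 2" by (simp add: field_simps)
  have "((\<lambda>t. N t powr ((p - 2) / 2)) has_field_derivative
      (p - 2) * (cmod z)\<^sup>2 powr ((p - 4) / 2) * Re (cnj z * w)) (at 0)"
    using DERIV_fun_powr[OF N' Npos, of "(p - 2) / 2"] unfolding exponent N0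
    by (rule DERIV_cong) simp
  then have "((\<lambda>t. complex_of_real (N t powr ((p - 2) / 2)) * cnj (z + complex_of_real t * w))
      has_vector_derivative complex_of_real (N 0 powr ((p - 2) / 2)) * cnj w
        + complex_of_real ((p - 2) * (cmod z)\<^sup>2 powr ((p - 4) / 2) * Re (cnj z * w))
          * cnj (z + complex_of_real 0 * w)) (at 0)"
    by (intro has_vector_derivative_mult has_vector_derivative_of_real)
      (auto intro!: derivative_eq_intros)
  moreover have "N 0 powr ((p - 2) / 2) = cmod z powr (p - 2)"
    using npow[of 0] by simp
  ultimately have "((\<lambda>t. lp_dual p (z + complex_of_real t * w)) has_vector_derivative ?D) (at 0)"
    unfolding lp_dual_altdef npow by (simp add: add.commute)
  then have "((\<lambda>t. (lp_dual p (z + complex_of_real t * w) - lp_dual p z) /\<^sub>R t) \<longlongrightarrow> ?D) (at 0)"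
    by (drule_tac has_vector_derivative_quotient) (simp only: add_0_left of_real_0 mult_zero_left add_0_right)
  then have "((\<lambda>t. (lp_dual p (z + complex_of_real t * w) - lp_dual p z) /\<^sub>R t)
      \<circ> (\<lambda>n. inverse (real (Suc n)))) \<longlonglongrightarrow> ?D"
    using LIMSEQ_inverse_real_of_nat by (auto simp: tendsto_at_iff_sequentially)
  moreover have "((\<lambda>t. (lp_dual p (z + complex_of_real t * w) - lp_dual p z) /\<^sub>R t)
      \<circ> (\<lambda>n. inverse (real (Suc n)))) = ?f"
    by (rule ext) (simp add: scaleR_conv_of_real divide_inverse mult.commute del: of_nat_Suc)
  ultimately show ?thesis by simp
qed

text \<open>\<open>lp_dual p\<close> is only real differentiable; adding \<open>\<i>\<close> times the derivative in direction \<open>\<i> w\<close>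
  isolates the antilinear part of its derivative.\<close>

lemma lp_dual_antilinear_derivative:
  assumes p: "2 < p"
  shows "(\<lambda>n. of_nat (Suc n) * (lp_dual p (z + w / of_nat (Suc n)) - lp_dual p z)
      + \<i> * (of_nat (Suc n) * (lp_dual p (z + (\<i> * w) / of_nat (Suc n)) - lp_dual p z))) \<longlonglongrightarrow>
    complex_of_real (p * cmod z powr (p - 2)) * cnj w" (is "?f \<longlonglongrightarrow> _")
proof -
  let ?A = "(p - 2) * (cmod z)\<^sup>2 powr ((p - 4) / 2)"
  define D where "D w = complex_of_real (?A * Re (cnj z * w)) * cnj z
      + complex_of_real (cmod z powr (p - 2)) * cnj w" for w
  have "?f \<longlonglongrightarrow> D w + \<i> * D (\<i> * w)"
    unfolding D_def by (intro tendsto_add tendsto_mult_left lp_dual_directional p)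
  also have "D w + \<i> * D (\<i> * w)
      = complex_of_real ?A * ((Re (cnj z * w) + \<i> * Re (cnj z * (\<i> * w))) * cnj z)
        + 2 * complex_of_real (cmod z powr (p - 2)) * cnj w"
    by (simp add: D_def algebra_simps)
  also have "Re (cnj z * w) + \<i> * Re (cnj z * (\<i> * w)) = cnj (cnj z * w)"
    by (simp add: complex_eq_iff)
  also have "complex_of_real ?A * (cnj (cnj z * w) * cnj z)
      = complex_of_real (?A * (cmod z)\<^sup>2) * cnj w"
    using complex_norm_square[of z] by (simp add: algebra_simps)
  also have "?A * (cmod z)\<^sup>2 = (p - 2) * cmod z powr (p - 2)"
  proof (cases "z = 0")
    case False
    have "(cmod z)\<^sup>2 powr ((p - 4) / 2) * (cmod z)\<^sup>2 = (cmod z)\<^sup>2 powr ((p - 2) / 2)"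
      using False powr_mult_base[of "(cmod z)\<^sup>2" "(p - 4) / 2"]
      by (simp add: mult.commute diff_divide_distrib)
    also have "\<dots> = cmod z powr (p - 2)" by (rule power2_powr_half) simp
    finally show ?thesis by simp
  qed simp
  finally show ?thesis by (simp add: algebra_simps)
qed

section \<open>Absolute values and phases in the fixed space\<close>

context contractive_forms
begin

text \<open>\<open>E'\<close> contains the dual of \<open>f + c * g\<close> for every
  \<open>c\<close>, hence the difference quotients and, by domination, their limits. Only the
  antilinear part of the derivative is kept, since its phase comes from \<open>g\<close>
  alone.\<close>

lemma lp_dual_power_fixed:
  assumes p: "2 < p" and f: "f \<in> E" and g: "g \<in> E"
  shows "(\<lambda>x. complex_of_real (cmod (f x) powr (p - 2)) * cnj (g x)) \<in> E'"
proof -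
  interpret S: contractive_forms q p M \<Phi> "\<lambda>t g f. B t f g" by (rule swap_forms)
  define h where "h n = (\<lambda>x. of_nat (Suc n) * (lp_dual p (f x + g x / of_nat (Suc n)) - lp_dual p (f x))
      + \<i> * (of_nat (Suc n) * (lp_dual p (f x + (\<i> * g x) / of_nat (Suc n)) - lp_dual p (f x))))" for n
  have dual_E: "(\<lambda>x. lp_dual p (f x + c * g x)) \<in> E'" for c
    using lp_dual_fixed[OF fixed_add[OF f fixed_scale[OF g]]] .
  have h_E': "h n \<in> E'" for n
  proof -
    have "(\<lambda>x. lp_dual p (f x + g x / of_nat (Suc n))) \<in> E'"
      "(\<lambda>x. lp_dual p (f x + (\<i> * g x) / of_nat (Suc n))) \<in> E'"
      using dual_E[of "1 / of_nat (Suc n)"] dual_E[of "\<i> / of_nat (Suc n)"] by simp_all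
    then show ?thesis
      unfolding h_def
      by (rule S.fixed_add[OF S.fixed_scale[OF S.fixed_diff] S.fixed_scale[OF S.fixed_scale[OF S.fixed_diff]],
            OF _ lp_dual_fixed[OF f] _ lp_dual_fixed[OF f]])
  qed
  have h_bound: "cmod (h n x) \<le> (2 * p) * (cmod (f x) + cmod (g x)) powr (p - 1)" for n x
  proof -
    let ?a = "cmod (f x) + cmod (g x)"
    have *: "cmod (of_nat (Suc n) * (lp_dual p (f x + w / of_nat (Suc n)) - lp_dual p (f x)))
        \<le> p * ?a powr (p - 1)" if w: "cmod w = cmod (g x)" for w
    proof -
      have "cmod (of_nat (Suc n) * (lp_dual p (f x + w / of_nat (Suc n)) - lp_dual p (f x)))
          \<le> real (Suc n) * (p * (cmod (f x) + cmod (w / of_nat (Suc n))) powr (p - 2)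
              * cmod (w / of_nat (Suc n)))"
        unfolding norm_mult norm_of_nat by (intro mult_left_mono lp_dual_diff_le p) simp
      also have "\<dots> = p * (cmod (f x) + cmod (w / of_nat (Suc n))) powr (p - 2) * cmod (g x)"
        by (simp add: norm_divide w del: of_nat_Suc)
      also have "\<dots> \<le> p * ?a powr (p - 2) * ?a"
      proof -
        have "cmod (w / of_nat (Suc n)) \<le> cmod (g x)"
          using divide_left_mono[of 1 "real (Suc n)" "cmod (g x)"]
          by (simp add: norm_divide w del: of_nat_Suc)
        then show ?thesis
          using p by (intro mult_mono mult_left_mono powr_mono2) auto
      qed
      also have "\<dots> = p * ?a powr (p - 1)"
        using powr_mult_base[of ?a "p - 2"] by (simp add: mult.commute mult.left_commute)
      finally show ?thesis .
    qed
    have "cmod (h n x) \<le> p * ?a powr (p - 1) + cmod \<i> * (p * ?a powr (p - 1))"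
      unfolding h_def by (intro norm_triangle_mono *) (simp_all only: norm_mult[of \<i>] norm_ii mult_1 *)
    then show ?thesis by simp
  qed
  have "(\<lambda>x. complex_of_real (p * cmod (f x) powr (p - 2)) * cnj (g x)) \<in> E'"
  proof (rule S.fixed_bounded_limit[OF h_E'])
    show "(\<lambda>x. complex_of_real (p * cmod (f x) powr (p - 2)) * cnj (g x)) \<in> borel_measurable M"
      using f g by measurable
    show "AE x in M. cmod (h n x) \<le> (2 * p) * (cmod (f x) + cmod (g x)) powr (p - 1)" for n
      using h_bound by simp
    have "((2 * p) * (cmod (f x) + cmod (g x)) powr (p - 1)) powr q
        = (2 * p) powr q * (cmod (f x) + cmod (g x)) powr p" for x
      using p by (simp add: powr_mult powr_powr p_minus_1_mult)
    then show "integrable M (\<lambda>x. ((2 * p) * (cmod (f x) + cmod (g x)) powr (p - 1)) powr q)"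
      using Lp_funs_add_integrable[OF fixed_Lp[OF f] fixed_Lp[OF g]] p by simp
    show "AE x in M. (\<lambda>n. h n x) \<longlonglongrightarrow> complex_of_real (p * cmod (f x) powr (p - 2)) * cnj (g x)"
      unfolding h_def by (intro AE_I2 lp_dual_antilinear_derivative p)
  qed
  from S.fixed_scale[OF this, of "complex_of_real (1 / p)"]
  have "(\<lambda>x. complex_of_real (1 / p) * (complex_of_real (p * cmod (f x) powr (p - 2)) * cnj (g x))) \<in> E'" .
  moreover have "complex_of_real (1 / p) * (complex_of_real (p * r) * w) = complex_of_real r * w" for r w
    using p by simp
  ultimately show ?thesis by simp
qed

text \<open>A second duality map leads back to \<open>E\<close>; it turns the exponent
  \<open>p - 2\<close> into \<open>(p - 2) * (q - 1) = 2 - q\<close>, so that the two exponents add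
  up to 1.\<close>

lemma power_fixed:
  assumes p: "2 < p" and f: "f \<in> E" and g: "g \<in> E"
  shows "(\<lambda>x. complex_of_real (cmod (f x) powr (2 - q) * cmod (g x) powr (q - 1)) * sgn (g x)) \<in> E"
proof -
  interpret S: contractive_forms q p M \<Phi> "\<lambda>t g f. B t f g" by (rule swap_forms)
  have e: "(p - 2) * (q - 1) = 2 - q"
    using p_minus_1_mult(1) by (simp add: algebra_simps)
  have "lp_dual q (complex_of_real (a powr (p - 2)) * cnj w)
      = complex_of_real (a powr (2 - q) * cmod w powr (q - 1)) * sgn w" for a w
  proof -
    have "lp_dual q (cnj w) = complex_of_real (cmod w powr (q - 1)) * sgn w"
      by (simp add: lp_dual_def sgn_eq)
    then show ?thesis
      by (simp add: lp_dual_mult lp_dual_of_real powr_powr e)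
  qed
  then show ?thesis
    using S.lp_dual_fixed[OF lp_dual_power_fixed[OF assms]] by simp
qed

text \<open>Iterating \<open>power_fixed\<close> with the same \<open>f\<close> multiplies the
  exponent of \<open>cmod (g x)\<close> by \<open>q - 1\<close> each time, and
  \<open>q - 1 < 1\<close> for \<open>p > 2\<close>. In the limit only the phase of \<open>g\<close>
  remains.\<close>

lemma abs_sgn_fixed_gt_2:
  assumes p: "2 < p" and f: "f \<in> E" and g: "g \<in> E"
  shows "(\<lambda>x. complex_of_real (cmod (f x)) * sgn (g x)) \<in> E"
proof -
  define b where "b n = (q - 1) ^ Suc n" for n
  have q2: "q < 2"
  proof -
    have "q - 1 = 1 / (p - 1)"
      using p_minus_1_mult(1) p_gt_1 by (simp add: nonzero_eq_divide_eq mult.commute)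
    also have "\<dots> < 1" using p by simp
    finally show ?thesis by simp
  qed
  have b: "0 < b n" "b n < 1" for n
    using q2 q_gt_1 power_Suc_less_one[of "q - 1" n] unfolding b_def by simp_all
  define h where "h n = (\<lambda>x. complex_of_real (cmod (f x) powr (1 - b n) * cmod (g x) powr b n) * sgn (g x))" for n
  have sgn_norm: "cmod (complex_of_real r * sgn w) = (if w = 0 then 0 else \<bar>r\<bar>)" for r w
    by (simp add: norm_mult norm_sgn)
  have h_E: "h n \<in> E" for n
  proof (induction n)
    case 0
    have "1 - b 0 = 2 - q" "b 0 = q - 1" by (simp_all add: b_def)
    then show ?case using power_fixed[OF assms] by (simp only: h_def)
  next
    case (Suc n)
    have "h (Suc n) = (\<lambda>x. complex_of_real (cmod (f x) powr (2 - q) * cmod (h n x) powr (q - 1)) * sgn (h n x))"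
    proof
      fix x
      show "h (Suc n) x = complex_of_real (cmod (f x) powr (2 - q) * cmod (h n x) powr (q - 1)) * sgn (h n x)"
      proof (cases "f x = 0 \<or> g x = 0")
        case True
        then show ?thesis by (auto simp: h_def)
      next
        case False
        let ?r = "cmod (f x) powr (1 - b n) * cmod (g x) powr b n"
        have r: "0 < ?r" using False by simp
        have 1: "cmod (h n x) = ?r" using False by (simp add: h_def norm_mult norm_sgn)
        have 2: "sgn (h n x) = sgn (g x)"
          using r by (simp add: h_def sgn_mult_complex sgn_of_real del: of_real_mult)
        have "cmod (f x) powr (2 - q) * ?r powr (q - 1)
            = cmod (f x) powr (2 - q + (1 - b n) * (q - 1)) * cmod (g x) powr (b n * (q - 1))"
          by (simp add: powr_mult powr_powr powr_add)
        also have "2 - q + (1 - b n) * (q - 1) = 1 - b (Suc n)"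
          by (simp add: b_def algebra_simps)
        also have "b n * (q - 1) = b (Suc n)"
          by (simp add: b_def)
        finally show ?thesis
          unfolding 1 2 by (simp add: h_def)
      qed
    qed
    then show ?case using power_fixed[OF p f Suc] by simp
  qed
  have b_lim: "b \<longlonglongrightarrow> 0"
    unfolding b_def using q2 q_gt_1 by (intro LIMSEQ_Suc LIMSEQ_realpow_zero) auto
  show ?thesis
  proof (rule fixed_bounded_limit[OF h_E])
    show "(\<lambda>x. complex_of_real (cmod (f x)) * sgn (g x)) \<in> borel_measurable M"
      using f g by measurable
    show "integrable M (\<lambda>x. (cmod (f x) + cmod (g x)) powr p)"
      using Lp_funs_add_integrable[OF fixed_Lp[OF f] fixed_Lp[OF g]] p by simp
    show "AE x in M. cmod (h n x) \<le> cmod (f x) + cmod (g x)" for n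
    proof (intro AE_I2)
      fix x
      let ?a = "cmod (f x) + cmod (g x)"
      have "cmod (f x) powr (1 - b n) * cmod (g x) powr b n \<le> ?a powr (1 - b n) * ?a powr b n"
        using b[of n] by (intro mult_mono powr_mono2) auto
      also have "\<dots> = ?a" by (simp flip: powr_add)
      finally show "cmod (h n x) \<le> ?a"
        by (simp add: h_def norm_mult norm_sgn)
    qed
    show "AE x in M. (\<lambda>n. h n x) \<longlonglongrightarrow> complex_of_real (cmod (f x)) * sgn (g x)"
    proof (intro AE_I2)
      fix x
      show "(\<lambda>n. h n x) \<longlonglongrightarrow> complex_of_real (cmod (f x)) * sgn (g x)"
      proof (cases "f x = 0 \<or> g x = 0")
        case True
        then show ?thesis by (auto simp: h_def)
      next
        case False
        have "(\<lambda>n. h n x) \<longlonglongrightarrow>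
            complex_of_real (cmod (f x) powr (1 - 0) * cmod (g x) powr 0) * sgn (g x)"
          unfolding h_def using False b_lim
          by (intro tendsto_mult tendsto_of_real tendsto_powr tendsto_diff tendsto_const) auto
        then show ?thesis using False by simp
      qed
    qed
  qed
qed

end

text \<open>The map \<open>f \<mapsto> lp_dual p \<circ> f\<close> intertwines the operation with its analogue on the dual side,
  so the case \<open>p < 2\<close> is the case \<open>q > 2\<close> transported.\<close>

lemma (in contractive_forms) abs_sgn_fixed:
  assumes p: "p \<noteq> 2" and f: "f \<in> E" and g: "g \<in> E"
  shows "(\<lambda>x. complex_of_real (cmod (f x)) * sgn (g x)) \<in> E"
proof (cases "2 < p")
  case True
  then show ?thesis using abs_sgn_fixed_gt_2 assms by simp
next
  case False
  interpret S: contractive_forms q p M \<Phi> "\<lambda>t g f. B t f g" by (rule swap_forms)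
  have "p < 2" using False p by simp
  then have "2 < q"
  proof -
    have "q - 1 = 1 / (p - 1)"
      using p_minus_1_mult(1) p_gt_1 by (simp add: nonzero_eq_divide_eq mult.commute)
    moreover have "1 < 1 / (p - 1)" using p_gt_1 \<open>p < 2\<close> by simp
    ultimately show ?thesis by simp
  qed
  from S.abs_sgn_fixed_gt_2[OF this lp_dual_fixed[OF f] lp_dual_fixed[OF g]]
  have "(\<lambda>x. lp_dual q (complex_of_real (cmod (lp_dual p (f x))) * sgn (lp_dual p (g x)))) \<in> E"
    by (rule S.lp_dual_fixed)
  moreover have "lp_dual q (complex_of_real (cmod (lp_dual p z)) * sgn (lp_dual p w))
      = complex_of_real (cmod z) * sgn w" for z w
  proof -
    have "lp_dual q (complex_of_real (cmod (lp_dual p z))) = complex_of_real (cmod z)"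
      using p_minus_1_mult(1) by (simp add: lp_dual_of_real norm_lp_dual powr_powr)
    moreover have "lp_dual q (sgn (lp_dual p w)) = sgn w"
      by (simp add: lp_dual_cnj_sgn sgn_lp_dual)
    ultimately show ?thesis by (simp add: lp_dual_mult)
  qed
  ultimately show ?thesis by simp
qed

section \<open>Hermitian operators on the fixed subspace\<close>

lemma eq_0_if_quadratic_bound:
  fixes y K :: real
  assumes "\<And>r. \<bar>r\<bar> \<le> 1 \<Longrightarrow> r * y \<le> K * r\<^sup>2"
  shows "y = 0"
proof (rule ccontr)
  assume y: "y \<noteq> 0"
  \<comment> \<open>\<open>r = y / L\<close> is admissible and turns the hypothesis into
    \<open>y^2 * L \<le> y^2 * K\<close>, although \<open>K < L\<close>.\<close>
  define L where "L = \<bar>y\<bar> + \<bar>K\<bar>"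
  have L: "0 < L" "\<bar>y\<bar> \<le> L" "K < L" using y unfolding L_def by auto
  have "\<bar>y / L\<bar> \<le> 1" using L by (simp add: abs_divide)
  from assms[OF this] have "y\<^sup>2 / L \<le> K * (y\<^sup>2 / L\<^sup>2)"
    by (simp add: power2_eq_square)
  then have "y\<^sup>2 * L \<le> y\<^sup>2 * K"
    using L by (simp add: field_simps power2_eq_square)
  then show False using y L by simp
qed

context contractive_forms
begin

text \<open>Elements of \<open>E\<close> are functions rather than classes, so linearity is required
  almost everywhere only.\<close>

definition fixed_operator :: "real \<Rightarrow> (('x \<Rightarrow> complex) \<Rightarrow> 'x \<Rightarrow> complex) \<Rightarrow> bool"
  where "fixed_operator C H \<longleftrightarrow> 0 \<le> C \<and> (\<forall>f\<in>E. H f \<in> E) \<and>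
    (\<forall>f\<in>E. \<forall>g\<in>E. AE x in M. H (\<lambda>x. f x + g x) x = H f x + H g x) \<and>
    (\<forall>c. \<forall>f\<in>E. AE x in M. H (\<lambda>x. c * f x) x = c * H f x) \<and>
    (\<forall>f\<in>E. mass p M (H f) \<le> C powr p * mass p M f)"

text \<open>Supports are tested against elements of \<open>E\<close>, because multiplication by an
  indicator function need not preserve \<open>E\<close>.\<close>

definition local_operator :: "(('x \<Rightarrow> complex) \<Rightarrow> 'x \<Rightarrow> complex) \<Rightarrow> bool"
  where "local_operator H \<longleftrightarrow> (\<forall>f\<in>E. \<forall>g\<in>E.
    (AE x in M. f x = 0 \<or> g x = 0) \<longrightarrow> (AE x in M. H f x = 0 \<or> g x = 0))"

text \<open>No multiplier function on the whole space is chosen: the cross relation says that the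
  quotients \<open>H f / f\<close> and \<open>H g / g\<close> agree where both denominators are
  nonzero.\<close>

definition real_multiplier :: "(('x \<Rightarrow> complex) \<Rightarrow> 'x \<Rightarrow> complex) \<Rightarrow> bool"
  where "real_multiplier H \<longleftrightarrow> (\<forall>f\<in>E. AE x in M. cmod (H f x) \<le> cmod (f x) \<and> Im (H f x * cnj (f x)) = 0) \<and>
    (\<forall>f\<in>E. \<forall>g\<in>E. AE x in M. H f x * g x = f x * H g x)"

definition symmetric_operator :: "(('x \<Rightarrow> complex) \<Rightarrow> 'x \<Rightarrow> complex) \<Rightarrow> bool"
  where "symmetric_operator H \<longleftrightarrow> (\<forall>f\<in>E. \<forall>g\<in>E.
    pairing M (H f) (\<lambda>x. cnj (g x)) = cnj (pairing M (H g) (\<lambda>x. cnj (f x))))"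

lemma fixed_operatorD:
  assumes "fixed_operator C H" "f \<in> E"
  shows "H f \<in> E" "g \<in> E \<Longrightarrow> AE x in M. H (\<lambda>x. f x + g x) x = H f x + H g x"
    "AE x in M. H (\<lambda>x. c * f x) x = c * H f x" "mass p M (H f) \<le> C powr p * mass p M f"
  using assms by (auto simp: fixed_operator_def)

lemma fixed_operator_diff:
  assumes H: "fixed_operator C H" and f: "f \<in> E" and g: "g \<in> E"
  shows "AE x in M. H (\<lambda>x. f x - g x) x = H f x - H g x"
  using fixed_operatorD(2)[OF H f fixed_scale[OF g, of "-1"]] fixed_operatorD(3)[OF H g, of "-1"]
  by eventually_elim simp

lemma fixed_operator_cong:
  assumes H: "fixed_operator C H" and f: "f \<in> E" and g: "g \<in> E" and eq: "AE x in M. f x = g x"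
  shows "AE x in M. H f x = H g x"
proof -
  have d: "(\<lambda>x. f x - g x) \<in> E" using f g by (rule fixed_diff)
  have "mass p M (\<lambda>x. f x - g x) = 0"
    using eq by (subst mass_eq_0_iff[OF fixed_Lp[OF d]]) auto
  then have "mass p M (H (\<lambda>x. f x - g x)) = 0"
    using fixed_operatorD(4)[OF H d] mass_nonneg[of p M "H (\<lambda>x. f x - g x)"] by simp
  then have "AE x in M. H (\<lambda>x. f x - g x) x = 0"
    using mass_eq_0_iff[OF fixed_Lp[OF fixed_operatorD(1)[OF H d]]] by simp
  then show ?thesis
    using fixed_operator_diff[OF H f g] by eventually_elim simp
qed

text \<open>The difference of \<open>|k| sgn e\<close> and \<open>|u| sgn e\<close> has the phase of
  \<open>e\<close> times the sign \<sigma> of \<open>|k| - |u|\<close>, so \<open>e \<sigma>\<close>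
  lies in \<open>E\<close>; the indicator of \<open>\<sigma> = 1\<close> is
  \<open>(\<sigma> + \<sigma>^2) / 2\<close>.\<close>

lemma truncation_fixed:
  assumes p: "p \<noteq> 2" and e: "e \<in> E" and k: "k \<in> E" and u: "u \<in> E"
  shows "(\<lambda>x. if cmod (u x) < cmod (k x) then e x else 0) \<in> E"
proof -
  let ?s = "\<lambda>x. complex_of_real (sgn (cmod (k x) - cmod (u x)))"
  have *: "(\<lambda>x. e x * ?s x) \<in> E" if e: "e \<in> E" for e
  proof -
    have "(\<lambda>x. complex_of_real (cmod (e x)) * sgn (complex_of_real (cmod (k x)) * sgn (e x)
        - complex_of_real (cmod (u x)) * sgn (e x))) \<in> E"
      by (intro abs_sgn_fixed[OF p] fixed_diff e k u)
    moreover have "complex_of_real (cmod z) * sgn (complex_of_real a * sgn z - complex_of_real b * sgn z)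
        = z * complex_of_real (sgn (a - b))" for z a b
    proof -
      have "complex_of_real a * sgn z - complex_of_real b * sgn z = complex_of_real (a - b) * sgn z"
        by (simp add: left_diff_distrib)
      then have "sgn (complex_of_real a * sgn z - complex_of_real b * sgn z)
          = complex_of_real (sgn (a - b)) * sgn z"
        by (cases "z = 0") (simp_all only: sgn_mult_complex sgn_of_real sgn_eq[of "sgn z"] norm_sgn, simp_all)
      moreover have "complex_of_real (cmod z) * sgn z = z"
        by (cases "z = 0") (simp_all add: sgn_eq)
      ultimately show ?thesis by (metis mult.commute mult.left_commute)
    qed
    ultimately show ?thesis by simp
  qed
  have "(\<lambda>x. (1 / 2) * (e x * ?s x + e x * ?s x * ?s x)) \<in> E"
    by (intro fixed_scale fixed_add *[OF *] * e)
  moreover have "(1 / 2) * (z * complex_of_real (sgn r) + z * complex_of_real (sgn r) * complex_of_real (sgn r))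
      = (if 0 < r then z else 0)" for z r
    by (cases r "0::real" rule: linorder_cases) auto
  ultimately show ?thesis by simp
qed

lemma local_if_numerically_real:
  assumes p: "p \<noteq> 2" and H: "fixed_operator C H"
    and real: "\<And>f. f \<in> E \<Longrightarrow> Im (pairing M (H f) (dual f)) = 0"
  shows "local_operator H"
  unfolding local_operator_def
proof (intro ballI impI)
  have orth: "pairing M (H f) (dual g) = 0"
    if f: "f \<in> E" and g: "g \<in> E" and disj: "AE x in M. f x = 0 \<or> g x = 0" for f g
  proof -
    define a where "a = pairing M (H f) (dual g)"
    define b where "b = pairing M (H g) (dual f)"
    note L = fixed_Lp[OF fixed_operatorD(1)[OF H f]] fixed_Lp[OF fixed_operatorD(1)[OF H g]]
      lp_dual_Lp_funs[OF fixed_Lp[OF f]] lp_dual_Lp_funs[OF fixed_Lp[OF g]]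
    \<comment> \<open>Disjointness makes the duality map additive on \<open>f + z g\<close>, and the
      diagonal terms are real, so only the cross terms remain.\<close>
    have key: "Im (lp_dual p z * a + z * b) = 0" for z
    proof -
      have zg: "(\<lambda>x. z * g x) \<in> E" using g by (rule fixed_scale)
      have fzg: "(\<lambda>x. f x + z * g x) \<in> E" using f zg by (rule fixed_add)
      have 1: "AE x in M. H (\<lambda>x. f x + z * g x) x = H f x + z * H g x"
        using fixed_operatorD(2)[OF H f zg] fixed_operatorD(3)[OF H g, of z]
        by eventually_elim simp
      have 2: "AE x in M. lp_dual p (f x + z * g x) = lp_dual p (f x) + lp_dual p z * lp_dual p (g x)"
        using disj by eventually_elim (auto simp: lp_dual_mult)
      have S: "(\<lambda>x. H f x + z * H g x) \<in> Lp_funs p M"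
        using p_gt_1 L by (intro Lp_funs_add Lp_funs_scale) auto
      have T: "(\<lambda>x. lp_dual p (f x) + lp_dual p z * lp_dual p (g x)) \<in> Lp_funs q M"
        using q_gt_1 L by (intro Lp_funs_add Lp_funs_scale) auto
      have "pairing M (H (\<lambda>x. f x + z * g x)) (\<lambda>x. lp_dual p (f x + z * g x))
          = pairing M (\<lambda>x. H f x + z * H g x) (\<lambda>x. lp_dual p (f x) + lp_dual p z * lp_dual p (g x))"
        by (rule pairing_cong[OF 1 _ _ 2])
          (use S T fixed_operatorD(1)[OF H fzg] lp_dual_Lp_funs[OF fixed_Lp[OF fzg]] in
            \<open>auto intro: Lp_funs_measurable fixed_Lp\<close>)
      also have "\<dots> = pairing M (H f) (dual f) + lp_dual p z * a
          + z * b + z * lp_dual p z * pairing M (H g) (dual g)"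
        using L T by (simp add: pairing_add_left pairing_add_right pairing_scale_left pairing_scale_right
            Lp_funs_scale a_def b_def algebra_simps)
      finally have "0 = Im (pairing M (H f) (dual f) + (lp_dual p z * a
          + z * b) + z * lp_dual p z * pairing M (H g) (dual g))"
        using real[OF fzg] by (simp only: add.assoc)
      then show ?thesis
        using real[OF f] real[OF g] by (simp add: mult_lp_dual)
    qed
    have J: "lp_dual p 2 = complex_of_real (2 powr (p - 1))"
      using lp_dual_of_real[of 2 p] by simp
    have Ji: "lp_dual p \<i> = - \<i>" by (simp add: lp_dual_def sgn_eq)
    \<comment> \<open>The values \<open>z = 1\<close> and \<open>z = \<i>\<close> give
      \<open>b = cnj a\<close>; doubling \<open>z\<close> multiplies the two terms by
      \<open>2 powr (p - 1)\<close> and by 2, which differ for \<open>p \<noteq> 2\<close>.\<close>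
    have "2 powr (p - 1) \<noteq> (2::real)"
      using powr_inj[of 2 "p - 1" 1] p by simp
    moreover have "Im b = - Im a" "Re b = Re a"
      using key[of 1] key[of \<i>] Ji by simp_all
    moreover from this have "(2 powr (p - 1) - 2) * Im a = 0" "(2 powr (p - 1) - 2) * Re a = 0"
      using key[of 2] key[of "2 * \<i>"] J Ji by (simp_all add: lp_dual_mult left_diff_distrib)
    ultimately have "a = 0" by (simp add: complex_eq_iff)
    then show ?thesis by (simp add: a_def)
  qed
  fix f g assume f: "f \<in> E" and g: "g \<in> E" and disj: "AE x in M. f x = 0 \<or> g x = 0"
  have k: "H f \<in> E" by (rule fixed_operatorD(1)[OF H f])
  \<comment> \<open>Giving \<open>g\<close> the phase of \<open>H f\<close> makes the integrand
    nonnegative, so that a vanishing integral forces it to vanish almost everywhere.\<close>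
  let ?g = "\<lambda>x. complex_of_real (cmod (g x)) * sgn (H f x)"
  have g': "?g \<in> E" by (rule abs_sgn_fixed[OF p g k])
  have "pairing M (H f) (dual ?g) = 0"
    using disj by (intro orth[OF f g']) auto
  moreover have eq: "H f x * lp_dual p (?g x) = complex_of_real (cmod (H f x) * cmod (g x) powr (p - 1))" for x
  proof -
    have "H f x * cnj (sgn (H f x)) = complex_of_real (cmod (H f x))"
      using mult_lp_dual[of "H f x" 1] by (cases "H f x = 0") (simp_all add: lp_dual_def)
    moreover have "lp_dual p (sgn (H f x)) = cnj (sgn (H f x))"
      using lp_dual_cnj_sgn[of p "cnj (H f x)"] by (simp add: sgn_eq)
    ultimately show ?thesis by (simp add: lp_dual_mult lp_dual_of_real mult.left_commute mult.commute)
  qed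
  ultimately have "(\<integral>x. complex_of_real (cmod (H f x) * cmod (g x) powr (p - 1)) \<partial>M) = 0"
    by (simp add: pairing_def)
  then have int0: "(\<integral>x. cmod (H f x) * cmod (g x) powr (p - 1) \<partial>M) = 0"
    unfolding integral_complex_of_real by simp
  have "integrable M (\<lambda>x. H f x * lp_dual p (?g x))"
    by (rule pairing_integrable[OF fixed_Lp[OF k] lp_dual_Lp_funs[OF fixed_Lp[OF g']]])
  from integrable_norm[OF this]
  have "integrable M (\<lambda>x. cmod (H f x) * cmod (g x) powr (p - 1))"
    unfolding eq norm_of_real by simp
  from integral_nonneg_eq_0_iff_AE[OF this] int0
  show "AE x in M. H f x = 0 \<or> g x = 0" by simp
qed

text \<open>On the set \<open>D\<close> where the bound fails, locality gives
  \<open>V u = V v\<close> for the truncation \<open>v\<close> of \<open>u\<close> to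
  \<open>D\<close>. The mass of \<open>V u\<close> over \<open>D\<close> is then at most that of
  \<open>C * v\<close>, which contradicts the pointwise inequality unless \<open>D\<close> is
  null.\<close>

lemma local_bound:
  assumes p: "p \<noteq> 2" and V: "fixed_operator C V" and loc: "local_operator V" and u: "u \<in> E"
  shows "AE x in M. cmod (V u x) \<le> C * cmod (u x)"
proof -
  have C: "0 \<le> C" using V by (simp add: fixed_operator_def)
  have k: "V u \<in> E" by (rule fixed_operatorD(1)[OF V u])
  let ?D = "\<lambda>x. cmod (C * u x) < cmod (V u x)"
  define v where "v = (\<lambda>x. if ?D x then u x else 0)"
  define v' where "v' = (\<lambda>x. u x - v x)"
  define w where "w = (\<lambda>x. if ?D x then V u x else 0)"
  have Cu: "(\<lambda>x. C * u x) \<in> E" by (rule fixed_scale[OF u])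
  have v: "v \<in> E" unfolding v_def by (rule truncation_fixed[OF p u k Cu])
  have v': "v' \<in> E" unfolding v'_def by (rule fixed_diff[OF u v])
  have w: "w \<in> E" unfolding w_def by (rule truncation_fixed[OF p k k Cu])
  have Cv: "(\<lambda>x. C * v x) \<in> E" by (rule fixed_scale[OF v])
  have Vv: "V v \<in> E" by (rule fixed_operatorD(1)[OF V v])
  have "AE x in M. V v' x = 0 \<or> w x = 0"
    using loc v' w unfolding local_operator_def by (auto simp: v'_def v_def w_def)
  moreover have "AE x in M. V v' x = V u x - V v x"
    unfolding v'_def by (rule fixed_operator_diff[OF V u v])
  ultimately have "AE x in M. cmod (w x) \<le> cmod (V v x)"
    by eventually_elim (auto simp: w_def)
  then have "mass p M w \<le> mass p M (V v)"
    using p_gt_1 w by (intro mass_mono fixed_Lp Vv) auto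
  also have "\<dots> \<le> mass p M (\<lambda>x. C * v x)"
    using fixed_operatorD(4)[OF V v] C by (simp add: mass_scale[of _ _ "complex_of_real C"])
  finally have "(\<integral>x. cmod (w x) powr p - cmod (C * v x) powr p \<partial>M) \<le> 0"
    using Lp_funsD[OF fixed_Lp[OF w]] Lp_funsD[OF fixed_Lp[OF Cv]] by (simp add: mass_def)
  moreover have nonneg: "0 \<le> cmod (w x) powr p - cmod (C * v x) powr p" for x
    using p_gt_1 by (auto simp: w_def v_def intro!: powr_mono2)
  ultimately have "(\<integral>x. cmod (w x) powr p - cmod (C * v x) powr p \<partial>M) = 0"
    by (simp add: order_antisym integral_nonneg_AE)
  moreover have "integrable M (\<lambda>x. cmod (w x) powr p - cmod (C * v x) powr p)"
    using Lp_funsD[OF fixed_Lp[OF w]] Lp_funsD[OF fixed_Lp[OF Cv]] by simp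
  ultimately have "AE x in M. cmod (w x) powr p - cmod (C * v x) powr p = 0"
    using nonneg by (subst (asm) integral_nonneg_eq_0_iff_AE) auto
  then show ?thesis
  proof eventually_elim
    case (elim x)
    show ?case
    proof (rule ccontr)
      assume "\<not> ?case"
      then have "?D x" using C by (simp add: norm_mult)
      then have "cmod (C * v x) powr p < cmod (w x) powr p"
        using p_gt_1 by (intro powr_less_mono2) (auto simp: w_def v_def)
      then show False using elim by simp
    qed
  qed
qed

lemma fixed_operator_combination:
  assumes H: "fixed_operator C H" and "0 \<le> C'"
    and "\<And>f. f \<in> E \<Longrightarrow> mass p M (\<lambda>x. a * f x + b * H f x) \<le> C' powr p * mass p M f"
  shows "fixed_operator C' (\<lambda>f x. a * f x + b * H f x)"
  unfolding fixed_operator_def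
proof (intro conjI ballI allI)
  show "(\<lambda>x. a * f x + b * H f x) \<in> E" if "f \<in> E" for f
    by (intro fixed_add fixed_scale fixed_operatorD(1)[OF H] that)
  show "AE x in M. a * (f x + g x) + b * H (\<lambda>x. f x + g x) x
      = (a * f x + b * H f x) + (a * g x + b * H g x)" if "f \<in> E" "g \<in> E" for f g
    using fixed_operatorD(2)[OF H that] by eventually_elim (simp add: algebra_simps)
  show "AE x in M. a * (c * f x) + b * H (\<lambda>x. c * f x) x = c * (a * f x + b * H f x)" if "f \<in> E" for c f
    using fixed_operatorD(3)[OF H that, of c] by eventually_elim (simp add: algebra_simps)
qed (use assms in auto)

lemma local_operator_combination:
  assumes "local_operator H"
  shows "local_operator (\<lambda>f x. a * f x + b * H f x)"
  unfolding local_operator_def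
proof (intro ballI impI)
  fix f g assume "f \<in> E" "g \<in> E" and disj: "AE x in M. f x = 0 \<or> g x = 0"
  then have "AE x in M. H f x = 0 \<or> g x = 0"
    using assms by (simp add: local_operator_def)
  then show "AE x in M. a * f x + b * H f x = 0 \<or> g x = 0"
    using disj by eventually_elim auto
qed

text \<open>Contractivity on \<open>g - c * f\<close> holds pointwise outside one null set for all
  \<open>c\<close> of a countable dense set, hence by continuity for all \<open>c\<close>, and so
  for the value \<open>c = g x / f x\<close> that depends on the point.\<close>

lemma local_commute:
  assumes p: "p \<noteq> 2" and H: "fixed_operator 1 H" and loc: "local_operator H"
    and f: "f \<in> E" and g: "g \<in> E"
  shows "AE x in M. H f x * g x = f x * H g x"
proof -
  have bound: "AE x in M. cmod (H g x - c * H f x) \<le> cmod (g x - c * f x)" for c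
  proof -
    have cf: "(\<lambda>x. c * f x) \<in> E" by (rule fixed_scale[OF f])
    show ?thesis
      using local_bound[OF p H loc fixed_diff[OF g cf]] fixed_operator_diff[OF H g cf]
        fixed_operatorD(3)[OF H f, of c]
      by eventually_elim simp
  qed
  obtain S :: "complex set" where S: "countable S" "\<And>U. open U \<Longrightarrow> U \<noteq> {} \<Longrightarrow> \<exists>d\<in>S. d \<in> U"
    using countable_dense_setE by blast
  have "AE x in M. \<forall>c\<in>S. cmod (H g x - c * H f x) \<le> cmod (g x - c * f x)"
    using bound by (subst AE_ball_countable[OF S(1)]) simp
  moreover have "AE x in M. cmod (H f x) \<le> 1 * cmod (f x)"
    by (rule local_bound[OF p H loc f])
  ultimately show ?thesis
  proof eventually_elim
    case (elim x)
    have all: "cmod (H g x - c * H f x) \<le> cmod (g x - c * f x)" for c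
    proof (rule ccontr)
      assume "\<not> ?thesis"
      then have "c \<in> {c. cmod (g x - c * f x) < cmod (H g x - c * H f x)}" by simp
      moreover have "open {c. cmod (g x - c * f x) < cmod (H g x - c * H f x)}"
        by (intro open_Collect_less continuous_intros)
      ultimately show False using S(2) elim(1) by (metis (no_types, lifting) emptyE mem_Collect_eq not_le)
    qed
    show ?case
    proof (cases "f x = 0")
      case True
      then show ?thesis using elim(2) by simp
    next
      case False
      then have "H g x - g x / f x * H f x = 0"
        using all[of "g x / f x"] by simp
      then show ?thesis using False by (simp add: field_simps)
    qed
  qed
qed

text \<open>\<open>1 + \<i> r H\<close> increases norms only to second order in \<open>r\<close>,
  whereas the real part of its pairing with the dual of \<open>f\<close> changes to first order by
  the imaginary part in question.\<close>

lemma numerically_real: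
  assumes H: "fixed_operator 1 H" and f: "f \<in> E"
    and herm: "\<And>r. \<bar>r\<bar> \<le> 1 \<Longrightarrow>
      mass p M (\<lambda>x. 1 * f x + (\<i> * complex_of_real r) * H f x) \<le> (1 + r\<^sup>2) powr p * mass p M f"
  shows "Im (pairing M (H f) (dual f)) = 0"
proof -
  let ?J = "\<lambda>x. lp_dual p (f x)"
  note L = fixed_Lp[OF f] fixed_Lp[OF fixed_operatorD(1)[OF H f]] lp_dual_Lp_funs[OF fixed_Lp[OF f]]
  have "r * (- Im (pairing M (H f) ?J)) \<le> (2 powr (p - 1) * mass p M f) * r\<^sup>2" if r: "\<bar>r\<bar> \<le> 1" for r
  proof -
    have r2: "r\<^sup>2 \<le> 1" using r by (simp add: abs_square_le_1)
    have "pairing M (\<lambda>x. 1 * f x + (\<i> * complex_of_real r) * H f x) ?J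
        = complex_of_real (mass p M f) + \<i> * r * pairing M (H f) ?J"
      using L by (simp add: pairing_add_left pairing_scale_left Lp_funs_scale pairing_lp_dual)
    then have "mass p M f - r * Im (pairing M (H f) ?J)
        = Re (pairing M (\<lambda>x. 1 * f x + (\<i> * complex_of_real r) * H f x) ?J)"
      by simp
    also have "\<dots> \<le> cmod (pairing M (\<lambda>x. 1 * f x + (\<i> * complex_of_real r) * H f x) ?J)"
      by (rule complex_Re_le_cmod)
    also have "\<dots> \<le> mass p M (\<lambda>x. 1 * f x + (\<i> * complex_of_real r) * H f x) / p + mass q M ?J / q"
      using p_gt_1 L by (intro pairing_young Lp_funs_add Lp_funs_scale) auto
    also have "\<dots> \<le> (1 + r\<^sup>2) powr p * mass p M f / p + mass p M f / q"
      using herm[OF r] p_gt_1 by (simp add: mass_lp_dual divide_right_mono)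
    \<comment> \<open>The tangent inequality at \<open>1 + r^2\<close>, which is at most 2.\<close>
    also have "\<dots> \<le> (1 + p * 2 powr (p - 1) * r\<^sup>2) * mass p M f / p + mass p M f / q"
    proof -
      have "(1 + r\<^sup>2) powr p - 1 powr p \<le> p * (1 + r\<^sup>2) powr (p - 1) * (1 + r\<^sup>2 - 1)"
        using p_gt_1 by (intro powr_diff_le_real) auto
      also have "\<dots> \<le> p * 2 powr (p - 1) * (1 + r\<^sup>2 - 1)"
        using p_gt_1 r2 by (intro mult_right_mono mult_left_mono powr_mono2) auto
      finally have "(1 + r\<^sup>2) powr p \<le> 1 + p * 2 powr (p - 1) * r\<^sup>2" by simp
      then show ?thesis
        using p_gt_1 by (intro add_right_mono divide_right_mono mult_right_mono) auto
    qed
    also have "\<dots> = mass p M f * (1 / p + 1 / q) + 2 powr (p - 1) * r\<^sup>2 * mass p M f"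
      using p_gt_1 by (simp add: add_divide_distrib algebra_simps)
    finally show ?thesis by (simp add: conj_eq algebra_simps)
  qed
  from eq_0_if_quadratic_bound[OF this] show ?thesis by simp
qed

text \<open>Locality turns the norm bound on \<open>1 + \<i> r H\<close> into a pointwise one, and
  \<open>r\<close> of both signs tending to 0 leaves no room for an imaginary part. Countably many
  \<open>r\<close> are used, so that one null set suffices.\<close>

lemma real_multiplier_if_hermitian:
  assumes p: "p \<noteq> 2" and H: "fixed_operator 1 H"
    and herm: "\<And>r f. \<bar>r\<bar> \<le> 1 \<Longrightarrow> f \<in> E \<Longrightarrow>
      mass p M (\<lambda>x. 1 * f x + (\<i> * complex_of_real r) * H f x) \<le> (1 + r\<^sup>2) powr p * mass p M f"
  shows "real_multiplier H"
proof -
  have loc: "local_operator H"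
  proof (rule local_if_numerically_real[OF p H])
    fix f assume f: "f \<in> E"
    show "Im (pairing M (H f) (dual f)) = 0"
      by (rule numerically_real[OF H f herm[OF _ f]])
  qed
  have "AE x in M. Im (H f x * cnj (f x)) = 0" if f: "f \<in> E" for f
  proof -
    have V: "AE x in M. cmod (1 * f x + (\<i> * complex_of_real r) * H f x) \<le> (1 + r\<^sup>2) * cmod (f x)"
      if "\<bar>r\<bar> \<le> 1" for r
      using herm[OF that] f
      by (intro local_bound[OF p fixed_operator_combination[OF H] local_operator_combination[OF loc]]) auto
    have "\<bar>1 / real (Suc n)\<bar> \<le> 1" "\<bar>- 1 / real (Suc n)\<bar> \<le> 1" for n
      by (simp_all add: abs_divide)
    with V have "AE x in M. \<forall>n. cmod (1 * f x + (\<i> * complex_of_real (1 / real (Suc n))) * H f x)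
          \<le> (1 + (1 / real (Suc n))\<^sup>2) * cmod (f x) \<and>
        cmod (1 * f x + (\<i> * complex_of_real (- 1 / real (Suc n))) * H f x)
          \<le> (1 + (- 1 / real (Suc n))\<^sup>2) * cmod (f x)"
      unfolding AE_all_countable AE_conj_iff by blast
    then show ?thesis
    proof eventually_elim
      case (elim x)
      define y where "y = Im (H f x * cnj (f x))"
      \<comment> \<open>Both sides are squared; the 3 comes from
        \<open>(1 + r^2)^2 \<le> 1 + 3 * r^2\<close> for \<open>r^2 \<le> 1\<close>.\<close>
      have est: "- 2 * r * y \<le> 3 * r\<^sup>2 * (cmod (f x))\<^sup>2"
        if "\<bar>r\<bar> \<le> 1" "cmod (1 * f x + (\<i> * complex_of_real r) * H f x) \<le> (1 + r\<^sup>2) * cmod (f x)" for r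
      proof -
        have r2: "r\<^sup>2 \<le> 1" using that by (simp add: abs_square_le_1)
        have "(cmod (1 * f x + (\<i> * complex_of_real r) * H f x))\<^sup>2
            = (cmod (f x))\<^sup>2 - 2 * r * y + r\<^sup>2 * (cmod (H f x))\<^sup>2"
          unfolding cmod_power2 y_def by (simp add: power2_eq_square algebra_simps)
        moreover have "(cmod (1 * f x + (\<i> * complex_of_real r) * H f x))\<^sup>2 \<le> ((1 + r\<^sup>2) * cmod (f x))\<^sup>2"
          using that by (intro power_mono) auto
        moreover have "((1 + r\<^sup>2) * cmod (f x))\<^sup>2 = (1 + 2 * r\<^sup>2 + r\<^sup>2 * r\<^sup>2) * (cmod (f x))\<^sup>2"
          by (simp add: power2_eq_square algebra_simps)
        moreover have "\<dots> \<le> (1 + 2 * r\<^sup>2 + 1 * r\<^sup>2) * (cmod (f x))\<^sup>2"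
          using r2 by (intro mult_right_mono add_left_mono) auto
        moreover have "(1 + 2 * r\<^sup>2 + 1 * r\<^sup>2) * (cmod (f x))\<^sup>2 = (cmod (f x))\<^sup>2 + 3 * r\<^sup>2 * (cmod (f x))\<^sup>2"
          by (simp add: algebra_simps)
        moreover have "0 \<le> r\<^sup>2 * (cmod (H f x))\<^sup>2" by simp
        ultimately show ?thesis by linarith
      qed
      have "2 * \<bar>y\<bar> \<le> 3 * (cmod (f x))\<^sup>2 * inverse (real (Suc n))" for n
      proof -
        define s where "s = 1 / real (Suc n)"
        have s: "0 < s" "s \<le> 1" by (simp_all add: s_def)
        have "cmod (1 * f x + (\<i> * complex_of_real s) * H f x) \<le> (1 + s\<^sup>2) * cmod (f x)"
          "cmod (1 * f x + (\<i> * complex_of_real (- s)) * H f x) \<le> (1 + (- s)\<^sup>2) * cmod (f x)"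
          using elim[rule_format, of n] unfolding s_def minus_divide_left by blast+
        from est[OF _ this(1)] est[OF _ this(2)] s
        have "s * (- (2 * y)) \<le> s * (3 * (cmod (f x))\<^sup>2 * s)" "s * (2 * y) \<le> s * (3 * (cmod (f x))\<^sup>2 * s)"
          by (simp_all add: power2_eq_square algebra_simps)
        then have "- (2 * y) \<le> 3 * (cmod (f x))\<^sup>2 * s" "2 * y \<le> 3 * (cmod (f x))\<^sup>2 * s"
          using s by (simp_all only: mult_le_cancel_left_pos)
        then have "2 * \<bar>y\<bar> \<le> 3 * (cmod (f x))\<^sup>2 * s" by linarith
        then show ?thesis by (simp add: s_def inverse_eq_divide)
      qed
      moreover have "(\<lambda>n. 3 * (cmod (f x))\<^sup>2 * inverse (real (Suc n))) \<longlonglongrightarrow> 3 * (cmod (f x))\<^sup>2 * 0"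
        by (intro tendsto_intros LIMSEQ_inverse_real_of_nat)
      ultimately have "2 * \<bar>y\<bar> \<le> 3 * (cmod (f x))\<^sup>2 * 0"
        by (intro LIMSEQ_le_const) auto
      then show ?case by (simp add: y_def)
    qed
  qed
  then show ?thesis
    unfolding real_multiplier_def
    using local_commute[OF p H loc] local_bound[OF p H loc] by (auto simp: AE_conj_iff)
qed

text \<open>Both classes of operators needed below (multiplication by a real function if \<open>p \<noteq> 2\<close>,
  selfadjoint operators if \<open>p = 2\<close>) have this property. For multiplication by \<open>m\<close>, take
  \<open>\<alpha> = \<integral> m\<^sup>2 \<bar>u\<bar>\<^sup>p\<close> and \<open>\<beta> = \<integral> m\<^sup>2 \<bar>g\<bar>\<^sup>p\<close>.\<close>

definition splitting_operator :: "(('x \<Rightarrow> complex) \<Rightarrow> 'x \<Rightarrow> complex) \<Rightarrow> bool"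
  where "splitting_operator H \<longleftrightarrow> (\<forall>u\<in>E. \<forall>g\<in>E. \<exists>\<alpha> \<beta>. mass p M (H (H u)) \<le> \<alpha> \<and>
    (\<forall>k\<in>E. cmod (pairing M (H (H k)) (dual g)) \<le> mass p M k / p + \<beta> / q) \<and>
    cmod (pairing M (\<lambda>x. u x - H (H u) x) (dual g))
      \<le> (mass p M u - \<alpha>) / p + (mass p M g - \<beta>) / q)"

lemma real_multiplier_splitting:
  assumes H: "fixed_operator 1 H" and mult: "real_multiplier H"
  shows "splitting_operator H"
  unfolding splitting_operator_def
proof (intro ballI)
  \<comment> \<open>The multiplier read off from \<open>u\<close>. It is 0 where \<open>u\<close>
    vanishes, by division by zero; multipliers read off from two functions agree almost everywhere
    where both are nonzero.\<close>
  define m where "m u x = Re (H u x / u x)" for u x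
  have HE: "H f \<in> E" if "f \<in> E" for f by (rule fixed_operatorD(1)[OF H that])
  have m: "AE x in M. H u x = complex_of_real (m u x) * u x \<and>
      H (H u) x = complex_of_real ((m u x)\<^sup>2) * u x \<and> (m u x)\<^sup>2 \<le> 1" if u: "u \<in> E" for u
  proof -
    have "AE x in M. cmod (H u x) \<le> cmod (u x) \<and> Im (H u x * cnj (u x)) = 0"
      "AE x in M. cmod (H (H u) x) \<le> cmod (H u x)"
      "AE x in M. H (H u) x * u x = H u x * H u x"
      using mult u HE[OF u] unfolding real_multiplier_def by (auto simp: AE_conj_iff)
    then show ?thesis
    proof eventually_elim
      case (elim x)
      show ?case
      proof (cases "u x = 0")
        case True
        then show ?thesis using elim by (simp add: m_def)
      next
        case False
        have "Im (H u x / u x) = 0"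
          using elim(1) by (simp add: complex_div_cnj[of "H u x"])
        then have 1: "H u x = complex_of_real (m u x) * u x"
          using False by (simp add: m_def complex_is_Real_iff[symmetric] nonzero_eq_divide_eq[symmetric]
              complex_eq_iff[of "H u x / u x"])
        have "\<bar>m u x\<bar> * cmod (u x) \<le> 1 * cmod (u x)"
          using elim(1) unfolding 1 by (simp add: norm_mult)
        then have "\<bar>m u x\<bar> \<le> 1" using False by simp
        then show ?thesis
          using 1 elim(3) False by (simp add: power2_eq_square abs_square_le_1[unfolded power2_eq_square])
      qed
    qed
  qed
  have m_meas [measurable]: "m u \<in> borel_measurable M" if "u \<in> E" for u
    unfolding m_def using that HE[OF that] by measurable
  fix u g assume u: "u \<in> E" and g: "g \<in> E"
  define \<alpha> where "\<alpha> u = (\<integral>x. (m u x)\<^sup>2 * cmod (u x) powr p \<partial>M)" for u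
  have int\<alpha>: "integrable M (\<lambda>x. (m u x)\<^sup>2 * cmod (u x) powr p)" if u: "u \<in> E" for u
  proof (rule Bochner_Integration.integrable_bound[OF Lp_funsD(2)[OF fixed_Lp[OF u]]])
    show "AE x in M. norm ((m u x)\<^sup>2 * cmod (u x) powr p) \<le> norm (cmod (u x) powr p)"
      using m[OF u] by eventually_elim (simp add: mult_left_le_one_le)
  qed (use u in measurable)
  have diff\<alpha>: "(\<integral>x. (1 - (m u x)\<^sup>2) * cmod (u x) powr p \<partial>M) = mass p M u - \<alpha> u"
    "integrable M (\<lambda>x. (1 - (m u x)\<^sup>2) * cmod (u x) powr p)" if u: "u \<in> E" for u
    unfolding left_diff_distrib mult_1 \<alpha>_def mass_def
    using int\<alpha>[OF u] Lp_funsD(2)[OF fixed_Lp[OF u]] by auto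
  \<comment> \<open>Lets \<open>(m^2) powr p\<close> and \<open>(m^2) powr q\<close> be replaced by
    \<open>m^2\<close>, so that the same weights serve all three estimates.\<close>
  have sq_powr: "(t\<^sup>2) powr r \<le> t\<^sup>2" if "t\<^sup>2 \<le> 1" "1 \<le> r" for t r :: real
    using powr_mono'[of 1 r "t\<^sup>2"] that by (cases "t = 0") auto
  have "mass p M (H (H u)) \<le> \<alpha> u"
    unfolding mass_def \<alpha>_def
  proof (rule integral_mono_AE[OF Lp_funsD(2)[OF fixed_Lp[OF HE[OF HE[OF u]]]] int\<alpha>[OF u]])
    show "AE x in M. cmod (H (H u) x) powr p \<le> (m u x)\<^sup>2 * cmod (u x) powr p"
      using m[OF u]
      by eventually_elim
        (use p_gt_1 in \<open>simp add: norm_mult norm_power powr_mult mult_right_mono sq_powr\<close>)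
  qed
  moreover have "cmod (pairing M (H (H k)) (dual g)) \<le> mass p M k / p + \<alpha> g / q"
    if k: "k \<in> E" for k
  proof -
    \<comment> \<open>The multiplier of \<open>H (H k)\<close> is moved to \<open>g\<close>, where
      \<beta> is measured; at zeros of \<open>g\<close> the dual vanishes as well.\<close>
    let ?G = "\<lambda>x. complex_of_real ((m g x)\<^sup>2) * lp_dual p (g x)"
    have G: "?G \<in> Lp_funs q M"
    proof (rule Lp_funs_bound_fun[OF _ lp_dual_Lp_funs[OF fixed_Lp[OF g]]])
      show "AE x in M. cmod (?G x) \<le> cmod (lp_dual p (g x))"
        using m[OF g] by eventually_elim (simp add: norm_mult norm_power mult_left_le_one_le)
      show "?G \<in> borel_measurable M"
        using g lp_dual_Lp_funs[OF fixed_Lp[OF g]] by measurable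
    qed (use q_gt_1 in simp)
    have "AE x in M. H (H k) x * lp_dual p (g x) = k x * ?G x"
    proof -
      have "AE x in M. H (H k) x * g x = H k x * H g x" "AE x in M. H k x * g x = k x * H g x"
        using mult k g HE[OF k] unfolding real_multiplier_def by blast+
      then show ?thesis
        using m[OF g]
      proof eventually_elim
        case (elim x)
        show ?case
        proof (cases "g x = 0")
          case False
          have "H k x = m g x * k x" using elim False by simp
          moreover have "H (H k) x = m g x * H k x" using elim False by simp
          ultimately show ?thesis by (simp add: power2_eq_square)
        qed simp
      qed
    qed
    then have "pairing M (H (H k)) (dual g) = pairing M k ?G"
      unfolding pairing_def
      using pairing_integrable[OF fixed_Lp[OF k] G]
        pairing_integrable[OF fixed_Lp[OF HE[OF HE[OF k]]] lp_dual_Lp_funs[OF fixed_Lp[OF g]]]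
      by (intro integral_cong_AE) auto
    also have "cmod \<dots> \<le> mass p M k / p + mass q M ?G / q"
      by (rule pairing_young[OF fixed_Lp[OF k] G])
    also have "mass q M ?G \<le> \<alpha> g"
      unfolding mass_def \<alpha>_def
    proof (rule integral_mono_AE[OF Lp_funsD(2)[OF G] int\<alpha>[OF g]])
      show "AE x in M. cmod (?G x) powr q \<le> (m g x)\<^sup>2 * cmod (g x) powr p"
        using m[OF g]
        by eventually_elim
          (use q_gt_1 in \<open>simp add: norm_mult norm_power powr_mult norm_lp_dual_powr mult_right_mono sq_powr\<close>)
    qed
    finally show ?thesis using q_gt_1 by (simp add: divide_right_mono)
  qed
  moreover have "cmod (pairing M (\<lambda>x. u x - H (H u) x) (dual g))
      \<le> (mass p M u - \<alpha> u) / p + (mass p M g - \<alpha> g) / q"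
  proof -
    have D: "(\<lambda>x. u x - H (H u) x) \<in> E" by (intro fixed_diff HE u)
    have "cmod (pairing M (\<lambda>x. u x - H (H u) x) (dual g))
        \<le> (\<integral>x. cmod ((u x - H (H u) x) * lp_dual p (g x)) \<partial>M)"
      unfolding pairing_def by (rule integral_norm_bound)
    also have "\<dots> \<le> (\<integral>x. (1 - (m u x)\<^sup>2) * cmod (u x) powr p / p
        + (1 - (m g x)\<^sup>2) * cmod (g x) powr p / q \<partial>M)"
    proof (rule integral_mono_AE)
      show "integrable M (\<lambda>x. cmod ((u x - H (H u) x) * lp_dual p (g x)))"
        by (intro integrable_norm pairing_integrable fixed_Lp D lp_dual_Lp_funs g)
      show "integrable M (\<lambda>x. (1 - (m u x)\<^sup>2) * cmod (u x) powr p / p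
          + (1 - (m g x)\<^sup>2) * cmod (g x) powr p / q)"
        using diff\<alpha>(2)[OF u] diff\<alpha>(2)[OF g] by auto
      have "AE x in M. H u x * g x = u x * H g x"
        using mult u g unfolding real_multiplier_def by blast
      then show "AE x in M. cmod ((u x - H (H u) x) * lp_dual p (g x))
          \<le> (1 - (m u x)\<^sup>2) * cmod (u x) powr p / p + (1 - (m g x)\<^sup>2) * cmod (g x) powr p / q"
        using m[OF u] m[OF g]
      proof eventually_elim
        case (elim x)
        show ?case
        proof (cases "u x = 0 \<or> g x = 0")
          case True
          then show ?thesis using elim p_gt_1 q_gt_1 by auto
        next
          case False
          then have mm: "m g x = m u x" using elim by simp
          have "(u x - H (H u) x) * lp_dual p (g x) = complex_of_real (1 - (m u x)\<^sup>2) * (u x * lp_dual p (g x))"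
            using elim(2) by (simp add: algebra_simps)
          then have "cmod ((u x - H (H u) x) * lp_dual p (g x)) = (1 - (m u x)\<^sup>2) * cmod (u x * lp_dual p (g x))"
            using elim(2) by (simp only: norm_mult[of "complex_of_real _"] norm_of_real) simp
          also have "\<dots> \<le> (1 - (m u x)\<^sup>2) * (cmod (u x) powr p / p + cmod (g x) powr p / q)"
            using elim(2) young[of "u x" "lp_dual p (g x)"]
            by (intro mult_left_mono) (auto simp: norm_lp_dual_powr)
          finally show ?thesis by (simp add: mm distrib_left)
        qed
      qed
    qed
    also have "\<dots> = (mass p M u - \<alpha> u) / p + (mass p M g - \<alpha> g) / q"
      using diff\<alpha>[OF u] diff\<alpha>[OF g] by simp
    finally show ?thesis .
  qed
  ultimately show "\<exists>\<alpha> \<beta>. mass p M (H (H u)) \<le> \<alpha> \<and>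
      (\<forall>k\<in>E. cmod (pairing M (H (H k)) (dual g)) \<le> mass p M k / p + \<beta> / q) \<and>
      cmod (pairing M (\<lambda>x. u x - H (H u) x) (dual g))
        \<le> (mass p M u - \<alpha>) / p + (mass p M g - \<beta>) / q"
    by blast
qed

lemma real_multiplier_compose:
  assumes H: "fixed_operator 1 H" and mult: "real_multiplier H"
  shows "real_multiplier (\<lambda>f. H (H f))"
  unfolding real_multiplier_def
proof (intro conjI ballI)
  have HE: "H f \<in> E" if "f \<in> E" for f by (rule fixed_operatorD(1)[OF H that])
  show "AE x in M. H (H f) x * g x = f x * H (H g) x" if f: "f \<in> E" and g: "g \<in> E" for f g
  proof -
    have "AE x in M. H (H f) x * g x = H f x * H g x" "AE x in M. H f x * H g x = f x * H (H g) x"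
      using mult f g HE unfolding real_multiplier_def by blast+
    then show ?thesis by eventually_elim simp
  qed
  show "AE x in M. cmod (H (H f) x) \<le> cmod (f x) \<and> Im (H (H f) x * cnj (f x)) = 0" if f: "f \<in> E" for f
  proof -
    have "AE x in M. cmod (H f x) \<le> cmod (f x) \<and> Im (H f x * cnj (f x)) = 0"
      "AE x in M. cmod (H (H f) x) \<le> cmod (H f x) \<and> Im (H (H f) x * cnj (H f x)) = 0"
      "AE x in M. H (H f) x * f x = H f x * H f x"
      using mult f HE[OF f] unfolding real_multiplier_def by blast+
    then show ?thesis
    proof eventually_elim
      case (elim x)
      have "Im (H (H f) x * cnj (f x)) = 0"
      proof (cases "f x = 0")
        case False
        \<comment> \<open>The multiplier of the composition is the square of a real one; multiplying
          through by \<open>(cmod (f x))^2\<close> avoids the division.\<close>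
        let ?s = "H f x * cnj (f x)"
        have "(H (H f) x * f x) * (cnj (f x) * cnj (f x)) = ?s * ?s"
          unfolding elim(3) by simp
        moreover have "f x * cnj (f x) = complex_of_real ((cmod (f x))\<^sup>2)"
          using complex_norm_square[of "f x"] by simp
        ultimately have "complex_of_real ((cmod (f x))\<^sup>2) * (H (H f) x * cnj (f x)) = ?s * ?s"
          by (metis (no_types, opaque_lifting) mult.assoc mult.commute)
        then have "(cmod (f x))\<^sup>2 * Im (H (H f) x * cnj (f x)) = Im (?s * ?s)"
          by (metis Im_complex_of_real Re_complex_of_real add.right_neutral mult_zero_left times_complex.sel(2))
        also have "\<dots> = 0"
          using elim(1) by (simp only: times_complex.sel(2))
        finally show ?thesis using False by simp
      qed simp
      then show ?case using elim by auto
    qed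
  qed
qed

section \<open>The Hilbert space case\<close>

lemma symmetric_if_numerically_real:
  assumes p: "p = 2" and H: "fixed_operator C H"
    and real: "\<And>f. f \<in> E \<Longrightarrow> Im (pairing M (H f) (dual f)) = 0"
  shows "symmetric_operator H"
  unfolding symmetric_operator_def
proof (intro ballI)
  fix f g assume f: "f \<in> E" and g: "g \<in> E"
  define a where "a = pairing M (H f) (\<lambda>x. cnj (g x))"
  define b where "b = pairing M (H g) (\<lambda>x. cnj (f x))"
  have dual_cnj: "lp_dual p = cnj" using p lp_dual_2 by auto
  have cnjL: "(\<lambda>x. cnj (u x)) \<in> Lp_funs q M" if "u \<in> E" for u
    using lp_dual_Lp_funs[OF fixed_Lp[OF that]] dual_cnj by simp
  have HL: "H u \<in> Lp_funs p M" if "u \<in> E" for u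
    by (rule fixed_Lp[OF fixed_operatorD(1)[OF H that]])
  \<comment> \<open>Polarization: the values at \<open>z = 1\<close> and \<open>z = \<i>\<close>
    will show that \<open>a\<close> and \<open>b\<close> are conjugate.\<close>
  have key: "Im (cnj z * a + z * b) = 0" for z
  proof -
    have zg: "(\<lambda>x. z * g x) \<in> E" using g by (rule fixed_scale)
    have fzg: "(\<lambda>x. f x + z * g x) \<in> E" using f zg by (rule fixed_add)
    have 1: "AE x in M. H (\<lambda>x. f x + z * g x) x = H f x + z * H g x"
      using fixed_operatorD(2)[OF H f zg] fixed_operatorD(3)[OF H g, of z]
      by eventually_elim simp
    have S: "(\<lambda>x. H f x + z * H g x) \<in> Lp_funs p M"
      using p_gt_1 HL f g by (intro Lp_funs_add Lp_funs_scale) auto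
    have T: "(\<lambda>x. cnj (f x) + cnj z * cnj (g x)) \<in> Lp_funs q M"
      using q_gt_1 cnjL f g by (intro Lp_funs_add Lp_funs_scale) auto
    have "pairing M (H (\<lambda>x. f x + z * g x)) (\<lambda>x. cnj (f x + z * g x))
        = pairing M (\<lambda>x. H f x + z * H g x) (\<lambda>x. cnj (f x) + cnj z * cnj (g x))"
      by (rule pairing_cong[OF 1])
        (use S T HL[OF fzg] cnjL[OF fzg] in \<open>auto intro: Lp_funs_measurable\<close>)
    also have "\<dots> = pairing M (H f) (\<lambda>x. cnj (f x)) + cnj z * a
        + z * b + z * cnj z * pairing M (H g) (\<lambda>x. cnj (g x))"
      using HL[OF f] HL[OF g] cnjL[OF f] cnjL[OF g] T
      by (simp add: pairing_add_left pairing_add_right pairing_scale_left pairing_scale_right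
          Lp_funs_scale a_def b_def algebra_simps)
    finally have "0 = Im (pairing M (H f) (\<lambda>x. cnj (f x)) + (cnj z * a
        + z * b) + z * cnj z * pairing M (H g) (\<lambda>x. cnj (g x)))"
      using real[OF fzg] unfolding dual_cnj by (simp only: add.assoc)
    then show ?thesis
      using real[OF f] real[OF g] unfolding dual_cnj complex_norm_square[symmetric] by simp
  qed
  have "a = cnj b"
    using key[of 1] key[of \<i>] by (simp add: complex_eq_iff)
  then show "pairing M (H f) (\<lambda>x. cnj (g x)) = cnj (pairing M (H g) (\<lambda>x. cnj (f x)))"
    by (simp add: a_def b_def)
qed

lemma pairing_cnj_flip: "pairing M f (\<lambda>x. cnj (g x)) = cnj (pairing M g (\<lambda>x. cnj (f x)))"
proof -
  have "cnj (pairing M g (\<lambda>x. cnj (f x))) = (\<integral>x. cnj (g x * cnj (f x)) \<partial>M)"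
    unfolding pairing_def by (rule Bochner_Integration.integral_cnj[symmetric])
  then show ?thesis by (simp add: pairing_def mult.commute)
qed

lemma symmetric_compose:
  assumes H: "fixed_operator 1 H" and sym: "symmetric_operator H"
  shows "symmetric_operator (\<lambda>f. H (H f))"
  unfolding symmetric_operator_def
proof (intro ballI)
  fix f g assume f: "f \<in> E" and g: "g \<in> E"
  have HE: "H f \<in> E" if "f \<in> E" for f by (rule fixed_operatorD(1)[OF H that])
  have "pairing M (H (H f)) (\<lambda>x. cnj (g x)) = cnj (pairing M (H g) (\<lambda>x. cnj (H f x)))"
    using sym f g HE unfolding symmetric_operator_def by blast
  also have "pairing M (H g) (\<lambda>x. cnj (H f x)) = cnj (pairing M (H f) (\<lambda>x. cnj (H g x)))"
    by (rule pairing_cnj_flip)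
  also have "pairing M (H f) (\<lambda>x. cnj (H g x)) = cnj (pairing M (H (H g)) (\<lambda>x. cnj (f x)))"
    using sym f g HE unfolding symmetric_operator_def by blast
  finally show "pairing M (H (H f)) (\<lambda>x. cnj (g x)) = cnj (pairing M (H (H g)) (\<lambda>x. cnj (f x)))"
    by simp
qed

text \<open>By symmetry the pairing of \<open>u - H (H u)\<close> with \<open>g\<close> is
  \<open>ip u g - ip (H u) (H g)\<close>. This form is positive semidefinite because
  \<open>H\<close> is a contraction, so twice its modulus is at most the sum of its values at
  \<open>(u, u)\<close> and \<open>(g, g)\<close>. The weights are \<alpha> =
  \<open>mass p M (H u)\<close> and \<beta> = \<open>mass p M (H g)\<close>.\<close>

lemma symmetric_splitting:
  assumes p: "p = 2" and H: "fixed_operator 1 H" and sym: "symmetric_operator H"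
  shows "splitting_operator H"
  unfolding splitting_operator_def
proof (intro ballI)
  fix u g assume u: "u \<in> E" and g: "g \<in> E"
  have HE: "H f \<in> E" if "f \<in> E" for f by (rule fixed_operatorD(1)[OF H that])
  have contr: "mass p M (H f) \<le> mass p M f" if "f \<in> E" for f
    using fixed_operatorD(4)[OF H that] by simp
  have q: "q = 2" using conj_sum p by simp
  have dual_cnj: "lp_dual p = cnj" using p lp_dual_2 by auto
  have L: "f \<in> Lp_funs 2 M" "(\<lambda>x. cnj (f x)) \<in> Lp_funs 2 M" if "f \<in> E" for f
    using fixed_Lp[OF that] lp_dual_Lp_funs[OF fixed_Lp[OF that]] p q dual_cnj by simp_all
  define ip where "ip f g = pairing M f (\<lambda>x. cnj (g x))" for f g
  have ip_young: "cmod (ip f g) \<le> mass 2 M f / 2 + mass 2 M g / 2" if "f \<in> E" "g \<in> E" for f g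
    using pairing_young[of f M "\<lambda>x. cnj (g x)"] L that
    by (simp add: ip_def p q mass_def)
  have HH: "ip (H (H f)) g = ip (H f) (H g)" if "f \<in> E" "g \<in> E" for f g
    using sym HE that pairing_cnj_flip[of "H f" "H g"]
    unfolding ip_def symmetric_operator_def by metis
  have ip_diff: "ip (\<lambda>x. f x - z * h x) (\<lambda>x. f x - z * h x)
      = mass 2 M f + mass 2 M h * (cmod z)\<^sup>2 - 2 * Re (cnj z * ip f h)"
    if f: "f \<in> E" and h: "h \<in> E" for f h z
  proof -
    note Lf = L[OF f] and Lh = L[OF h]
    interpret two: conjugate_exponents 2 2 by unfold_locales auto
    have self: "ip w w = mass 2 M w" if "w \<in> E" for w
      using two.pairing_lp_dual[OF L(1)[OF that]] by (simp add: ip_def lp_dual_2)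
    have "ip (\<lambda>x. f x + w * h x) (\<lambda>x. f x + w * h x)
        = ip f f + cnj w * ip f h + w * ip h f + w * cnj w * ip h h" for w
      unfolding ip_def complex_cnj_add complex_cnj_mult
      using Lf Lh
      by (simp add: two.pairing_add_left two.pairing_add_right pairing_scale_left pairing_scale_right
          Lp_funs_scale Lp_funs_add algebra_simps)
    from this[of "- z"] have "ip (\<lambda>x. f x - z * h x) (\<lambda>x. f x - z * h x)
        = ip f f - cnj z * ip f h - z * ip h f + z * cnj z * ip h h"
      by simp
    moreover have "z * ip h f = cnj (cnj z * ip f h)"
      unfolding ip_def by (subst pairing_cnj_flip) simp
    ultimately have "ip (\<lambda>x. f x - z * h x) (\<lambda>x. f x - z * h x)
        = ip f f - (cnj z * ip f h + cnj (cnj z * ip f h)) + z * cnj z * ip h h"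
      by (simp only: diff_diff_eq)
    also have "cnj z * ip f h + cnj (cnj z * ip f h) = complex_of_real (2 * Re (cnj z * ip f h))"
      by (rule complex_add_cnj)
    also have "z * cnj z = complex_of_real ((cmod z)\<^sup>2)"
      using complex_norm_square[of z] by simp
    finally show ?thesis
      unfolding self[OF f] self[OF h] by (simp only: of_real_diff of_real_add of_real_mult) simp
  qed
  have third: "cmod (ip u g - ip (H u) (H g))
      \<le> (mass 2 M u - mass 2 M (H u)) / 2 + (mass 2 M g - mass 2 M (H g)) / 2"
  proof -
    define d where "d = ip u g - ip (H u) (H g)"
    obtain w where w: "cmod w = 1" "w * d = complex_of_real (cmod d)"
      by (rule unimodular_rotation)
    \<comment> \<open>In the expansion of \<open>u - z * g\<close> the cross term carries
      \<open>cnj z\<close>, which has to rotate \<open>d\<close> to its absolute value.\<close>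
    define z where "z = cnj w"
    have z: "cmod z = 1" "cnj z * d = complex_of_real (cmod d)" using w by (simp_all add: z_def)
    have zg: "(\<lambda>x. z * g x) \<in> E" by (rule fixed_scale[OF g])
    have v: "(\<lambda>x. u x - z * g x) \<in> E" by (rule fixed_diff[OF u zg])
    have v': "(\<lambda>x. H u x - z * H g x) \<in> E" by (intro fixed_diff fixed_scale HE u g)
    have eq: "AE x in M. H (\<lambda>x. u x - z * g x) x = H u x - z * H g x"
      using fixed_operator_diff[OF H u zg] fixed_operatorD(3)[OF H g, of z]
      by eventually_elim simp
    have self: "complex_of_real (mass 2 M w) = ip w w" if "w \<in> E" for w
      using pairing_lp_dual[OF fixed_Lp[OF that]] by (simp add: ip_def lp_dual_2 p)
    have "mass 2 M (\<lambda>x. H u x - z * H g x) = mass 2 M (H (\<lambda>x. u x - z * g x))"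
      using L(1)[OF v'] L(1)[OF HE[OF v]] eq by (intro mass_cong) auto
    also have "\<dots> \<le> mass 2 M (\<lambda>x. u x - z * g x)"
      using contr[OF v] p by simp
    finally have "mass 2 M (\<lambda>x. H u x - z * H g x) \<le> mass 2 M (\<lambda>x. u x - z * g x)" .
    moreover have "complex_of_real (mass 2 M (\<lambda>x. H u x - z * H g x))
        = complex_of_real (mass 2 M (H u) + mass 2 M (H g) - 2 * Re (cnj z * ip (H u) (H g)))"
      using self[OF v'] ip_diff[OF HE[OF u] HE[OF g], of z] z by simp
    moreover have "complex_of_real (mass 2 M (\<lambda>x. u x - z * g x))
        = complex_of_real (mass 2 M u + mass 2 M g - 2 * Re (cnj z * ip u g))"
      using self[OF v] ip_diff[OF u g, of z] z by simp
    ultimately have "2 * (Re (cnj z * ip u g) - Re (cnj z * ip (H u) (H g)))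
        \<le> (mass 2 M u - mass 2 M (H u)) + (mass 2 M g - mass 2 M (H g))"
      unfolding of_real_eq_iff
      by (smt (verit, ccfv_threshold))
    moreover have "Re (cnj z * ip u g) - Re (cnj z * ip (H u) (H g)) = cmod d"
      using arg_cong[OF z(2), of Re] by (simp add: d_def algebra_simps)
    ultimately have "2 * cmod d \<le> (mass 2 M u - mass 2 M (H u)) + (mass 2 M g - mass 2 M (H g))"
      by (simp only:)
    then show ?thesis unfolding d_def[symmetric] by (simp add: field_simps)
  qed
  have "mass p M (H (H u)) \<le> mass p M (H u)" by (rule contr[OF HE[OF u]])
  moreover have "cmod (pairing M (H (H k)) (dual g)) \<le> mass p M k / p + mass p M (H g) / q"
    if k: "k \<in> E" for k
    using ip_young[OF HE[OF k] HE[OF g]] HH[OF k g] contr[OF k] by (simp add: ip_def lp_dual_2 p q)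
  moreover have "cmod (pairing M (\<lambda>x. u x - H (H u) x) (dual g))
        \<le> (mass p M u - mass p M (H u)) / p + (mass p M g - mass p M (H g)) / q"
  proof -
    have "pairing M (\<lambda>x. u x + (-1) * H (H u) x) (\<lambda>x. cnj (g x)) = ip u g - ip (H (H u)) g"
      using pairing_add_left[OF fixed_Lp[OF u] Lp_funs_scale[OF fixed_Lp[OF HE[OF HE[OF u]]]], of "\<lambda>x. cnj (g x)" "-1"]
        L(2)[OF g] q pairing_scale_left[of M "-1" "H (H u)"]
      by (simp add: ip_def)
    then show ?thesis
      using third HH[OF u g] by (simp add: lp_dual_2 p q)
  qed
  ultimately show "\<exists>\<alpha> \<beta>. mass p M (H (H u)) \<le> \<alpha> \<and>
      (\<forall>k\<in>E. cmod (pairing M (H (H k)) (dual g)) \<le> mass p M k / p + \<beta> / q) \<and>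
      cmod (pairing M (\<lambda>x. u x - H (H u) x) (dual g))
        \<le> (mass p M u - \<alpha>) / p + (mass p M g - \<beta>) / q"
    by blast
qed

lemma fixed_operator_compose:
  assumes H: "fixed_operator 1 H"
  shows "fixed_operator 1 (\<lambda>f. H (H f))"
  unfolding fixed_operator_def
proof (intro conjI ballI allI)
  have HE: "H f \<in> E" if "f \<in> E" for f by (rule fixed_operatorD(1)[OF H that])
  show "H (H f) \<in> E" if "f \<in> E" for f by (intro HE that)
  show "AE x in M. H (H (\<lambda>x. f x + g x)) x = H (H f) x + H (H g) x" if f: "f \<in> E" and g: "g \<in> E" for f g
    using fixed_operator_cong[OF H HE[OF fixed_add[OF f g]] fixed_add[OF HE[OF f] HE[OF g]]
        fixed_operatorD(2)[OF H f g]] fixed_operatorD(2)[OF H HE[OF f] HE[OF g]]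
    by eventually_elim simp
  show "AE x in M. H (H (\<lambda>x. c * f x)) x = c * H (H f) x" if f: "f \<in> E" for c f
    using fixed_operator_cong[OF H HE[OF fixed_scale[OF f]] fixed_scale[OF HE[OF f]]
        fixed_operatorD(3)[OF H f, of c]] fixed_operatorD(3)[OF H HE[OF f], of c]
    by eventually_elim simp
  show "mass p M (H (H f)) \<le> 1 powr p * mass p M f" if f: "f \<in> E" for f
    using fixed_operatorD(4)[OF H f] fixed_operatorD(4)[OF H HE[OF f]] by simp
qed simp

text \<open>Splitting for \<open>H\<close> serves \<open>s = h * h\<close>; splitting for its square
  serves \<open>s = (h * h) * (h * h)\<close>.\<close>

theorem hermitian_splitting:
  assumes H: "fixed_operator 1 H"
    and herm: "\<And>r f. \<bar>r\<bar> \<le> 1 \<Longrightarrow> f \<in> E \<Longrightarrow>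
      mass p M (\<lambda>x. 1 * f x + (\<i> * complex_of_real r) * H f x) \<le> (1 + r\<^sup>2) powr p * mass p M f"
  shows "splitting_operator H" "splitting_operator (\<lambda>f. H (H f))"
proof -
  have "splitting_operator H \<and> splitting_operator (\<lambda>f. H (H f))"
  proof (cases "p = 2")
    case True
    have "symmetric_operator H"
    proof (rule symmetric_if_numerically_real[OF True H])
      fix f assume f: "f \<in> E"
      show "Im (pairing M (H f) (dual f)) = 0"
        by (rule numerically_real[OF H f herm[OF _ f]])
    qed
    then show ?thesis
      using symmetric_splitting[OF True] symmetric_compose[OF H] fixed_operator_compose[OF H] H by blast
  next
    case False
    have "real_multiplier H" by (rule real_multiplier_if_hermitian[OF False H herm])
    then show ?thesis
      using real_multiplier_splitting real_multiplier_compose[OF H] fixed_operator_compose[OF H] H by blast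
  qed
  then show "splitting_operator H" "splitting_operator (\<lambda>f. H (H f))" by blast+
qed

end

section \<open>Representations on \<open>L\<^sup>p\<close>\<close>

text \<open>The isometric embedding, restated for functions instead of classes, with identities
  almost everywhere. \<open>rep_bound\<close> and \<open>norm_le_rep\<close> together say that the
  operator norm is the norm of the algebra.\<close>

locale lp_representation = conjugate_exponents p q for p q :: real +
  fixes M :: "'x measure" and T :: "'a::complex_banach_algebra \<Rightarrow> ('x \<Rightarrow> complex) \<Rightarrow> 'x \<Rightarrow> complex"
  assumes rep_Lp: "\<And>a f. f \<in> Lp_funs p M \<Longrightarrow> T a f \<in> Lp_funs p M"
    and rep_add_fun: "\<And>a f g. f \<in> Lp_funs p M \<Longrightarrow> g \<in> Lp_funs p M \<Longrightarrow>
      AE x in M. T a (\<lambda>x. f x + g x) x = T a f x + T a g x"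
    and rep_scale_fun: "\<And>a c f. f \<in> Lp_funs p M \<Longrightarrow> AE x in M. T a (\<lambda>x. c * f x) x = c * T a f x"
    and rep_add: "\<And>a b f. f \<in> Lp_funs p M \<Longrightarrow> AE x in M. T (a + b) f x = T a f x + T b f x"
    and rep_scale: "\<And>a c f. f \<in> Lp_funs p M \<Longrightarrow> AE x in M. T (c *\<^sub>C a) f x = c * T a f x"
    and rep_mult: "\<And>a b f. f \<in> Lp_funs p M \<Longrightarrow> AE x in M. T (a * b) f x = T a (T b f) x"
    and rep_bound: "\<And>a f. f \<in> Lp_funs p M \<Longrightarrow> mass p M (T a f) \<le> norm a powr p * mass p M f"
    and norm_le_rep: "\<And>a C. 0 \<le> C \<Longrightarrow>
      (\<And>f. f \<in> Lp_funs p M \<Longrightarrow> mass p M (T a f) \<le> C powr p * mass p M f) \<Longrightarrow> norm a \<le> C"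

section \<open>Classes of functions and their representatives\<close>

lemma Lp_class_cong:
  assumes "AE x in M. f x = g x"
  shows "Lp_class p M f = Lp_class p M g"
proof -
  have "(AE x in M. h x = f x) \<longleftrightarrow> (AE x in M. h x = g x)" for h
  proof
    assume "AE x in M. h x = f x"
    then show "AE x in M. h x = g x" using assms by eventually_elim simp
  next
    assume "AE x in M. h x = g x"
    then show "AE x in M. h x = f x" using assms by eventually_elim simp
  qed
  then show ?thesis by (simp add: Lp_class_def)
qed

lemma Lp_rep_class:
  assumes "f \<in> Lp_funs p M"
  shows "Lp_rep (Lp_class p M f) \<in> Lp_funs p M" "AE x in M. Lp_rep (Lp_class p M f) x = f x"
proof -
  have "f \<in> Lp_class p M f" using assms by (simp add: Lp_class_def)
  then have "Lp_rep (Lp_class p M f) \<in> Lp_class p M f" unfolding Lp_rep_def by (rule someI[of "\<lambda>g. g \<in> Lp_class p M f"])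
  then show "Lp_rep (Lp_class p M f) \<in> Lp_funs p M" "AE x in M. Lp_rep (Lp_class p M f) x = f x"
    by (auto simp: Lp_class_def)
qed

lemma Lp_class_rep:
  assumes "F \<in> Lp p M"
  shows "Lp_rep F \<in> Lp_funs p M" "Lp_class p M (Lp_rep F) = F"
proof -
  obtain f where f: "f \<in> Lp_funs p M" "F = Lp_class p M f" using assms by (auto simp: Lp_def)
  show "Lp_rep F \<in> Lp_funs p M" unfolding f(2) by (rule Lp_rep_class(1)[OF f(1)])
  show "Lp_class p M (Lp_rep F) = F"
    unfolding f(2) by (rule Lp_class_cong[OF Lp_rep_class(2)[OF f(1)]])
qed

lemma Lp_class_in_Lp: "f \<in> Lp_funs p M \<Longrightarrow> Lp_class p M f \<in> Lp p M"
  by (simp add: Lp_def)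

lemma Lp_add_class:
  assumes "f \<in> Lp_funs p M" "g \<in> Lp_funs p M"
  shows "Lp_add p M (Lp_class p M f) (Lp_class p M g) = Lp_class p M (\<lambda>x. f x + g x)"
  unfolding Lp_add_def
proof (rule Lp_class_cong)
  show "AE x in M. Lp_rep (Lp_class p M f) x + Lp_rep (Lp_class p M g) x = f x + g x"
    using Lp_rep_class(2)[OF assms(1)] Lp_rep_class(2)[OF assms(2)] by eventually_elim simp
qed

lemma Lp_scale_class:
  assumes "f \<in> Lp_funs p M"
  shows "Lp_scale p M c (Lp_class p M f) = Lp_class p M (\<lambda>x. c * f x)"
  unfolding Lp_scale_def
proof (rule Lp_class_cong)
  show "AE x in M. c * Lp_rep (Lp_class p M f) x = c * f x"
    using Lp_rep_class(2)[OF assms] by eventually_elim simp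
qed

lemma Lp_norm_rep: "Lp_norm p M F = mass p M (Lp_rep F) powr (1 / p)"
  by (simp add: Lp_norm_def mass_def)

lemma Lp_norm_class:
  assumes "f \<in> Lp_funs p M"
  shows "Lp_norm p M (Lp_class p M f) = mass p M f powr (1 / p)"
  unfolding Lp_norm_rep using mass_cong[OF Lp_rep_class(1)[OF assms] assms Lp_rep_class(2)[OF assms]] by simp

lemma Lp_norm_scale:
  assumes "F \<in> Lp p M" "1 < p"
  shows "Lp_scale p M c F \<in> Lp p M" "Lp_norm p M (Lp_scale p M c F) = cmod c * Lp_norm p M F"
proof -
  obtain f where f: "f \<in> Lp_funs p M" "F = Lp_class p M f" using assms by (auto simp: Lp_def)
  show "Lp_scale p M c F \<in> Lp p M"
    unfolding f(2) Lp_scale_class[OF f(1)] by (intro Lp_class_in_Lp Lp_funs_scale f)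
  show "Lp_norm p M (Lp_scale p M c F) = cmod c * Lp_norm p M F"
    unfolding f(2) Lp_scale_class[OF f(1)] Lp_norm_class[OF f(1)] Lp_norm_class[OF Lp_funs_scale[OF f(1)]]
    using assms(2) by (simp add: mass_scale powr_mult powr_powr)
qed

lemma Lp_op_norm_bound:
  assumes p: "1 < p" and S: "S \<in> Lp_ops p M" and F: "F \<in> Lp p M"
  shows "Lp_norm p M (S F) \<le> Lp_op_norm p M S * Lp_norm p M F"
proof -
  have "\<exists>C. \<forall>F\<in>Lp p M. Lp_norm p M (S F) \<le> C * Lp_norm p M F"
    using S by (simp add: Lp_ops_def)
  then obtain C where C: "\<And>F. F \<in> Lp p M \<Longrightarrow> Lp_norm p M (S F) \<le> C * Lp_norm p M F"
    by blast
  have bdd: "bdd_above ((\<lambda>F. Lp_norm p M (S F)) ` {F \<in> Lp p M. Lp_norm p M F \<le> 1})"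
  proof (rule bdd_aboveI2)
    fix G assume "G \<in> {F \<in> Lp p M. Lp_norm p M F \<le> 1}"
    then have G: "G \<in> Lp p M" "Lp_norm p M G \<le> 1" "0 \<le> Lp_norm p M G"
      by (auto simp: Lp_norm_rep)
    have "Lp_norm p M (S G) \<le> C * Lp_norm p M G" by (rule C[OF G(1)])
    also have "\<dots> \<le> \<bar>C\<bar> * 1" using G by (intro mult_mono) auto
    finally show "Lp_norm p M (S G) \<le> \<bar>C\<bar>" by simp
  qed
  show ?thesis
  proof (cases "Lp_norm p M F = 0")
    case True
    then show ?thesis using C[OF F] by simp
  next
    case False
    define c where "c = Lp_norm p M F"
    have c: "0 < c" using False powr_ge_zero[of "mass p M (Lp_rep F)" "1 / p"]
      unfolding c_def Lp_norm_rep by linarith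
    let ?c = "complex_of_real (1 / c)"
    have "Lp_norm p M (S (Lp_scale p M ?c F)) \<le> Lp_op_norm p M S"
      unfolding Lp_op_norm_def
      using Lp_norm_scale[OF F p, of ?c] c
      by (intro cSUP_upper bdd) (auto simp: norm_divide simp flip: c_def)
    moreover have "S (Lp_scale p M ?c F) = Lp_scale p M ?c (S F)" "S F \<in> Lp p M"
      using S F by (auto simp: Lp_ops_def)
    ultimately have "Lp_norm p M (S F) / c \<le> Lp_op_norm p M S"
      using Lp_norm_scale(2)[of "S F" p M ?c] c p by (simp add: norm_divide)
    then show ?thesis using c by (simp add: field_simps flip: c_def)
  qed
qed

lemma lp_representation_exists:
  assumes p: "1 < p" and A: "Lp_operator_algebra p M TYPE('a::complex_banach_algebra)"
  shows "\<exists>T :: 'a \<Rightarrow> _. lp_representation p (p / (p - 1)) M T"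
proof -
  from A obtain B and \<pi> :: "'a \<Rightarrow> _" where B: "closed_subalgebra p M B" and bij: "bij_betw \<pi> UNIV B"
    and add: "\<And>a b. \<pi> (a + b) = Lp_op_add p M (\<pi> a) (\<pi> b)"
    and scale: "\<And>c a. \<pi> (c *\<^sub>C a) = Lp_op_scale p M c (\<pi> a)"
    and mult: "\<And>a b. \<pi> (a * b) = Lp_op_mult p M (\<pi> a) (\<pi> b)"
    and norm: "\<And>a. Lp_op_norm p M (\<pi> a) = norm a"
    unfolding Lp_operator_algebra_def by blast
  have ops: "\<pi> a \<in> Lp_ops p M" for a
    using B bij by (auto simp: closed_subalgebra_def bij_betw_def)
  let ?cl = "Lp_class p M"
  define T where "T a f = Lp_rep (\<pi> a (?cl f))" for a f
  have \<pi>_Lp: "\<pi> a F \<in> Lp p M" if "F \<in> Lp p M" for a F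
    using ops[of a] that by (auto simp: Lp_ops_def)
  have cl_T: "?cl (T a f) = \<pi> a (?cl f)" if "f \<in> Lp_funs p M" for a f
    unfolding T_def by (intro Lp_class_rep \<pi>_Lp Lp_class_in_Lp that)
  have T_Lp: "T a f \<in> Lp_funs p M" if "f \<in> Lp_funs p M" for a f
    unfolding T_def by (intro Lp_class_rep \<pi>_Lp Lp_class_in_Lp that)
  have AE_eq: "AE x in M. T a f x = g x" if "f \<in> Lp_funs p M" "g \<in> Lp_funs p M" "\<pi> a (?cl f) = ?cl g" for a f g
    using Lp_rep_class(2)[OF that(2)] unfolding T_def that(3) .
  have N: "mass p M (T a f) \<le> norm a powr p * mass p M f" if f: "f \<in> Lp_funs p M" for a f
  proof -
    have "mass p M (T a f) powr (1 / p) \<le> norm a * mass p M f powr (1 / p)"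
      using Lp_op_norm_bound[OF p ops Lp_class_in_Lp[OF f], of a]
      by (simp add: Lp_norm_class[OF f] norm Lp_norm_class[OF T_Lp[OF f]] flip: cl_T[OF f])
    then have "(mass p M (T a f) powr (1 / p)) powr p \<le> (norm a * mass p M f powr (1 / p)) powr p"
      using p by (intro powr_mono2) auto
    then show ?thesis using p by (simp add: powr_mult powr_powr)
  qed
  have "lp_representation p (p / (p - 1)) M T"
  proof unfold_locales
    show "1 < p" "1 < p / (p - 1)" "1 / p + 1 / (p / (p - 1)) = 1"
      using p by (auto simp: field_simps)
  next
    fix a b :: 'a and c :: complex and f g assume f: "f \<in> Lp_funs p M"
    note fL = Lp_class_in_Lp[OF f]
    show "T a f \<in> Lp_funs p M" "mass p M (T a f) \<le> norm a powr p * mass p M f"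
      using T_Lp N f by auto
    show "AE x in M. T a (\<lambda>x. f x + g x) x = T a f x + T a g x" if g: "g \<in> Lp_funs p M"
    proof (rule AE_eq)
      have "\<pi> a (Lp_add p M (?cl f) (?cl g)) = Lp_add p M (\<pi> a (?cl f)) (\<pi> a (?cl g))"
        using ops[of a] fL Lp_class_in_Lp[OF g] by (auto simp: Lp_ops_def)
      then show "\<pi> a (?cl (\<lambda>x. f x + g x)) = ?cl (\<lambda>x. T a f x + T a g x)"
        unfolding Lp_add_class[OF f g] cl_T[OF f, symmetric] cl_T[OF g, symmetric]
          Lp_add_class[OF T_Lp[OF f] T_Lp[OF g]] .
    qed (use p f g T_Lp in \<open>auto intro: Lp_funs_add\<close>)
    show "AE x in M. T a (\<lambda>x. c * f x) x = c * T a f x"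
    proof (rule AE_eq)
      have "\<pi> a (Lp_scale p M c (?cl f)) = Lp_scale p M c (\<pi> a (?cl f))"
        using ops[of a] fL by (auto simp: Lp_ops_def)
      then show "\<pi> a (?cl (\<lambda>x. c * f x)) = ?cl (\<lambda>x. c * T a f x)"
        unfolding Lp_scale_class[OF f] cl_T[OF f, symmetric] Lp_scale_class[OF T_Lp[OF f]] .
    qed (use f T_Lp in \<open>auto intro: Lp_funs_scale\<close>)
    show "AE x in M. T (a + b) f x = T a f x + T b f x"
    proof (rule AE_eq[OF f])
      show "\<pi> (a + b) (?cl f) = ?cl (\<lambda>x. T a f x + T b f x)"
        using fL by (simp add: add Lp_op_add_def Lp_add_class[OF T_Lp[OF f] T_Lp[OF f]] flip: cl_T[OF f])
    qed (use p f T_Lp in \<open>auto intro: Lp_funs_add\<close>)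
    show "AE x in M. T (c *\<^sub>C a) f x = c * T a f x"
    proof (rule AE_eq[OF f])
      show "\<pi> (c *\<^sub>C a) (?cl f) = ?cl (\<lambda>x. c * T a f x)"
        using fL by (simp add: scale Lp_op_scale_def Lp_scale_class[OF T_Lp[OF f]] flip: cl_T[OF f])
    qed (use f T_Lp in \<open>auto intro: Lp_funs_scale\<close>)
    show "AE x in M. T (a * b) f x = T a (T b f) x"
    proof (rule AE_eq[OF f])
      show "\<pi> (a * b) (?cl f) = ?cl (T a (T b f))"
        using fL by (simp add: mult Lp_op_mult_def compose_def cl_T[OF T_Lp[OF f]] cl_T[OF f])
    qed (use f T_Lp in auto)
  next
    fix a :: 'a and C :: real
    assume C: "0 \<le> C" and bound: "\<And>f. f \<in> Lp_funs p M \<Longrightarrow> mass p M (T a f) \<le> C powr p * mass p M f"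
    have "Lp_op_norm p M (\<pi> a) \<le> C"
      unfolding Lp_op_norm_def
    proof (rule cSUP_least)
      have "(\<lambda>x. 0) \<in> Lp_funs p M" by (simp add: Lp_funs_def)
      moreover from this have "Lp_norm p M (?cl (\<lambda>x. 0)) \<le> 1"
        by (simp add: Lp_norm_class mass_def)
      ultimately show "{F \<in> Lp p M. Lp_norm p M F \<le> 1} \<noteq> {}"
        using Lp_class_in_Lp by blast
    next
      fix F assume "F \<in> {F \<in> Lp p M. Lp_norm p M F \<le> 1}"
      then obtain f where f: "f \<in> Lp_funs p M" "F = ?cl f" "Lp_norm p M F \<le> 1"
        by (auto simp: Lp_def)
      have "Lp_norm p M (\<pi> a F) = mass p M (T a f) powr (1 / p)"
        using f by (simp add: Lp_norm_class[OF T_Lp] flip: cl_T)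
      also have "\<dots> \<le> (C powr p * mass p M f) powr (1 / p)"
        using bound[OF f(1)] p by (intro powr_mono2) auto
      also have "\<dots> = C * Lp_norm p M F"
        using p C f by (simp add: powr_mult powr_powr Lp_norm_class)
      also have "\<dots> \<le> C * 1" using C f by (intro mult_left_mono) auto
      finally show "Lp_norm p M (\<pi> a F) \<le> C" by simp
    qed
    then show "norm a \<le> C" by (simp add: norm)
  qed
  then show ?thesis by blast
qed

lemma uminus_eq_scaleC: "- x = (-1 :: complex) *\<^sub>C (x :: 'a::complex_vector)"
  using scaleR_scaleC[of "-1" x] by simp

lemma diff_eq_scaleC: "x - y = x + (-1 :: complex) *\<^sub>C (y :: 'a::complex_vector)"
  using uminus_eq_scaleC[of y] by (metis diff_conv_add_uminus)

lemma zero_scaleC [simp]: "(0 :: complex) *\<^sub>C (x :: 'a::complex_vector) = 0"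
  using scaleR_scaleC[of 0 x] by simp

lemma scaleC_zero [simp]: "c *\<^sub>C (0 :: 'a::complex_vector) = 0"
  using scaleC_add_right[of c "0::'a" 0] by simp

lemma (in lp_representation) rep_contraction:
  assumes "norm a \<le> K" "f \<in> Lp_funs p M"
  shows "mass p M (T a f) \<le> K powr p * mass p M f"
  using assms p_gt_1
  by (intro order_trans[OF rep_bound[OF assms(2)]] mult_right_mono powr_mono2) auto

section \<open>The unitization acting on the fixed space\<close>

locale lp_approximate_identity = lp_representation p q M T
  for p q M and T :: "'a::complex_banach_algebra \<Rightarrow> ('x \<Rightarrow> complex) \<Rightarrow> 'x \<Rightarrow> complex" +
  fixes \<Phi> :: "'i filter" and e :: "'i \<Rightarrow> 'a"
  assumes \<Phi>_nontrivial: "\<Phi> \<noteq> bot" and norm_e: "norm (e t) \<le> 1"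
    and e_left: "((\<lambda>t. e t * a) \<longlongrightarrow> a) \<Phi>" and e_right: "((\<lambda>t. a * e t) \<longlongrightarrow> a) \<Phi>"
begin

lemma pairing_AE:
  assumes "AE x in M. f x = f' x" "f \<in> Lp_funs p M" "f' \<in> Lp_funs p M" "g \<in> Lp_funs q M"
  shows "pairing M f g = pairing M f' g"
  by (rule pairing_cong) (use assms in auto)

sublocale contractive_forms p q M \<Phi> "\<lambda>t f g. pairing M (T (e t) f) g"
proof unfold_locales
  fix t f f' g assume f: "f \<in> Lp_funs p M" and f': "f' \<in> Lp_funs p M" and g: "g \<in> Lp_funs q M"
  have "pairing M (T (e t) (\<lambda>x. f x + f' x)) g = pairing M (\<lambda>x. T (e t) f x + T (e t) f' x) g"
    using p_gt_1 by (intro pairing_AE rep_add_fun f f' g rep_Lp Lp_funs_add) auto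
  also have "\<dots> = pairing M (T (e t) f) g + pairing M (T (e t) f') g"
    by (intro pairing_add_left rep_Lp f f' g)
  finally show "pairing M (T (e t) (\<lambda>x. f x + f' x)) g = pairing M (T (e t) f) g + pairing M (T (e t) f') g" .
next
  fix t f g g' assume f: "f \<in> Lp_funs p M" and g: "g \<in> Lp_funs q M" and g': "g' \<in> Lp_funs q M"
  show "pairing M (T (e t) f) (\<lambda>x. g x + g' x) = pairing M (T (e t) f) g + pairing M (T (e t) f) g'"
    by (intro pairing_add_right rep_Lp f g g')
next
  fix t f g and c :: complex assume f: "f \<in> Lp_funs p M" and g: "g \<in> Lp_funs q M"
  have "pairing M (T (e t) (\<lambda>x. c * f x)) g = pairing M (\<lambda>x. c * T (e t) f x) g"
    by (intro pairing_AE rep_scale_fun f g rep_Lp Lp_funs_scale)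
  then show "pairing M (T (e t) (\<lambda>x. c * f x)) g = c * pairing M (T (e t) f) g"
    by (simp add: pairing_scale_left)
  show "pairing M (T (e t) f) (\<lambda>x. c * g x) = c * pairing M (T (e t) f) g"
    by (rule pairing_scale_right)
  have "cmod (pairing M (T (e t) f) g) \<le> mass p M (T (e t) f) / p + mass q M g / q"
    by (intro pairing_young rep_Lp f g)
  also have "mass p M (T (e t) f) \<le> 1 powr p * mass p M f"
    by (rule rep_contraction[OF norm_e f])
  finally show "cmod (pairing M (T (e t) f) g) \<le> mass p M f / p + mass q M g / q"
    using p_gt_1 by (simp add: divide_right_mono)
qed

lemma pairing_rep_tendsto:
  assumes d: "(d \<longlongrightarrow> a) \<Phi>" and f: "f \<in> Lp_funs p M" and g: "g \<in> Lp_funs q M"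
  shows "((\<lambda>t. pairing M (T (d t) f) g) \<longlongrightarrow> pairing M (T a f) g) \<Phi>"
proof (rule tendstoI)
  fix \<epsilon> :: real assume \<epsilon>: "0 < \<epsilon>"
  interpret P: contractive_forms p q M \<Phi> "\<lambda>_. pairing M" by (rule pairing_forms)
  obtain \<delta> where \<delta>: "0 < \<delta>"
    "\<And>f. f \<in> Lp_funs p M \<Longrightarrow> mass p M f < \<delta> \<Longrightarrow> cmod (pairing M f g) < \<epsilon>"
    using P.form_small[OF g \<epsilon>] by metis
  have "((\<lambda>t. norm (d t - a)) \<longlongrightarrow> 0) \<Phi>" using d by (simp add: LIM_zero tendsto_norm_zero)
  then have "((\<lambda>t. norm (d t - a) powr p * mass p M f) \<longlongrightarrow> 0 powr p * mass p M f) \<Phi>"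
    using p_gt_1 by (intro tendsto_mult tendsto_const tendsto_powr') auto
  then have "\<forall>\<^sub>F t in \<Phi>. norm (d t - a) powr p * mass p M f < \<delta>"
    using \<delta>(1) p_gt_1 by (intro order_tendstoD(2)) auto
  then show "\<forall>\<^sub>F t in \<Phi>. dist (pairing M (T (d t) f) g) (pairing M (T a f) g) < \<epsilon>"
  proof eventually_elim
    case (elim t)
    have "cmod (pairing M (T (d t - a) f) g) < \<epsilon>"
      using rep_bound[OF f, of "d t - a"] elim by (intro \<delta>(2) rep_Lp f) auto
    moreover have "pairing M (T (d t) f) g = pairing M (\<lambda>x. T (d t - a) f x + T a f x) g"
      using rep_add[OF f, of "d t - a" a] p_gt_1
      by (intro pairing_AE Lp_funs_add rep_Lp f g) auto
    ultimately show ?case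
      using f g by (simp add: pairing_add_left rep_Lp dist_norm)
  qed
qed

lemma rep_fixed: "f \<in> Lp_funs p M \<Longrightarrow> T a f \<in> E"
proof -
  assume f: "f \<in> Lp_funs p M"
  have "((\<lambda>t. pairing M (T (e t) (T a f)) g) \<longlongrightarrow> pairing M (T a f) g) \<Phi>" if g: "g \<in> Lp_funs q M" for g
  proof -
    have "pairing M (T (e t * a) f) g = pairing M (T (e t) (T a f)) g" for t
      by (intro pairing_AE rep_mult rep_Lp f g)
    then show ?thesis using pairing_rep_tendsto[OF e_left[of a] f g] by simp
  qed
  then show ?thesis using rep_Lp[OF f] by (simp add: fixed_space_def)
qed

text \<open>The action of \<open>a + l1\<close>. On \<open>E\<close> its norm is that of the
  unitization; \<open>act_bound\<close> and \<open>norm_le_act\<close> are the two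
  inequalities.\<close>

definition act :: "'a \<Rightarrow> complex \<Rightarrow> ('x \<Rightarrow> complex) \<Rightarrow> 'x \<Rightarrow> complex"
  where "act a l f = (\<lambda>x. T a f x + l * f x)"

lemma act_fixed: "f \<in> E \<Longrightarrow> act a l f \<in> E"
  unfolding act_def by (intro fixed_add fixed_scale rep_fixed fixed_Lp)

text \<open>On \<open>E\<close> the operator is the weak limit of the elements
  \<open>a * e t + l *\<^sub>C e t\<close> of the algebra, whose norms are at most \<open>K\<close>;
  testing the limit against its own dual recovers its mass.\<close>

lemma act_bound:
  assumes K: "0 \<le> K" "\<And>c. norm c \<le> 1 \<Longrightarrow> norm (a * c + l *\<^sub>C c) \<le> K" and f: "f \<in> E"
  shows "mass p M (act a l f) \<le> K powr p * mass p M f"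
proof -
  note fL = fixed_Lp[OF f]
  define G where "G = act a l f"
  have G: "G \<in> Lp_funs p M" unfolding G_def by (intro fixed_Lp act_fixed f)
  have "cmod (pairing M G g) \<le> K powr p * mass p M f / p + mass q M g / q" if g: "g \<in> Lp_funs q M" for g
  proof -
    have "((\<lambda>t. pairing M (T (a * e t) f) g + l * pairing M (T (e t) f) g)
        \<longlongrightarrow> pairing M (T a f) g + l * pairing M f g) \<Phi>"
      using f g by (intro tendsto_add tendsto_mult_left pairing_rep_tendsto e_right fL)
        (auto simp: fixed_space_def)
    moreover have "pairing M (T a f) g + l * pairing M f g = pairing M G g"
      unfolding G_def act_def using fL g
      by (simp add: pairing_add_left pairing_scale_left rep_Lp Lp_funs_scale)
    moreover have "cmod (pairing M (T (a * e t) f) g + l * pairing M (T (e t) f) g)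
        \<le> K powr p * mass p M f / p + mass q M g / q" for t
    proof -
      let ?d = "a * e t + l *\<^sub>C e t"
      have "pairing M (T ?d f) g = pairing M (\<lambda>x. T (a * e t) f x + l * T (e t) f x) g"
      proof (rule pairing_AE)
        show "AE x in M. T ?d f x = T (a * e t) f x + l * T (e t) f x"
          using rep_add[OF fL, of "a * e t" "l *\<^sub>C e t"] rep_scale[OF fL, of l "e t"]
          by eventually_elim simp
      qed (use p_gt_1 in \<open>auto intro!: rep_Lp Lp_funs_add Lp_funs_scale fL g\<close>)
      then have "pairing M (T (a * e t) f) g + l * pairing M (T (e t) f) g = pairing M (T ?d f) g"
        using fL g by (simp add: pairing_add_left pairing_scale_left rep_Lp Lp_funs_scale)
      also have "cmod \<dots> \<le> mass p M (T ?d f) / p + mass q M g / q"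
        by (intro pairing_young rep_Lp fL g)
      also have "mass p M (T ?d f) \<le> K powr p * mass p M f"
        by (rule rep_contraction[OF K(2)[OF norm_e] fL])
      finally show ?thesis using p_gt_1 by (simp add: divide_right_mono)
    qed
    ultimately show ?thesis
      by (intro tendsto_upperbound[OF tendsto_norm _ \<Phi>_nontrivial]) auto
  qed
  from this[OF lp_dual_Lp_funs[OF G]]
  have "mass p M G \<le> K powr p * mass p M f / p + mass p M G / q"
    by (simp add: pairing_lp_dual[OF G] mass_lp_dual)
  then show ?thesis unfolding G_def by (rule young_cancel)
qed

text \<open>\<open>T c\<close> is a contraction of \<open>L^p\<close> into \<open>E\<close>, and
  \<open>a * c + l *\<^sub>C c\<close> acts as \<open>act a l\<close> after
  \<open>T c\<close>.\<close>

lemma norm_le_act: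
  assumes K: "0 \<le> K" "\<And>f. f \<in> E \<Longrightarrow> mass p M (act a l f) \<le> K powr p * mass p M f"
    and c: "norm c \<le> 1"
  shows "norm (a * c + l *\<^sub>C c) \<le> K"
proof (rule norm_le_rep[OF K(1)])
  fix f assume f: "f \<in> Lp_funs p M"
  have "AE x in M. T (a * c + l *\<^sub>C c) f x = act a l (T c f) x"
    using rep_add[OF f, of "a * c" "l *\<^sub>C c"] rep_scale[OF f, of l c] rep_mult[OF f, of a c]
    unfolding act_def by eventually_elim simp
  then have "mass p M (T (a * c + l *\<^sub>C c) f) = mass p M (act a l (T c f))"
    by (intro mass_cong rep_Lp f fixed_Lp act_fixed rep_fixed)
  also have "\<dots> \<le> K powr p * mass p M (T c f)" by (intro K(2) rep_fixed f)
  also have "mass p M (T c f) \<le> 1 powr p * mass p M f"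
    by (rule rep_contraction[OF c f])
  finally show "mass p M (T (a * c + l *\<^sub>C c) f) \<le> K powr p * mass p M f"
    using K by (simp add: mult_left_mono)
qed

lemma rep_fixed_operator:
  assumes "norm h \<le> 1"
  shows "fixed_operator 1 (T h)"
  unfolding fixed_operator_def
proof (intro conjI ballI allI)
  show "mass p M (T h f) \<le> 1 powr p * mass p M f" if "f \<in> E" for f
    by (rule rep_contraction[OF assms fixed_Lp[OF that]])
qed (auto intro: rep_fixed fixed_Lp rep_add_fun rep_scale_fun)

text \<open>With \<open>x = a + l1\<close> and \<open>k = x (H (H u))\<close>, the image of
  \<open>u\<close> is \<open>G = H (H k) + (u - H (H u))\<close>. Since
  \<open>mass p M k \<le> \<alpha>\<close>, the splitting estimates for the two summands, paired
  with the dual of \<open>G\<close>, add up to \<open>mass p M u / p + mass p M G / q\<close>: the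
  weights \<alpha> and \<beta> cancel, and \<open>young_cancel\<close> applies.\<close>

lemma splitting_contraction:
  assumes H: "fixed_operator 1 H" and split: "splitting_operator H"
    and s: "\<And>f. f \<in> E \<Longrightarrow> AE x in M. T s f x = H (H f) x"
    and a: "\<And>c. norm c \<le> 1 \<Longrightarrow> norm (a * c + l *\<^sub>C c) \<le> 1" and c: "norm c \<le> 1"
  shows "norm ((s * (a * s) + l *\<^sub>C (s * s) - s) * c + 1 *\<^sub>C c) \<le> 1"
proof (rule norm_le_act[OF _ _ c])
  fix u assume u: "u \<in> E"
  let ?b = "s * (a * s) + l *\<^sub>C (s * s) - s"
  define k where "k = act a l (H (H u))"
  define G where "G = act ?b 1 u"
  have HE: "H f \<in> E" if "f \<in> E" for f by (rule fixed_operatorD(1)[OF H that])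
  have HH: "fixed_operator 1 (\<lambda>f. H (H f))" by (rule fixed_operator_compose[OF H])
  have k: "k \<in> E" unfolding k_def by (intro act_fixed HE u)
  have G: "G \<in> E" unfolding G_def by (rule act_fixed[OF u])
  have uL: "u \<in> Lp_funs p M" by (rule fixed_Lp[OF u])
  have Tsu: "T s u \<in> E" by (rule rep_fixed[OF uL])
  have HHu: "H (H u) \<in> E" by (intro HE u)
  have TaTs: "AE x in M. T a (T s u) x = T a (H (H u)) x"
    by (rule fixed_operator_cong[of "norm a" "T a", OF _ Tsu HHu s[OF u]])
      (auto simp: fixed_operator_def intro: rep_fixed fixed_Lp rep_add_fun rep_scale_fun rep_bound)
  have eq: "AE x in M. G x = H (H k) x + (u x - H (H u) x)"
  proof -
    have 1: "AE x in M. T ?b u x = T s (T (a * s) u) x + l * T s (T s u) x - T s u x"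
      using rep_add[OF uL, of "s * (a * s) + l *\<^sub>C (s * s)" "(-1) *\<^sub>C s"]
        rep_add[OF uL, of "s * (a * s)" "l *\<^sub>C (s * s)"] rep_scale[OF uL, of "-1" s]
        rep_scale[OF uL, of l "s * s"] rep_mult[OF uL, of s s] rep_mult[OF uL, of s "a * s"]
      unfolding diff_eq_scaleC[of "s * (a * s) + l *\<^sub>C (s * s)" s]
      by eventually_elim simp
    have 2: "AE x in M. T (a * s) u x + l * T s u x = k x"
      using rep_mult[OF uL, of a s] TaTs s[OF u] unfolding k_def act_def by eventually_elim simp
    have v: "(\<lambda>x. T (a * s) u x + l * T s u x) \<in> E"
      by (intro fixed_add fixed_scale rep_fixed uL)
    have 3: "AE x in M. H (H (\<lambda>x. T (a * s) u x + l * T s u x)) x = H (H k) x"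
      by (rule fixed_operator_cong[OF HH v k 2])
    have 4: "AE x in M. H (H (\<lambda>x. T (a * s) u x + l * T s u x)) x = H (H (T (a * s) u)) x + l * H (H (T s u)) x"
      using fixed_operatorD(2)[OF HH rep_fixed[OF uL, of "a * s"] fixed_scale[OF Tsu, of l]]
        fixed_operatorD(3)[OF HH Tsu, of l]
      by eventually_elim simp
    show ?thesis
      using 1 3 4 s[OF rep_fixed[OF uL, of "a * s"]] s[OF Tsu] s[OF u]
      unfolding G_def act_def by eventually_elim simp
  qed
  obtain \<alpha> \<beta> where ab: "mass p M (H (H u)) \<le> \<alpha>"
    "cmod (pairing M (H (H k)) (dual G)) \<le> mass p M k / p + \<beta> / q"
    "cmod (pairing M (\<lambda>x. u x - H (H u) x) (dual G))
      \<le> (mass p M u - \<alpha>) / p + (mass p M G - \<beta>) / q"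
    using split u G k unfolding splitting_operator_def by blast
  have kb: "mass p M k \<le> \<alpha>"
    using act_bound[OF _ a HHu] ab(1) unfolding k_def by simp
  have JG: "(dual G) \<in> Lp_funs q M" by (rule lp_dual_Lp_funs[OF fixed_Lp[OF G]])
  have D: "(\<lambda>x. u x - H (H u) x) \<in> E" by (rule fixed_diff[OF u HHu])
  have "pairing M G (dual G)
      = pairing M (\<lambda>x. H (H k) x + (u x - H (H u) x)) (dual G)"
    by (intro pairing_AE eq fixed_Lp G fixed_add HE k D JG)
  also have "\<dots> = pairing M (H (H k)) (dual G)
      + pairing M (\<lambda>x. u x - H (H u) x) (dual G)"
    by (intro pairing_add_left fixed_Lp HE k D JG)
  finally have eq': "complex_of_real (mass p M G) = \<dots>"
    unfolding pairing_lp_dual[OF fixed_Lp[OF G]] .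
  have "mass p M G = cmod (complex_of_real (mass p M G))" by simp
  also have "\<dots> \<le> cmod (pairing M (H (H k)) (dual G))
      + cmod (pairing M (\<lambda>x. u x - H (H u) x) (dual G))"
    unfolding eq' by (rule norm_triangle_ineq)
  also have "\<dots> \<le> mass p M k / p + \<beta> / q + ((mass p M u - \<alpha>) / p + (mass p M G - \<beta>) / q)"
    using ab by (intro add_mono)
  also have "\<dots> \<le> \<alpha> / p + \<beta> / q + ((mass p M u - \<alpha>) / p + (mass p M G - \<beta>) / q)"
    using kb p_gt_1 by (intro add_right_mono divide_right_mono) auto
  also have "\<dots> = mass p M u / p + mass p M G / q"
    by (simp add: diff_divide_distrib)
  finally have "mass p M G \<le> mass p M u / p + mass p M G / q" .
  then show "mass p M (act ?b 1 u) \<le> 1 powr p * mass p M u"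
    using young_cancel by (simp add: G_def)
qed simp

theorem hermitian_contraction:
  fixes h a c s :: 'a
  assumes h: "norm h \<le> 1"
    and herm: "\<And>r c. \<bar>r\<bar> \<le> 1 \<Longrightarrow> norm c \<le> 1 \<Longrightarrow>
      norm (((\<i> * complex_of_real r) *\<^sub>C h) * c + 1 *\<^sub>C c) \<le> 1 + r\<^sup>2"
    and a: "\<And>c. norm c \<le> 1 \<Longrightarrow> norm (a * c + l *\<^sub>C c) \<le> 1" and c: "norm c \<le> 1"
    and s: "s = h * h \<or> s = (h * h) * (h * h)"
  shows "norm ((s * (a * s) + l *\<^sub>C (s * s) - s) * c + 1 *\<^sub>C c) \<le> 1"
proof -
  let ?H = "T h"
  have H: "fixed_operator 1 ?H" by (rule rep_fixed_operator[OF h])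
  have bound: "mass p M (\<lambda>x. 1 * f x + (\<i> * complex_of_real r) * ?H f x) \<le> (1 + r\<^sup>2) powr p * mass p M f"
    if r: "\<bar>r\<bar> \<le> 1" and f: "f \<in> E" for r f
  proof -
    have "mass p M (\<lambda>x. 1 * f x + (\<i> * complex_of_real r) * ?H f x)
        = mass p M (act ((\<i> * complex_of_real r) *\<^sub>C h) 1 f)"
    proof (rule mass_cong)
      show "AE x in M. 1 * f x + (\<i> * complex_of_real r) * ?H f x = act ((\<i> * complex_of_real r) *\<^sub>C h) 1 f x"
        using rep_scale[OF fixed_Lp[OF f], of "\<i> * complex_of_real r" h]
        unfolding act_def by eventually_elim simp
    qed (intro fixed_Lp act_fixed fixed_add fixed_scale rep_fixed f)+
    also have "\<dots> \<le> (1 + r\<^sup>2) powr p * mass p M f"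
      by (rule act_bound[OF _ herm[OF r] f]) simp
    finally show ?thesis .
  qed
  note split = hermitian_splitting[OF H bound]
  have 2: "AE x in M. T (h * h) f x = ?H (?H f) x" if "f \<in> E" for f
    by (rule rep_mult[OF fixed_Lp[OF that]])
  from s show ?thesis
  proof
    assume "s = h * h"
    then show ?thesis using splitting_contraction[OF H split(1) _ a c] 2 by blast
  next
    assume s: "s = (h * h) * (h * h)"
    have "AE x in M. T s f x = ?H (?H (?H (?H f))) x" if f: "f \<in> E" for f
      unfolding s
      using rep_mult[OF fixed_Lp[OF f], of "h * h" "h * h"] 2[OF rep_fixed[OF fixed_Lp[OF f]], of "h * h"]
        fixed_operator_cong[OF fixed_operator_compose[OF H] rep_fixed[OF fixed_Lp[OF f]]
          rep_fixed[OF rep_Lp[OF fixed_Lp[OF f]]] 2[OF f]]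
      by eventually_elim simp
    then show ?thesis using splitting_contraction[OF fixed_operator_compose[OF H] split(2) _ a c] by blast
  qed
qed

text \<open>The vector state of a normalized vector in the range of \<open>T b\<close>. The third
  condition is what makes its extension by \<open>l\<close> contractive on the unitization.\<close>

theorem vector_state:
  assumes "b \<noteq> (0 :: 'a)"
  shows "\<exists>\<omega> :: 'a \<Rightarrow> complex. (\<forall>a b. \<omega> (a + b) = \<omega> a + \<omega> b) \<and> (\<forall>c a. \<omega> (c *\<^sub>C a) = c * \<omega> a) \<and>
    (\<forall>a l. (\<forall>c. norm c \<le> 1 \<longrightarrow> norm (a * c + l *\<^sub>C c) \<le> 1) \<longrightarrow> cmod (\<omega> a + l) \<le> 1) \<and>
    (\<exists>a. \<omega> a \<noteq> 0)"
proof -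
  have "\<exists>f\<in>Lp_funs p M. mass p M (T b f) \<noteq> 0"
  proof (rule ccontr)
    assume "\<not> ?thesis"
    then have "norm b \<le> 0" by (intro norm_le_rep) auto
    then show False using assms by simp
  qed
  then obtain f where f: "f \<in> Lp_funs p M" "mass p M (T b f) \<noteq> 0" by blast
  define m where "m = mass p M (T b f)"
  have m: "0 < m" using f(2) mass_nonneg[of p M "T b f"] unfolding m_def by linarith
  define u where "u = (\<lambda>x. complex_of_real (m powr (- 1 / p)) * T b f x)"
  have u: "u \<in> E" unfolding u_def by (intro fixed_scale rep_fixed f)
  have uL: "u \<in> Lp_funs p M" by (rule fixed_Lp[OF u])
  have mass_u: "mass p M u = 1"
  proof -
    have "mass p M u = (m powr (- 1 / p)) powr p * m"
      unfolding u_def m_def by (simp only: mass_scale norm_of_real abs_of_nonneg powr_ge_zero)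
    also have "\<dots> = 1"
      using m p_gt_1 unfolding powr_powr by (simp add: powr_minus)
    finally show ?thesis .
  qed
  define F where "F = (dual u)"
  have F: "F \<in> Lp_funs q M" unfolding F_def by (rule lp_dual_Lp_funs[OF uL])
  have uF: "pairing M u F = 1" unfolding F_def by (simp add: pairing_lp_dual[OF uL] mass_u)
  define \<omega> where "\<omega> a = pairing M (T a u) F" for a
  show ?thesis
  proof (intro exI[of _ \<omega>] conjI allI impI)
    fix a b :: 'a and c :: complex
    have "\<omega> (a + b) = pairing M (\<lambda>x. T a u x + T b u x) F"
      unfolding \<omega>_def using p_gt_1 by (intro pairing_AE rep_add rep_Lp uL F Lp_funs_add) auto
    then show "\<omega> (a + b) = \<omega> a + \<omega> b" unfolding \<omega>_def by (simp add: pairing_add_left rep_Lp uL F)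
    have "\<omega> (c *\<^sub>C a) = pairing M (\<lambda>x. c * T a u x) F"
      unfolding \<omega>_def by (intro pairing_AE rep_scale rep_Lp uL F Lp_funs_scale)
    then show "\<omega> (c *\<^sub>C a) = c * \<omega> a" unfolding \<omega>_def by (simp add: pairing_scale_left)
  next
    fix a :: 'a and l assume "\<forall>c. norm c \<le> 1 \<longrightarrow> norm (a * c + l *\<^sub>C c) \<le> 1"
    then have a: "norm (a * c + l *\<^sub>C c) \<le> 1" if "norm c \<le> 1" for c using that by blast
    have "\<omega> a + l = pairing M (act a l u) F"
      unfolding \<omega>_def act_def using uF
      by (simp add: pairing_add_left pairing_scale_left rep_Lp uL F Lp_funs_scale)
    also have "cmod \<dots> \<le> mass p M (act a l u) / p + mass q M F / q"
      by (intro pairing_young fixed_Lp act_fixed u F)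
    also have "\<dots> \<le> 1 / p + 1 / q"
      using act_bound[OF _ a u] p_gt_1 mass_u by (simp add: F_def mass_lp_dual divide_right_mono)
    finally show "cmod (\<omega> a + l) \<le> 1" by (simp add: conj_eq)
  next
    \<comment> \<open>As \<open>u\<close> is fixed, the values along the net tend to
      \<open>pairing M u F = 1\<close>; this makes the functional nonzero on the algebra.\<close>
    have "((\<lambda>t. \<omega> (e t)) \<longlongrightarrow> pairing M u F) \<Phi>"
      using u F unfolding \<omega>_def fixed_space_def by blast
    then have "((\<lambda>t. \<omega> (e t)) \<longlongrightarrow> 1) \<Phi>" unfolding uF .
    show "\<exists>a. \<omega> a \<noteq> 0"
    proof (rule ccontr)
      assume "\<not> ?thesis"
      with \<open>((\<lambda>t. \<omega> (e t)) \<longlongrightarrow> 1) \<Phi>\<close> show False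
        using \<Phi>_nontrivial by (simp add: tendsto_const_iff)
    qed
  qed
qed

end

section \<open>The multiplier unitization\<close>

lemma tail_filter_eventually:
  assumes "directed_set \<Lambda> le"
  shows "tail_filter \<Lambda> le \<noteq> bot" "\<forall>\<^sub>F t in tail_filter \<Lambda> le. t \<in> \<Lambda>"
proof -
  have ne: "\<Lambda> \<noteq> {}" and refl: "\<And>s. s \<in> \<Lambda> \<Longrightarrow> le s s"
    using assms by (auto simp: directed_set_def)
  have "eventually P (tail_filter \<Lambda> le) \<longleftrightarrow> (\<exists>s\<in>\<Lambda>. eventually P (principal {t\<in>\<Lambda>. le s t}))" for P
    unfolding tail_filter_def
  proof (rule eventually_INF_base[OF ne])
    fix r s assume rs: "r \<in> \<Lambda>" "s \<in> \<Lambda>"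
    then obtain t where t: "t \<in> \<Lambda>" "le r t" "le s t"
      using assms unfolding directed_set_def by meson
    then have "{u \<in> \<Lambda>. le t u} \<subseteq> {u \<in> \<Lambda>. le r u} \<inter> {u \<in> \<Lambda>. le s u}"
      using assms rs unfolding directed_set_def by blast
    then show "\<exists>t\<in>\<Lambda>. principal {u \<in> \<Lambda>. le t u} \<le> inf (principal {u \<in> \<Lambda>. le r u}) (principal {u \<in> \<Lambda>. le s u})"
      using t(1) by (auto simp: inf_principal)
  qed
  then have ev: "eventually P (tail_filter \<Lambda> le) \<longleftrightarrow> (\<exists>s\<in>\<Lambda>. \<forall>t\<in>\<Lambda>. le s t \<longrightarrow> P t)" for P
    by (auto simp: eventually_principal)
  show "tail_filter \<Lambda> le \<noteq> bot"
    using ev[of "\<lambda>_. False"] refl by (auto simp: trivial_limit_def)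
  show "\<forall>\<^sub>F t in tail_filter \<Lambda> le. t \<in> \<Lambda>"
    unfolding ev using ne by blast
qed

lemma norm_mult_le_1:
  fixes a b :: "'a::real_normed_algebra"
  assumes "norm a \<le> 1" "norm b \<le> 1"
  shows "norm (a * b) \<le> 1"
  using norm_mult_ineq[of a b] mult_le_one[OF assms(1) _ assms(2)] by simp

lemma tendsto_zero_if_norm_le:
  assumes "\<And>t. norm (f t) \<le> g t" "(g \<longlongrightarrow> (0::real)) F"
  shows "(f \<longlongrightarrow> 0) F"
  by (rule Lim_null_comparison[OF _ assms(2)]) (simp add: assms(1))

section \<open>Approximate identities along a filter\<close>

definition approximates_identity :: "'i filter \<Rightarrow> ('i \<Rightarrow> 'a::complex_banach_algebra) \<Rightarrow> bool"
  where "approximates_identity \<Phi> e \<longleftrightarrow> (\<forall>t. norm (e t) \<le> 1) \<and>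
    (\<forall>a. ((\<lambda>t. e t * a) \<longlongrightarrow> a) \<Phi>) \<and> (\<forall>a. ((\<lambda>t. a * e t) \<longlongrightarrow> a) \<Phi>)"

lemma approximates_identity_sandwich:
  assumes "approximates_identity \<Phi> e"
  shows "((\<lambda>t. e t * (a * e t)) \<longlongrightarrow> a) \<Phi>"
proof -
  have n: "\<And>t. norm (e t) \<le> 1" and l: "((\<lambda>t. e t * a) \<longlongrightarrow> a) \<Phi>" and r: "((\<lambda>t. a * e t) \<longlongrightarrow> a) \<Phi>"
    using assms by (auto simp: approximates_identity_def)
  have "norm (e t * (a * e t) - a) \<le> norm (a * e t - a) + norm (e t * a - a)" for t
  proof -
    have eq: "e t * (a * e t) - a = e t * (a * e t - a) + (e t * a - a)" by (simp add: algebra_simps)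
    have n1: "norm (e t * (a * e t - a)) \<le> 1 * norm (a * e t - a)"
      using n[of t] by (intro order_trans[OF norm_mult_ineq] mult_right_mono) auto
    show ?thesis
        unfolding eq by (rule order_trans[OF norm_triangle_mono[OF n1 order_refl]]) simp
  qed
  moreover have "((\<lambda>t. norm (a * e t - a) + norm (e t * a - a)) \<longlongrightarrow> 0) \<Phi>"
    using tendsto_add[OF tendsto_norm_zero[OF LIM_zero[OF r]] tendsto_norm_zero[OF LIM_zero[OF l]]] by simp
  ultimately have "((\<lambda>t. e t * (a * e t) - a) \<longlongrightarrow> 0) \<Phi>"
    by (rule tendsto_zero_if_norm_le)
  then show ?thesis by (rule LIM_zero_cancel)
qed

lemma approximates_identity_square:
  assumes "approximates_identity \<Phi> e"
  shows "approximates_identity \<Phi> (\<lambda>t. e t * e t)"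
proof -
  have n: "\<And>t. norm (e t) \<le> 1" and l: "\<And>a. ((\<lambda>t. e t * a) \<longlongrightarrow> a) \<Phi>" and r: "\<And>a. ((\<lambda>t. a * e t) \<longlongrightarrow> a) \<Phi>"
    using assms by (auto simp: approximates_identity_def)
  have "((\<lambda>t. e t * e t * a) \<longlongrightarrow> a) \<Phi>" for a
  proof -
    have "norm (e t * e t * a - a) \<le> 2 * norm (e t * a - a)" for t
    proof -
      have eq: "e t * e t * a - a = e t * (e t * a - a) + (e t * a - a)" by (simp add: algebra_simps)
      have n1: "norm (e t * (e t * a - a)) \<le> 1 * norm (e t * a - a)"
        using n[of t] by (intro order_trans[OF norm_mult_ineq] mult_right_mono) auto
      show ?thesis
        unfolding eq by (rule order_trans[OF norm_triangle_mono[OF n1 order_refl]]) simp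
    qed
    moreover have "((\<lambda>t. 2 * norm (e t * a - a)) \<longlongrightarrow> 0) \<Phi>"
      using tendsto_mult[OF tendsto_const tendsto_norm_zero[OF LIM_zero[OF l]], of 2] by simp
    ultimately have "((\<lambda>t. e t * e t * a - a) \<longlongrightarrow> 0) \<Phi>"
      by (rule tendsto_zero_if_norm_le)
    then show ?thesis by (rule LIM_zero_cancel)
  qed
  moreover have "((\<lambda>t. a * (e t * e t)) \<longlongrightarrow> a) \<Phi>" for a
  proof -
    have "norm (a * (e t * e t) - a) \<le> 2 * norm (a * e t - a)" for t
    proof -
      have eq: "a * (e t * e t) - a = (a * e t - a) * e t + (a * e t - a)" by (simp add: algebra_simps)
      have n1: "norm ((a * e t - a) * e t) \<le> norm (a * e t - a) * 1"
        using n[of t] by (intro order_trans[OF norm_mult_ineq] mult_left_mono) auto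
      show ?thesis
        unfolding eq by (rule order_trans[OF norm_triangle_mono[OF n1 order_refl]]) simp
    qed
    moreover have "((\<lambda>t. 2 * norm (a * e t - a)) \<longlongrightarrow> 0) \<Phi>"
      using tendsto_mult[OF tendsto_const tendsto_norm_zero[OF LIM_zero[OF r]], of 2] by simp
    ultimately have "((\<lambda>t. a * (e t * e t) - a) \<longlongrightarrow> 0) \<Phi>"
      by (rule tendsto_zero_if_norm_le)
    then show ?thesis by (rule LIM_zero_cancel)
  qed
  ultimately show ?thesis
    using n by (auto simp: approximates_identity_def intro: norm_mult_le_1)
qed

text \<open>The zero algebra has to be excluded: it counts as nonunital, because a unit must have
  norm 1, but the norm of its unitization vanishes identically.\<close>

locale nonunital_algebra =
  fixes \<Phi> :: "'i filter" and e :: "'i \<Rightarrow> 'a::complex_banach_algebra"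
  assumes nonunital: "\<not> unital TYPE('a)" and nontrivial: "\<exists>b::'a. b \<noteq> 0"
    and \<Phi>: "\<Phi> \<noteq> bot" and e: "approximates_identity \<Phi> e"
begin

lemma carrier_eq: "(A1_carrier :: ('a \<times> complex) set) = UNIV"
  using nonunital by (simp add: A1_carrier_def)

lemma one_eq: "(A1_one :: 'a \<times> complex) = (0, 1)"
  using nonunital by (simp add: A1_one_def)

lemma norm_le_iff:
  fixes a :: 'a
  shows "A1_norm (a, l) \<le> K \<longleftrightarrow> (\<forall>c. norm c \<le> 1 \<longrightarrow> norm (a * c + l *\<^sub>C c) \<le> K)"
proof -
  have "bdd_above ((\<lambda>c. norm (a * c + l *\<^sub>C c)) ` {c. norm c \<le> 1})"
  proof (rule bdd_aboveI2)
    fix c :: 'a assume "c \<in> {c. norm c \<le> 1}"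
    then have c: "norm c \<le> 1" by simp
    have "norm (a * c + l *\<^sub>C c) \<le> norm a * norm c + cmod l * norm c"
      using norm_triangle_mono[OF norm_mult_ineq order_eq_refl[OF norm_scaleC]] .
    also have "\<dots> \<le> norm a * 1 + cmod l * 1" using c by (intro add_mono mult_left_mono) auto
    finally show "norm (a * c + l *\<^sub>C c) \<le> norm a + cmod l" by simp
  qed
  moreover have "{c::'a. norm c \<le> 1} \<noteq> {}" by (rule ex_in_conv[THEN iffD1], rule exI[of _ 0]) simp
  ultimately show ?thesis
    using nonunital by (simp add: A1_norm_def cSUP_le_iff)
qed

lemma norm_mult_le:
  fixes a :: 'a
  shows "norm c \<le> 1 \<Longrightarrow> norm (a * c + l *\<^sub>C c) \<le> A1_norm (a, l)"
  using norm_le_iff[of a l "A1_norm (a, l)"] by simp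

lemma A1_norm_nonneg: "0 \<le> A1_norm (a :: 'a, l)"
  using norm_mult_le[of 0 a l] by simp

lemma A1_norm_add: "A1_norm (a + b :: 'a, l + m) \<le> A1_norm (a, l) + A1_norm (b, m)"
  unfolding norm_le_iff
proof (intro allI impI)
  fix c :: 'a assume c: "norm c \<le> 1"
  have "(a + b) * c + (l + m) *\<^sub>C c = (a * c + l *\<^sub>C c) + (b * c + m *\<^sub>C c)"
    by (simp add: distrib_right scaleC_add_left)
  then show "norm ((a + b) * c + (l + m) *\<^sub>C c) \<le> A1_norm (a, l) + A1_norm (b, m)"
    using norm_triangle_mono[OF norm_mult_le[OF c] norm_mult_le[OF c]] by simp
qed

lemma A1_norm_embed: "A1_norm (a :: 'a, 0) \<le> norm a"
  unfolding norm_le_iff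
proof (intro allI impI)
  fix c :: 'a assume "norm c \<le> 1"
  then show "norm (a * c + 0 *\<^sub>C c) \<le> norm a"
    using norm_mult_ineq[of a c] mult_left_mono[of "norm c" 1 "norm a"] by simp
qed

lemma A1_norm_one: "A1_norm (0 :: 'a, 1) \<le> 1"
  unfolding norm_le_iff by (simp add: scaleC_one)

text \<open>If \<open>\<parallel>a + l1\<parallel> < \<bar>l\<bar>\<close>, then multiplication by \<open>b = - a / l\<close> differs from the identity by a strict
  contraction, so \<open>b\<close> divides itself and the quotient is a unit.\<close>

lemma cmod_le_A1_norm: "cmod l \<le> A1_norm (a :: 'a, l)"
proof (rule ccontr)
  assume "\<not> ?thesis"
  then have less: "A1_norm (a, l) < cmod l" by simp
  have l: "l \<noteq> 0" using less A1_norm_nonneg[of a l] by auto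
  define b where "b = (- 1 / l) *\<^sub>C a"
  define \<kappa> where "\<kappa> = A1_norm (a, l) / cmod l"
  have \<kappa>: "0 \<le> \<kappa>" "\<kappa> < 1"
    using less l A1_norm_nonneg[of a l] by (auto simp: \<kappa>_def divide_less_eq_1)
  have contr: "norm (c - b * c) \<le> \<kappa> * norm c" for c
  proof (cases "c = 0")
    case False
    define d where "d = (complex_of_real (1 / norm c)) *\<^sub>C c"
    have d: "norm d \<le> 1" using False by (simp add: d_def norm_scaleC norm_divide)
    have c: "c = complex_of_real (norm c) *\<^sub>C d"
      using False by (simp add: d_def scaleC_scaleC scaleC_one)
    have "d - b * d = (1 / l) *\<^sub>C (a * d + l *\<^sub>C d)"
      using l unfolding diff_eq_scaleC[of d]
      by (simp add: b_def mult_scaleC_left scaleC_scaleC scaleC_add_right scaleC_one add.commute)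
    then have "norm (d - b * d) \<le> \<kappa>"
      using norm_mult_le[OF d, of a l] l by (simp add: norm_scaleC norm_divide \<kappa>_def divide_right_mono)
    moreover have "c - b * c = complex_of_real (norm c) *\<^sub>C (d - b * d)"
      by (subst (1 2) c) (simp add: mult_scaleC_right diff_eq_scaleC scaleC_add_right scaleC_scaleC mult.commute)
    ultimately show ?thesis
      using mult_right_mono[of "norm (d - b * d)" \<kappa> "norm c"] by (simp add: norm_scaleC mult.commute)
  qed simp
  \<comment> \<open>A fixed point \<open>u\<close> satisfies \<open>b * u = b\<close>; as left
    multiplication by \<open>b\<close> is injective, \<open>u\<close> is then a left unit.\<close>
  have "\<exists>!x. b + (x - b * x) = x"
  proof (rule banach_fix_type[OF \<kappa>])
    have "dist (b + (x - b * x)) (b + (y - b * y)) = norm ((x - y) - b * (x - y))" for x y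
      by (simp add: dist_norm algebra_simps)
    then show "\<forall>x y. dist (b + (x - b * x)) (b + (y - b * y)) \<le> \<kappa> * dist x y"
      using contr by (simp add: dist_norm)
  qed
  then obtain u where u: "b + (u - b * u) = u" by blast
  have inj: "c = 0" if "b * c = 0" for c
  proof -
    have "(1 - \<kappa>) * norm c \<le> 0" using contr[of c] that by (simp add: algebra_simps)
    then show ?thesis using \<kappa> by (simp add: mult_le_0_iff)
  qed
  have left: "u * c = c" for c
  proof -
    have "b * u = b" using u by (simp add: algebra_simps)
    then have "b * (u * c - c) = 0" by (simp add: right_diff_distrib flip: mult.assoc)
    then show ?thesis using inj by fastforce
  qed
  have lim: "((\<lambda>t. c * e t) \<longlongrightarrow> c) \<Phi>" "((\<lambda>t. e t * c) \<longlongrightarrow> c) \<Phi>" and ne: "\<And>t. norm (e t) \<le> 1" for c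
    using e by (auto simp: approximates_identity_def)
  have right: "c * u = c" for c
  proof -
    have "(c * u - c) * e t = 0" for t by (simp add: left_diff_distrib mult.assoc left)
    then have "((\<lambda>t. 0) \<longlongrightarrow> c * u - c) \<Phi>" using lim(1)[of "c * u - c"] by simp
    then show ?thesis using \<Phi> by (simp add: tendsto_const_iff)
  qed
  \<comment> \<open>Since \<open>e t * u = e t\<close>, the net itself converges to \<open>u\<close>
    and passes on its norm bound; \<open>u = u * u\<close> gives the opposite bound.\<close>
  have "(e \<longlongrightarrow> u) \<Phi>" using lim(2)[of u] right by simp
  then have "norm u \<le> 1"
    using ne by (intro tendsto_upperbound[OF tendsto_norm _ \<Phi>]) auto
  moreover obtain b' :: 'a where "b' \<noteq> 0" using nontrivial by blast
  then have "u \<noteq> 0" using left[of b'] by auto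
  then have "1 \<le> norm u" using norm_mult_ineq[of u u] left[of u] by simp
  ultimately have "is_unit u" using left right by (simp add: is_unit_def)
  then show False using nonunital by (auto simp: unital_def)
qed

text \<open>Definiteness of the norm rests on \<open>cmod_le_A1_norm\<close>; it makes the limit
  that defines \<open>A1_exp\<close> unique.\<close>

lemma A1_norm_eq_0:
  assumes "A1_norm (a :: 'a, l) \<le> 0"
  shows "a = 0" "l = 0"
proof -
  have "cmod l \<le> 0" by (rule order_trans[OF cmod_le_A1_norm assms])
  then show l: "l = 0" by simp
  have "((\<lambda>t. a * e t) \<longlongrightarrow> a) \<Phi>" and "\<And>t. norm (e t) \<le> 1"
    using e by (auto simp: approximates_identity_def)
  moreover have "a * e t = 0" for t
  proof -
    have "norm (a * e t + l *\<^sub>C e t) \<le> 0"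
      by (rule order_trans[OF norm_mult_le assms]) fact
    then show ?thesis by (simp add: l)
  qed
  ultimately show "a = 0" using \<Phi> by (simp add: tendsto_const_iff)
qed

text \<open>The algebra has no unit, so the power \<open>k + 1\<close> of \<open>x\<close> is
  written as \<open>k\<close>-fold left multiplication applied to \<open>x\<close>, and the zeroth
  term of the exponential appears only as the second component 1.\<close>

lemma A1_exp_embed:
  fixes x :: 'a
  shows "summable (\<lambda>k. complex_of_real (1 / fact (Suc k)) *\<^sub>C (((*) x) ^^ k) x)" (is "summable ?t")
    and "norm (complex_of_real (1 / fact (Suc k)) *\<^sub>C (((*) x) ^^ k) x) \<le> norm x ^ Suc k / fact (Suc k)"
    and "A1_exp (x, 0) = (\<Sum>k. complex_of_real (1 / fact (Suc k)) *\<^sub>C (((*) x) ^^ k) x, 1)"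
proof -
  have pow: "norm ((((*) x) ^^ k) x) \<le> norm x ^ Suc k" for k
  proof (induction k)
    case (Suc k)
    then show ?case
      using mult_left_mono[OF Suc, of "norm x"] norm_mult_ineq[of x "(((*) x) ^^ k) x"] by simp
  qed simp
  have bound: "norm (?t k) \<le> norm x ^ Suc k / fact (Suc k)" for k
    using pow[of k] by (simp add: norm_scaleC norm_divide divide_right_mono del: fact_Suc power_Suc)
  show "norm (?t k) \<le> norm x ^ Suc k / fact (Suc k)" by (rule bound)
  have "summable (\<lambda>k. norm x ^ Suc k / fact (Suc k))"
    using summable_exp[of "norm x"] summable_Suc_iff[of "\<lambda>k. inverse (fact k) * norm x ^ k"]
    by (simp add: divide_inverse mult.commute)
  then show sm: "summable ?t"
    by (rule summable_comparison_test'[where N=0]) (rule bound)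
  have P: "A1_power (x, 0) (Suc k) = ((((*) x) ^^ k) x, 0)" for k
    by (induction k) (simp_all add: A1_mult_def one_eq scaleC_one)
  have S: "(\<Sum>k<Suc n. complex_of_real (1 / fact k) *\<^sub>C A1_power (x, 0) k) = (\<Sum>k<n. ?t k, 1)" for n
  proof (induction n)
    case 0
    show ?case by (simp add: one_eq scaleC_prod_def scaleC_one scaleC_complex_def)
  next
    case (Suc n)
    then show ?case
      by (subst sum.lessThan_Suc) (simp only: P, simp add: scaleC_prod_def scaleC_complex_def del: fact_Suc)
  qed
  let ?S = "\<lambda>n. \<Sum>k<n. complex_of_real (1 / fact k) *\<^sub>C A1_power (x, 0) k"
  let ?y = "(\<Sum>k. ?t k, 1 :: complex)"
  have conv: "(\<lambda>n. A1_norm (?S n - ?y)) \<longlonglongrightarrow> 0"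
  proof (rule LIMSEQ_imp_Suc)
    have "(\<lambda>n. (\<Sum>k<n. ?t k)) \<longlonglongrightarrow> (\<Sum>k. ?t k)" by (rule summable_LIMSEQ[OF sm])
    then have lim: "(\<lambda>n. norm ((\<Sum>k<n. ?t k) - (\<Sum>k. ?t k))) \<longlonglongrightarrow> 0"
      by (rule tendsto_norm_zero[OF LIM_zero])
    have "norm (A1_norm (?S (Suc n) - ?y)) \<le> norm ((\<Sum>k<n. ?t k) - (\<Sum>k. ?t k))" for n
      using A1_norm_embed[of "(\<Sum>k<n. ?t k) - (\<Sum>k. ?t k)"]
        A1_norm_nonneg[of "(\<Sum>k<n. ?t k) - (\<Sum>k. ?t k)" 0]
      unfolding S by (simp only: minus_prod_def fst_conv snd_conv diff_self real_norm_def abs_of_nonneg)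
    from tendsto_zero_if_norm_le[OF this lim]
    show "(\<lambda>n. A1_norm (?S (Suc n) - ?y)) \<longlonglongrightarrow> 0" .
  qed
  show "A1_exp (x, 0) = ?y"
    unfolding A1_exp_def carrier_eq
  proof (rule the_equality)
    fix y assume y: "y \<in> UNIV \<and> (\<lambda>n. A1_norm (?S n - y)) \<longlonglongrightarrow> 0"
    have neg: "A1_norm (- b :: 'a, - l) \<le> A1_norm (b, l)" for b l
      unfolding norm_le_iff
    proof (intro allI impI)
      fix c :: 'a assume "norm c \<le> 1"
      moreover have "- b * c + (- l) *\<^sub>C c = - (b * c + l *\<^sub>C c)"
        using scaleC_scaleC[of "-1" l c] uminus_eq_scaleC[of "l *\<^sub>C c"] by simp
      ultimately show "norm (- b * c + (- l) *\<^sub>C c) \<le> A1_norm (b, l)"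
        using norm_mult_le by (simp only: norm_minus_cancel)
    qed
    have "A1_norm (?y - y) \<le> A1_norm (?S n - y) + A1_norm (?S n - ?y)" for n
    proof -
      obtain b l where bl: "?S n - y = (b, l)" by fastforce
      obtain b' l' where bl': "?S n - ?y = (b', l')" by fastforce
      have "?y - y = (?S n - y) - (?S n - ?y)" by simp
      also have "\<dots> = (b + - b', l + - l')" unfolding bl bl' by simp
      finally show ?thesis
        using A1_norm_add[of b "- b'" l "- l'"] neg[of b' l'] unfolding bl bl' by simp
    qed
    moreover have "(\<lambda>n. A1_norm (?S n - y) + A1_norm (?S n - ?y)) \<longlonglongrightarrow> 0 + 0"
      using y conv by (intro tendsto_add) auto
    ultimately have "A1_norm (?y - y) \<le> 0 + 0"
      by (intro LIMSEQ_le_const) auto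
    then show "y = ?y"
      using A1_norm_eq_0[of "(\<Sum>k. ?t k) - fst y" "1 - snd y"] by (cases y) simp
  qed (use conv in simp)
qed

text \<open>The exponential of \<open>\<i> r h\<close> has norm 1 and differs from its linear part
  \<open>1 + \<i> r h\<close> by terms of total norm at most \<open>r^2\<close>.\<close>

lemma hermitian_bound:
  fixes h :: 'a
  assumes h: "norm h \<le> 1" "A1_hermitian (h, 0)" and r: "\<bar>r\<bar> \<le> 1" and c: "norm c \<le> 1"
  shows "norm (((\<i> * complex_of_real r) *\<^sub>C h) * c + 1 *\<^sub>C c) \<le> 1 + r\<^sup>2"
proof -
  define x where "x = (\<i> * complex_of_real r) *\<^sub>C h"
  define t where "t k = complex_of_real (1 / fact (Suc k)) *\<^sub>C (((*) x) ^^ k) x" for k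
  have x: "norm x \<le> \<bar>r\<bar>"
    using h mult_left_mono[of "norm h" 1 "\<bar>r\<bar>"] by (simp add: x_def norm_scaleC norm_mult)
  have "(\<i> * complex_of_real r) *\<^sub>C (h, 0 :: complex) = (x, 0)"
    by (simp add: scaleC_prod_def scaleC_complex_def x_def)
  then have "A1_norm (A1_exp (x, 0)) = 1"
    using h(2) unfolding A1_hermitian_def by metis
  then have s1: "A1_norm (\<Sum>k. t k, 1) \<le> 1"
    using A1_exp_embed(3)[of x] by (simp add: t_def)
  \<comment> \<open>Compares the tail with the geometric series of \<open>(1 / 2) ^ Suc k\<close>,
    whose sum is 1, so that the constant in front of \<open>r^2\<close> is 1.\<close>
  have fact_ge: "2 ^ Suc k \<le> (fact (Suc (Suc k)) :: real)" for k
  proof (induction k)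
    case (Suc k)
    have "2 ^ Suc (Suc k) = 2 * (2 ^ Suc k :: real)" by simp
    also have "\<dots> \<le> real (Suc (Suc (Suc k))) * fact (Suc (Suc k))"
      using Suc by (intro mult_mono) auto
    also have "\<dots> = fact (Suc (Suc (Suc k)))" by (simp only: fact_Suc[of "Suc (Suc k)"] of_nat_mult of_nat_id)
    finally show ?case .
  qed simp
  have tail: "norm (t (Suc k)) \<le> r\<^sup>2 * (1 / 2) ^ Suc k" for k
  proof -
    have "norm x ^ Suc (Suc k) \<le> \<bar>r\<bar> ^ Suc (Suc k)" using x by (intro power_mono) auto
    also have "\<dots> = r\<^sup>2 * \<bar>r\<bar> ^ k" by (simp add: power2_eq_square abs_mult[symmetric] mult.assoc[symmetric])
    also have "\<dots> \<le> r\<^sup>2 * 1" using r by (intro mult_left_mono power_le_one) auto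
    finally have 1: "norm x ^ Suc (Suc k) \<le> r\<^sup>2" by simp
    have "norm (t (Suc k)) \<le> norm x ^ Suc (Suc k) / fact (Suc (Suc k))"
      unfolding t_def by (rule A1_exp_embed(2))
    also have "\<dots> \<le> r\<^sup>2 / 2 ^ Suc k"
      using 1 fact_ge by (intro frac_le) auto
    finally show ?thesis by (simp add: power_divide)
  qed
  have "(\<lambda>k. r\<^sup>2 * (1 / 2) ^ Suc k) sums (r\<^sup>2 * 1)"
    by (intro sums_mult power_half_series)
  then have "norm (\<Sum>k. t (Suc k)) \<le> r\<^sup>2"
    using norm_suminf_le[of "\<lambda>k. t (Suc k)" "\<lambda>k. r\<^sup>2 * (1 / 2) ^ Suc k"] tail by (simp add: sums_iff)
  moreover have "(\<Sum>k. t (Suc k)) = (\<Sum>k. t k) - x"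
  proof -
    have "summable t" using A1_exp_embed(1)[of x] unfolding t_def .
    moreover have "t 0 = x" by (simp add: t_def scaleC_one)
    ultimately show ?thesis using suminf_split_head[of t] by simp
  qed
  ultimately have d: "norm ((\<Sum>k. t k) - x) \<le> r\<^sup>2" by simp
  have "x * c + 1 *\<^sub>C c = ((\<Sum>k. t k) * c + 1 *\<^sub>C c) - ((\<Sum>k. t k) - x) * c"
    by (simp add: algebra_simps)
  also have "norm \<dots> \<le> norm ((\<Sum>k. t k) * c + 1 *\<^sub>C c) + norm (((\<Sum>k. t k) - x) * c)"
    by (rule norm_triangle_ineq4)
  also have "\<dots> \<le> 1 + r\<^sup>2 * 1"
  proof (rule add_mono)
    show "norm ((\<Sum>k. t k) * c + 1 *\<^sub>C c) \<le> 1"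
      using norm_mult_le[OF c, of "\<Sum>k. t k" 1] s1 by simp
    show "norm (((\<Sum>k. t k) - x) * c) \<le> r\<^sup>2 * 1"
      using d c by (intro order_trans[OF norm_mult_ineq] mult_mono) auto
  qed
  finally show ?thesis by (simp add: x_def)
qed

text \<open>The unit has norm at most 1 and value 1, so a contractive functional already attains the
  supremum 1.\<close>

lemma A1_state_iff:
  "A1_state (\<omega> :: 'a \<times> complex \<Rightarrow> complex) \<longleftrightarrow>
    (\<forall>x y. \<omega> (x + y) = \<omega> x + \<omega> y) \<and> (\<forall>c x. \<omega> (c *\<^sub>C x) = c * \<omega> x) \<and>
    (\<forall>x. A1_norm x \<le> 1 \<longrightarrow> cmod (\<omega> x) \<le> 1) \<and> \<omega> (0, 1) = 1" (is "_ \<longleftrightarrow> ?R")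
proof
  assume st: "A1_state \<omega>"
  have "cmod (\<omega> x) \<le> 1" if "A1_norm x \<le> 1" for x
  proof -
    have "cmod (\<omega> x) \<le> (SUP x\<in>{x\<in>A1_carrier. A1_norm x \<le> 1}. cmod (\<omega> x))"
      using st that by (intro cSUP_upper) (auto simp: A1_state_def carrier_eq)
    then show ?thesis using st by (simp add: A1_state_def)
  qed
  then show ?R using st by (simp add: A1_state_def carrier_eq one_eq)
next
  assume R: ?R
  have bdd: "bdd_above ((\<lambda>x. cmod (\<omega> x)) ` {x. A1_norm x \<le> 1})"
    using R by (intro bdd_aboveI2[where M=1]) auto
  have one: "(0, 1) \<in> {x :: 'a \<times> complex. A1_norm x \<le> 1}" using A1_norm_one by simp
  have "(SUP x\<in>{x. A1_norm x \<le> 1}. cmod (\<omega> x)) = 1"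
  proof (rule antisym)
    show "(SUP x\<in>{x. A1_norm x \<le> 1}. cmod (\<omega> x)) \<le> 1"
      using R one by (intro cSUP_least) auto
    show "1 \<le> (SUP x\<in>{x. A1_norm x \<le> 1}. cmod (\<omega> x))"
      using cSUP_upper[OF one bdd] R by simp
  qed
  then show "A1_state \<omega>" using R bdd by (simp add: A1_state_def carrier_eq one_eq)
qed

lemma scaleC_pair: "c *\<^sub>C (a :: 'a, l :: complex) = (c *\<^sub>C a, c * l)"
  by (simp add: scaleC_prod_def scaleC_complex_def)

lemma A1_state_pairI:
  assumes "\<And>a b. \<phi> (a + b) = \<phi> a + \<phi> b" "\<And>c a. \<phi> (c *\<^sub>C a) = c * \<phi> (a :: 'a)"
    and "\<And>a l. A1_norm (a, l) \<le> 1 \<Longrightarrow> cmod (\<phi> a + l) \<le> 1"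
  shows "A1_state (\<lambda>x. \<phi> (fst x) + snd x)"
proof -
  have "\<phi> 0 = 0" using assms(1)[of 0 0] by simp
  then show ?thesis
    unfolding A1_state_iff using assms
    by (auto simp: scaleC_prod_def scaleC_complex_def distrib_left)
qed

lemma A1_state_restrict:
  assumes "A1_state (\<omega> :: 'a \<times> complex \<Rightarrow> complex)"
  shows "\<omega> (a, l) = \<omega> (a, 0) + l" "\<omega> (a + b, 0) = \<omega> (a, 0) + \<omega> (b, 0)"
    "\<omega> (c *\<^sub>C a, 0) = c * \<omega> (a, 0)" "cmod (\<omega> (a, 0)) \<le> norm a"
proof -
  have add: "\<And>x y. \<omega> (x + y) = \<omega> x + \<omega> y" and scale: "\<And>c x. \<omega> (c *\<^sub>C x) = c * \<omega> x"
    and bound: "\<And>x. A1_norm x \<le> 1 \<Longrightarrow> cmod (\<omega> x) \<le> 1" and one: "\<omega> (0, 1) = 1"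
    using assms unfolding A1_state_iff by auto
  show "\<omega> (a, l) = \<omega> (a, 0) + l"
    using add[of "(a, 0)" "l *\<^sub>C (0, 1)"] scale[of l "(0, 1)"] one by (simp add: scaleC_pair)
  show "\<omega> (a + b, 0) = \<omega> (a, 0) + \<omega> (b, 0)" using add[of "(a, 0)" "(b, 0)"] by simp
  show sc: "\<omega> (c *\<^sub>C a, 0) = c * \<omega> (a, 0)" for c a using scale[of c "(a, 0)"] by (simp add: scaleC_pair)
  show "cmod (\<omega> (a, 0)) \<le> norm a"
  proof (cases "a = 0")
    case True
    then show ?thesis using sc[of 0 0] by simp
  next
    case False
    let ?c = "complex_of_real (1 / norm a)"
    have "norm (?c *\<^sub>C a) \<le> 1" using False by (simp add: norm_scaleC norm_divide)
    then have "cmod (\<omega> (?c *\<^sub>C a, 0)) \<le> 1"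
      by (intro bound order_trans[OF A1_norm_embed])
    then have "cmod ?c * cmod (\<omega> (a, 0)) \<le> 1" unfolding sc norm_mult .
    then show ?thesis using False by (simp add: norm_divide field_simps)
  qed
qed

end

section \<open>Normalizing restrictions of states\<close>

lemma onorm_attained_approximately:
  fixes \<phi> :: "'a::real_normed_vector \<Rightarrow> complex"
  assumes \<phi>: "bounded_linear \<phi>" and \<epsilon>: "0 < \<epsilon>"
  shows "\<exists>a. norm a \<le> 1 \<and> onorm \<phi> - \<epsilon> < cmod (\<phi> a)"
proof (rule ccontr)
  interpret bounded_linear \<phi> by (rule \<phi>)
  assume "\<not> ?thesis"
  then have small: "cmod (\<phi> a) \<le> onorm \<phi> - \<epsilon>" if "norm a \<le> 1" for a
    using that not_le by blast
  have "onorm \<phi> \<le> onorm \<phi> - \<epsilon>"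
  proof (rule onorm_bound)
    show "0 \<le> onorm \<phi> - \<epsilon>" using small[of 0] by (simp add: zero)
    fix x
    show "norm (\<phi> x) \<le> (onorm \<phi> - \<epsilon>) * norm x"
    proof (cases "x = 0")
      case False
      have "cmod (\<phi> ((1 / norm x) *\<^sub>R x)) \<le> onorm \<phi> - \<epsilon>"
        using False by (intro small) simp
      then show ?thesis using False by (simp add: scaleR field_simps)
    qed (simp add: zero)
  qed
  then show False using \<epsilon> by simp
qed

text \<open>For \<open>a\<close> nearly norming, \<open>\<phi> (d t * (a * d t))\<close> tends to
  \<open>\<phi> a\<close>, so the hypothesis pushes the real parts of \<open>\<phi> (d t)\<close> up
  to the norm; as the moduli cannot exceed it, the imaginary parts vanish in the limit.\<close>

lemma tendsto_onorm:
  fixes \<phi> :: "'a::complex_banach_algebra \<Rightarrow> complex"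
  assumes \<phi>: "bounded_linear \<phi>" and d: "approximates_identity \<Phi> d"
    and le: "\<And>t a. norm a \<le> 1 \<Longrightarrow> cmod (\<phi> (d t * (a * d t))) \<le> Re (\<phi> (d t))"
  shows "((\<lambda>t. \<phi> (d t)) \<longlongrightarrow> complex_of_real (onorm \<phi>)) \<Phi>"
proof -
  interpret bounded_linear \<phi> by (rule \<phi>)
  have upper: "cmod (\<phi> (d t)) \<le> onorm \<phi>" for t
  proof -
    have "norm (d t) \<le> 1" using d by (simp add: approximates_identity_def)
    then have "onorm \<phi> * norm (d t) \<le> onorm \<phi> * 1"
      by (rule mult_left_mono) (rule onorm_pos_le[OF \<phi>])
    then show ?thesis using onorm[OF \<phi>, of "d t"] by simp
  qed
  have re: "((\<lambda>t. Re (\<phi> (d t))) \<longlongrightarrow> onorm \<phi>) \<Phi>"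
  proof (rule order_tendstoI)
    fix y assume y: "y < onorm \<phi>"
    then obtain a where a: "norm a \<le> 1" "onorm \<phi> - (onorm \<phi> - y) < cmod (\<phi> a)"
      using onorm_attained_approximately[OF \<phi>, of "onorm \<phi> - y"] by auto
    have "((\<lambda>t. cmod (\<phi> (d t * (a * d t)))) \<longlongrightarrow> cmod (\<phi> a)) \<Phi>"
      by (rule tendsto_norm[OF tendsto[OF approximates_identity_sandwich[OF d]]])
    then have "\<forall>\<^sub>F t in \<Phi>. y < cmod (\<phi> (d t * (a * d t)))"
      using a(2) by (intro order_tendstoD(1)) auto
    then show "\<forall>\<^sub>F t in \<Phi>. y < Re (\<phi> (d t))"
      by eventually_elim (rule less_le_trans[OF _ le[OF a(1)]])
  next
    fix y assume "onorm \<phi> < y"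
    then have "Re (\<phi> (d t)) < y" for t
      using complex_Re_le_cmod[of "\<phi> (d t)"] upper[of t] by linarith
    then show "\<forall>\<^sub>F t in \<Phi>. Re (\<phi> (d t)) < y" by simp
  qed
  let ?N = "onorm \<phi>"
  \<comment> \<open>A number of modulus at most \<open>?N\<close> whose real part is close to
    \<open>?N\<close> is itself close to \<open>?N\<close>.\<close>
  have bound: "norm ((cmod (\<phi> (d t) - complex_of_real ?N))\<^sup>2) \<le> 2 * ?N * (?N - Re (\<phi> (d t)))" for t
  proof -
    have "(cmod (\<phi> (d t) - complex_of_real ?N))\<^sup>2 = (cmod (\<phi> (d t)))\<^sup>2 - 2 * ?N * Re (\<phi> (d t)) + ?N\<^sup>2"
      unfolding cmod_power2 by (simp add: power2_eq_square algebra_simps)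
    moreover have "(cmod (\<phi> (d t)))\<^sup>2 \<le> ?N\<^sup>2" using upper by (intro power_mono) auto
    ultimately show ?thesis by (simp add: power2_eq_square algebra_simps)
  qed
  have "((\<lambda>t. 2 * ?N * (?N - Re (\<phi> (d t)))) \<longlongrightarrow> 2 * ?N * (?N - ?N)) \<Phi>"
    by (intro tendsto_mult tendsto_diff tendsto_const re)
  then have "((\<lambda>t. (cmod (\<phi> (d t) - complex_of_real ?N))\<^sup>2) \<longlongrightarrow> 0) \<Phi>"
    using tendsto_zero_if_norm_le[OF bound] by simp
  then have "((\<lambda>t. sqrt ((cmod (\<phi> (d t) - complex_of_real ?N))\<^sup>2)) \<longlongrightarrow> sqrt 0) \<Phi>"
    by (rule tendsto_real_sqrt)
  then have "((\<lambda>t. cmod (\<phi> (d t) - complex_of_real ?N)) \<longlongrightarrow> 0) \<Phi>" by simp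
  then show ?thesis by (rule LIM_zero_cancel[OF tendsto_norm_zero_cancel])
qed

text \<open>Apart from one state with nonzero restriction, this contraction of the unit ball is all
  that the remaining argument takes from the representation.\<close>

locale hermitian_algebra = nonunital_algebra \<Phi> e
  for \<Phi> :: "'i filter" and e :: "'i \<Rightarrow> 'a::complex_banach_algebra" +
  assumes contraction: "\<And>t a l s. A1_norm (a, l) \<le> 1 \<Longrightarrow>
      s = e t * e t \<or> s = (e t * e t) * (e t * e t) \<Longrightarrow>
      A1_norm (s * (a * s) + l *\<^sub>C (s * s) - s, 1) \<le> 1"
begin

text \<open>Rotating \<open>x = a + l1\<close> turns \<open>\<omega> (s x s)\<close> into its
  absolute value \<open>|v|\<close>. Then \<open>\<omega> (s x s + 1 - s)\<close> has modulus at
  most 1 and real part \<open>|v| + 1 - Re (\<omega> s)\<close>.\<close>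

lemma state_bound:
  assumes \<omega>: "A1_state \<omega>" and a: "A1_norm (a :: 'a, l) \<le> 1"
    and s: "s = e t * e t \<or> s = (e t * e t) * (e t * e t)"
  shows "cmod (\<omega> (s * (a * s), 0) + l * \<omega> (s * s, 0)) \<le> Re (\<omega> (s, 0))"
proof -
  note R = A1_state_restrict[OF \<omega>]
  define v where "v = \<omega> (s * (a * s), 0) + l * \<omega> (s * s, 0)"
  obtain w where w: "cmod w = 1" "w * v = complex_of_real (cmod v)"
    by (rule unimodular_rotation)
  have "A1_norm (w *\<^sub>C a, w * l) \<le> 1"
    unfolding norm_le_iff
  proof (intro allI impI)
    fix c :: 'a assume c: "norm c \<le> 1"
    have "(w *\<^sub>C a) * c + (w * l) *\<^sub>C c = w *\<^sub>C (a * c + l *\<^sub>C c)"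
      by (simp add: mult_scaleC_left scaleC_add_right scaleC_scaleC)
    then show "norm ((w *\<^sub>C a) * c + (w * l) *\<^sub>C c) \<le> 1"
      using norm_mult_le[OF c, of a l] a w by (simp add: norm_scaleC)
  qed
  from contraction[OF this s]
  have "A1_norm (w *\<^sub>C (s * (a * s)) + (w * l) *\<^sub>C (s * s) + (-1) *\<^sub>C s, 1) \<le> 1"
    by (simp add: mult_scaleC_left mult_scaleC_right flip: uminus_eq_scaleC)
  then have "cmod (\<omega> (w *\<^sub>C (s * (a * s)) + (w * l) *\<^sub>C (s * s) + (-1) *\<^sub>C s, 1)) \<le> 1"
    using \<omega> unfolding A1_state_iff by blast
  moreover have "\<omega> (w *\<^sub>C (s * (a * s)) + (w * l) *\<^sub>C (s * s) + (-1) *\<^sub>C s, 1) = w * v - \<omega> (s, 0) + 1"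
    unfolding R(1)[of _ 1] R(2) R(3) by (simp add: v_def algebra_simps)
  ultimately have "cmod (w * v - \<omega> (s, 0) + 1) \<le> 1" by (simp only:)
  then have "Re (w * v - \<omega> (s, 0) + 1) \<le> 1"
    by (rule order_trans[OF complex_Re_le_cmod])
  then show ?thesis unfolding w(2) by (simp add: v_def)
qed

lemma normalized_restriction:
  fixes \<omega> :: "'a \<times> complex \<Rightarrow> complex"
  assumes \<omega>: "A1_state \<omega>"
  defines "\<phi> \<equiv> A1_restrict \<omega>"
  shows "bounded_linear \<phi>" "onorm \<phi> \<le> 1"
    and "\<phi> \<noteq> (\<lambda>_. 0) \<Longrightarrow> \<exists>\<psi>. state \<psi> \<and> \<phi> = (\<lambda>a. complex_of_real (onorm \<phi>) * \<psi> a)"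
proof -
  note R = A1_state_restrict[OF \<omega>]
  have \<phi>: "\<phi> a = \<omega> (a, 0)" for a by (simp add: \<phi>_def A1_restrict_def)
  have scale: "\<phi> (c *\<^sub>C a) = c * \<phi> a" for c a by (simp add: \<phi> R(2-4))
  show bl: "bounded_linear \<phi>"
  proof (rule bounded_linear_intro[where K=1])
    show "\<phi> (r *\<^sub>R a) = r *\<^sub>R \<phi> a" for r a
      by (simp add: scaleR_scaleC scale scaleC_complex_def)
  qed (simp_all add: \<phi> R(2-4))
  show le1: "onorm \<phi> \<le> 1" by (rule onorm_bound) (simp_all add: \<phi> R(2-4))
  assume ne: "\<phi> \<noteq> (\<lambda>_. 0)"
  let ?N = "onorm \<phi>"
  have N: "0 < ?N" using onorm_pos_lt[OF bl] ne by auto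
  define d where "d = (\<lambda>t. e t * e t)"
  have d: "approximates_identity \<Phi> d" unfolding d_def by (rule approximates_identity_square[OF e])
  have dd: "approximates_identity \<Phi> (\<lambda>t. d t * d t)" by (rule approximates_identity_square[OF d])
  have "((\<lambda>t. \<phi> (d t)) \<longlongrightarrow> complex_of_real ?N) \<Phi>"
  proof (rule tendsto_onorm[OF bl d])
    fix t and a :: 'a assume "norm a \<le> 1"
    then have "A1_norm (a, 0) \<le> 1" using A1_norm_embed[of a] by linarith
    from state_bound[OF \<omega> this, of "d t" t] show "cmod (\<phi> (d t * (a * d t))) \<le> Re (\<phi> (d t))"
      by (simp add: \<phi> d_def)
  qed
  then have lim2: "((\<lambda>t. Re (\<phi> (d t))) \<longlongrightarrow> ?N) \<Phi>"
    by (auto dest: tendsto_Re)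
  \<comment> \<open>The same estimate with \<open>d t * d t\<close>, the fourth power of
    \<open>e t\<close>; this limit becomes the coefficient of \<open>l\<close> when
    \<open>state_bound\<close> is applied to \<open>a + l1\<close> with
    \<open>s = d t\<close>.\<close>
  have lim4: "((\<lambda>t. \<phi> (d t * d t)) \<longlongrightarrow> complex_of_real ?N) \<Phi>"
  proof (rule tendsto_onorm[OF bl dd])
    fix t and a :: 'a assume "norm a \<le> 1"
    then have "A1_norm (a, 0) \<le> 1" using A1_norm_embed[of a] by linarith
    from state_bound[OF \<omega> this, of "d t * d t" t]
    show "cmod (\<phi> (d t * d t * (a * (d t * d t)))) \<le> Re (\<phi> (d t * d t))"
      by (simp add: \<phi> d_def)
  qed
  define \<psi> where "\<psi> a = \<phi> a / complex_of_real ?N" for a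
  have st: "A1_state (\<lambda>x. \<psi> (fst x) + snd x)"
  proof (rule A1_state_pairI)
    show "\<psi> (a + b) = \<psi> a + \<psi> b" "\<psi> (c *\<^sub>C a) = c * \<psi> a" for a b c
      by (simp_all add: \<psi>_def \<phi> R(2-4) add_divide_distrib)
    fix a :: 'a and l assume al: "A1_norm (a, l) \<le> 1"
    have "((\<lambda>t. cmod (\<phi> (d t * (a * d t)) + l * \<phi> (d t * d t))) \<longlongrightarrow> cmod (\<phi> a + l * complex_of_real ?N)) \<Phi>"
      by (intro tendsto_norm tendsto_add tendsto_mult tendsto_const lim4
          bounded_linear.tendsto[OF bl] approximates_identity_sandwich[OF d])
    moreover have "\<forall>\<^sub>F t in \<Phi>. cmod (\<phi> (d t * (a * d t)) + l * \<phi> (d t * d t)) \<le> Re (\<phi> (d t))"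
    proof (intro always_eventually allI)
      show "cmod (\<phi> (d t * (a * d t)) + l * \<phi> (d t * d t)) \<le> Re (\<phi> (d t))" for t
        using state_bound[OF \<omega> al, of "d t" t] by (simp add: \<phi> d_def)
    qed
    ultimately have "cmod (\<phi> a + l * complex_of_real ?N) \<le> ?N"
      using tendsto_le[OF \<Phi> lim2] by blast
    moreover have "\<psi> a + l = (\<phi> a + l * complex_of_real ?N) / complex_of_real ?N"
      using N by (simp add: \<psi>_def add_divide_distrib)
    ultimately show "cmod (\<psi> a + l) \<le> 1" using N by (simp add: norm_divide)
  qed
  have "onorm \<psi> = 1"
  proof -
    have "\<psi> = (\<lambda>a. inverse ?N *\<^sub>R \<phi> a)"
      by (simp add: fun_eq_iff \<psi>_def scaleR_conv_of_real divide_inverse mult.commute)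
    then show ?thesis using onorm_scaleR[OF bl, of "inverse ?N"] N by simp
  qed
  moreover have "bounded_linear \<psi>"
    unfolding \<psi>_def using bounded_linear_compose[OF bounded_linear_divide bl] .
  moreover have "\<psi> (c *\<^sub>C a) = c * \<psi> a" for c a by (simp add: \<psi>_def scale)
  moreover have "\<psi> = A1_restrict (\<lambda>x. \<psi> (fst x) + snd x)" by (simp add: A1_restrict_def)
  ultimately have "state \<psi>" unfolding state_def using st by blast
  moreover have "\<phi> = (\<lambda>a. complex_of_real ?N * \<psi> a)" using N by (simp add: \<psi>_def)
  ultimately show "\<exists>\<psi>. state \<psi> \<and> \<phi> = (\<lambda>a. complex_of_real ?N * \<psi> a)" by blast
qed

lemma scaled_if_state_exists:
  assumes ex: "A1_state \<omega>\<^sub>0" "A1_restrict \<omega>\<^sub>0 \<noteq> (\<lambda>_::'a. 0)"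
  shows "scaled TYPE('a)"
proof -
  have "A1_restrict \<omega> \<in> quasistates" if \<omega>: "A1_state \<omega>" for \<omega> :: "'a \<times> complex \<Rightarrow> complex"
  proof (cases "A1_restrict \<omega> = (\<lambda>_. 0)")
    case True
    \<comment> \<open>The zero functional is a quasistate only as 0 times some state; normalizing
      the given restriction supplies one.\<close>
    obtain \<psi> :: "'a \<Rightarrow> complex" where "state \<psi>" using normalized_restriction(3)[OF ex] by blast
    moreover have "A1_restrict \<omega> = (\<lambda>a. complex_of_real 0 * \<psi> a)" using True by simp
    ultimately show ?thesis
      unfolding quasistates_def by (intro CollectI exI[of _ 0] exI[of _ \<psi>] conjI) simp_all
  next
    case False
    from normalized_restriction(3)[OF \<omega> False] obtain \<psi> where
      "state \<psi>" "A1_restrict \<omega> = (\<lambda>a. complex_of_real (onorm (A1_restrict \<omega>)) * \<psi> a)" by blast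
    moreover have "onorm (A1_restrict \<omega>) \<in> {0..1}"
      using normalized_restriction(1,2)[OF \<omega>] onorm_pos_le by auto
    ultimately show ?thesis
      unfolding quasistates_def by (intro CollectI exI[of _ "onorm (A1_restrict \<omega>)"] exI[of _ \<psi>] conjI)
  qed
  moreover have "\<exists>\<omega>. A1_state \<omega> \<and> \<phi> = A1_restrict \<omega>" if q: "\<phi> \<in> quasistates" for \<phi> :: "'a \<Rightarrow> complex"
  proof -
    obtain r \<psi> where r: "r \<in> {0..1}" "state \<psi>" "\<phi> = (\<lambda>a. complex_of_real r * \<psi> a)"
      using q by (auto simp: quasistates_def)
    then obtain \<omega> where \<omega>: "A1_state \<omega>" "\<psi> = A1_restrict \<omega>" by (auto simp: state_def)
    note R = A1_state_restrict[OF \<omega>(1)]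
    have \<phi>: "\<phi> a = complex_of_real r * \<omega> (a, 0)" for a by (simp add: r(3) \<omega>(2) A1_restrict_def)
    have "A1_state (\<lambda>x. \<phi> (fst x) + snd x)"
    proof (rule A1_state_pairI)
      show "\<phi> (a + b) = \<phi> a + \<phi> b" "\<phi> (c *\<^sub>C a) = c * \<phi> a" for a b c
        by (simp_all add: \<phi> R(2-4) algebra_simps)
      fix a :: 'a and l assume al: "A1_norm (a, l) \<le> 1"
      \<comment> \<open>A convex combination of \<omega> and the functional
        \<open>(a, l) \<mapsto> l\<close>, which is contractive because \<open>cmod l\<close> is at
        most the norm of \<open>a + l1\<close>.\<close>
      have "\<phi> a + l = complex_of_real r * \<omega> (a, l) + complex_of_real (1 - r) * l"
        unfolding \<phi> R(1)[of a l] by (simp add: algebra_simps)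
      then have "cmod (\<phi> a + l) \<le> cmod (complex_of_real r * \<omega> (a, l)) + cmod (complex_of_real (1 - r) * l)"
        by (simp only: norm_triangle_ineq)
      also have "\<dots> = r * cmod (\<omega> (a, l)) + (1 - r) * cmod l"
        using r(1) by (simp add: norm_mult flip: of_real_diff del: of_real_1)
      also have "\<dots> \<le> r * 1 + (1 - r) * 1"
      proof (intro add_mono mult_left_mono)
        show "cmod (\<omega> (a, l)) \<le> 1" using \<omega>(1) al unfolding A1_state_iff by blast
        show "cmod l \<le> 1" using cmod_le_A1_norm[of l a] al by linarith
      qed (use r(1) in auto)
      finally show "cmod (\<phi> a + l) \<le> 1" by simp
    qed
    moreover have "\<phi> = A1_restrict (\<lambda>x. \<phi> (fst x) + snd x)" by (simp add: A1_restrict_def)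
    ultimately show ?thesis by blast
  qed
  ultimately show ?thesis unfolding scaled_def by blast
qed

end

text \<open>In the nonunital case every element of the unitization lies in the unit ball, so a
  functional with value 1 at the unit exceeds 1 there. There are no states, and both sets are
  empty.\<close>

lemma scaled_if_trivial:
  assumes triv: "\<And>b :: 'a::complex_banach_algebra. b = 0"
  shows "scaled TYPE('a)"
proof (cases "unital TYPE('a)")
  case False
  have "A1_norm x \<le> 1" for x :: "'a \<times> complex"
  proof -
    have "norm (fst x * c + snd x *\<^sub>C c) = 0" for c
      using triv[of "fst x * c + snd x *\<^sub>C c"] by simp
    moreover have "{c::'a. norm c \<le> 1} \<noteq> {}"
      by (rule ex_in_conv[THEN iffD1], rule exI[of _ 0]) simp
    ultimately show ?thesis using False by (simp add: A1_norm_def)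
  qed
  note bound = this
  have "\<not> A1_state \<omega>" for \<omega> :: "'a \<times> complex \<Rightarrow> complex"
  proof
    assume st: "A1_state \<omega>"
    have "cmod (\<omega> (2 *\<^sub>C A1_one)) \<le> (SUP x\<in>{x\<in>A1_carrier. A1_norm x \<le> 1}. cmod (\<omega> x))"
      using st False bound
      by (intro cSUP_upper) (auto simp: A1_state_def A1_carrier_def)
    moreover have "\<omega> (2 *\<^sub>C A1_one) = 2 * \<omega> A1_one"
    proof -
      have "\<forall>c. \<forall>x\<in>A1_carrier. \<omega> (c *\<^sub>C x) = c * \<omega> x"
        using st unfolding A1_state_def by blast
      then show ?thesis using False by (simp only: A1_carrier_def if_False ball_UNIV)
    qed
    ultimately show False using st by (simp add: A1_state_def)
  qed
  then have "A1_restrict ` {\<omega>. A1_state \<omega>} = (quasistates :: ('a \<Rightarrow> complex) set)"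
    by (simp add: quasistates_def state_def)
  then show ?thesis by (simp add: scaled_def)
qed (simp add: scaled_def)

theorem proposition6p7:
  fixes p :: real and M :: "'x measure"
    and \<Lambda> :: "'i set" and le :: "'i \<Rightarrow> 'i \<Rightarrow> bool"
    and e :: "'i \<Rightarrow> 'a::complex_banach_algebra"
  assumes "1 < p"
    and "Lp_operator_algebra p M TYPE('a)"
    and "is_cai \<Lambda> le e"
    and "\<forall>t\<in>\<Lambda>. A1_hermitian (e t, 0)"
  shows "scaled TYPE('a)"
proof (cases "unital TYPE('a) \<or> (\<forall>b::'a. b = 0)")
  case True
  then show ?thesis using scaled_if_trivial scaled_def by blast
next
  case False
  then have nonunital: "\<not> unital TYPE('a)" and nontriv: "\<exists>b::'a. b \<noteq> 0" by auto
  define \<Phi> where "\<Phi> = tail_filter \<Lambda> le"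
  have dir: "directed_set \<Lambda> le" using assms(3) by (simp add: is_cai_def)
  note ev = tail_filter_eventually[OF dir, folded \<Phi>_def]
  obtain t\<^sub>0 where t0: "t\<^sub>0 \<in> \<Lambda>" using dir by (auto simp: directed_set_def)
  \<comment> \<open>The locales bound the net at every index of its type, so outside
    \<open>\<Lambda>\<close> it takes the value at a fixed member; the tail filter does not see the
    change.\<close>
  define d where "d t = (if t \<in> \<Lambda> then e t else e t\<^sub>0)" for t
  have d\<Lambda>: "\<exists>u\<in>\<Lambda>. d t = e u" for t using t0 by (auto simp: d_def)
  have d_norm: "norm (d t) \<le> 1" for t using d\<Lambda>[of t] assms(3) by (auto simp: is_cai_def)
  have d_herm: "A1_hermitian (d t, 0)" for t using d\<Lambda>[of t] assms(4) by auto
  have d: "approximates_identity \<Phi> d"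
    unfolding approximates_identity_def
  proof (intro conjI allI d_norm)
    fix a
    have "((\<lambda>t. e t * a) \<longlongrightarrow> a) \<Phi>" "((\<lambda>t. a * e t) \<longlongrightarrow> a) \<Phi>"
      using assms(3) by (auto simp: is_cai_def \<Phi>_def)
    moreover have "\<forall>\<^sub>F t in \<Phi>. e t * a = d t * a" "\<forall>\<^sub>F t in \<Phi>. a * e t = a * d t"
      using ev(2) by (eventually_elim, simp add: d_def)+
    ultimately show "((\<lambda>t. d t * a) \<longlongrightarrow> a) \<Phi>" "((\<lambda>t. a * d t) \<longlongrightarrow> a) \<Phi>"
      by (auto elim: Lim_transform_eventually)
  qed
  interpret N: nonunital_algebra \<Phi> d
    by unfold_locales (use nonunital nontriv ev d in auto)
  obtain T :: "'a \<Rightarrow> _" where T: "lp_representation p (p / (p - 1)) M T"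
    using lp_representation_exists[OF assms(1,2)] by blast
  interpret T: lp_representation p "p / (p - 1)" M T by (rule T)
  interpret T: lp_approximate_identity p "p / (p - 1)" M T \<Phi> d
    by unfold_locales (use ev d in \<open>auto simp: approximates_identity_def\<close>)
  interpret H: hermitian_algebra \<Phi> d
  proof unfold_locales
    fix t and a :: 'a and l s
    assume al: "A1_norm (a, l) \<le> 1" and s: "s = d t * d t \<or> s = d t * d t * (d t * d t)"
    show "A1_norm (s * (a * s) + l *\<^sub>C (s * s) - s, 1) \<le> 1"
      unfolding N.norm_le_iff
    proof (intro allI impI)
      fix c :: 'a assume c: "norm c \<le> 1"
      show "norm ((s * (a * s) + l *\<^sub>C (s * s) - s) * c + 1 *\<^sub>C c) \<le> 1"
      proof (rule T.hermitian_contraction[OF d_norm _ _ c s])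
        show "norm (a * c + l *\<^sub>C c) \<le> 1" if "norm c \<le> 1" for c
          using al that unfolding N.norm_le_iff by blast
      qed (rule N.hermitian_bound[OF d_norm d_herm])
    qed
  qed
  obtain b :: 'a where "b \<noteq> 0" using nontriv by blast
  from T.vector_state[OF this] obtain \<omega> :: "'a \<Rightarrow> complex" where
    \<omega>: "\<forall>a b. \<omega> (a + b) = \<omega> a + \<omega> b" "\<forall>c a. \<omega> (c *\<^sub>C a) = c * \<omega> a"
      "\<forall>a l. (\<forall>c. norm c \<le> 1 \<longrightarrow> norm (a * c + l *\<^sub>C c) \<le> 1) \<longrightarrow> cmod (\<omega> a + l) \<le> 1"
    and ne: "\<exists>a. \<omega> a \<noteq> 0"
    by blast
  have "A1_state (\<lambda>x. \<omega> (fst x) + snd x)"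
    using \<omega> unfolding N.norm_le_iff[symmetric] by (intro N.A1_state_pairI) blast+
  moreover have "A1_restrict (\<lambda>x. \<omega> (fst x) + snd x) \<noteq> (\<lambda>_. 0)"
    using ne by (auto simp: A1_restrict_def fun_eq_iff)
  ultimately show ?thesis by (rule H.scaled_if_state_exists)
qed

end
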